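(* Let $k\geqslant1$ be fixed and let $(\hat f(j))_{j\geqslant1}$ be a fixed sequence of complex numbers with $|\hat f(j)|\leqslant1$, defining multiplicative functions $f$ on each $S_n$. Then: (1) if the series $\sum_{j\geqslant1,(j,k)=1}\frac{1-\Re(\hat f(j)e^{-ixj})}{j}$ diverges for every $x\in[-\pi,\pi]$, then $\lim_{n\to\infty}\mathbf M_n^{(k)}f=0$; (2) if $\sum_{j\geqslant1,(j,k)=1}\frac{1-\Re(\hat f(j)e^{-ix_0j})}{j}<\infty$ for some $x_0\in[-\pi,\pi]$, then as $n\to\infty$ $$\mathbf M_n^{(k)}f=e^{ix_0n}\exp\Big\{\sum_{\substack{1\leqslant j\leqslant n\\(j,k)=1}}\frac{\hat f(j)e^{-ix_0j}-1}{j}\Big\}\prod_{\substack{j\leqslant n\\(j,k)>1}}\frac{1+\sum_{s\geqslant1:q_k(j)\mid s}\frac{(\hat f(j)e^{-ix_0j})^s}{j^ss!}}{1+\sum_{s\geqslant1:q_k(j)\mid s}\frac{1}{j^ss!}}+o(1).$$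
   Context: $S_n^{(k)}=\{x^k:x\in S_n\}$ and $\mathbf M_n^{(k)}f=|S_n^{(k)}|^{-1}\sum_{\sigma\in S_n^{(k)}}f(\sigma)$, where the multiplicative function $f$ is the product over the cycles of $\sigma$ of $\hat f(\text{cycle length})$. If $k=\prod_pp^{l_k(p)}$, then $q_k(j)=\prod_{p\mid(k,j)}p^{l_k(p)}$. *)

theory Defs
  imports
    "HOL-Analysis.Analysis"
    "HOL-Combinatorics.Orbits"
    "HOL-Computational_Algebra.Primes"
begin

definition power_perms :: "nat \<Rightarrow> nat \<Rightarrow> (nat \<Rightarrow> nat) set" where
  "power_perms k n = (\<lambda>x. x ^^ k) ` {x. x permutes {1..n}}"

text \<open>A cycle is represented by its underlying set of points; fixed points are cycles of length 1.\<close>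

definition perm_cycles :: "nat \<Rightarrow> (nat \<Rightarrow> nat) \<Rightarrow> nat set set" where
  "perm_cycles n \<sigma> = orbit \<sigma> ` {1..n}"

definition mult_fun :: "(nat \<Rightarrow> complex) \<Rightarrow> nat \<Rightarrow> (nat \<Rightarrow> nat) \<Rightarrow> complex" where
  "mult_fun fhat n \<sigma> = (\<Prod>C\<in>perm_cycles n \<sigma>. fhat (card C))"

definition mean_power_perms :: "nat \<Rightarrow> nat \<Rightarrow> ((nat \<Rightarrow> nat) \<Rightarrow> complex) \<Rightarrow> complex" where
  "mean_power_perms k n f = (\<Sum>\<sigma>\<in>power_perms k n. f \<sigma>) / of_nat (card (power_perms k n))"

definition q_part :: "nat \<Rightarrow> nat \<Rightarrow> nat" where
  "q_part k j = (\<Prod>p\<in>prime_factors (gcd k j). p ^ multiplicity p k)"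

end

theory Submission
  imports Defs "HOL-Real_Asymp.Real_Asymp"
begin

text \<open>
  A permutation is a \<open>k\<close>-th power iff for every \<open>j\<close> the number of its cycles of length \<open>j\<close> is
  divisible by \<open>q\<^sub>k(j)\<close>. So the mean is a quotient of two \<open>n\<close>-th coefficients of products of an exponential
  \<open>exp (\<Sum> f(j) z\<^sup>j / j)\<close> over the \<open>j\<close> coprime to \<open>k\<close> and of factors \<open>1 + O(j\<^sup>-\<^sup>2)\<close> over the other \<open>j\<close>;
  the latter only contribute a convergent infinite product, and everything is about the former.

  Let \<open>\<theta>\<close> be the density of the integers coprime to \<open>k\<close>. For \<open>f = 1\<close> and lengths restricted to \<open>j \<ge> Y\<close>,
  the sums of the coefficients twisted by additive characters mod \<open>k\<close> satisfy an almost diagonal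
  recursion whose growth exponents are less than \<open>\<theta>\<close> except for the trivial character. This shows that
  the coefficients are asymptotic to \<open>\<kappa> exp (- H(Y - 1)) n powr (\<theta> - 1)\<close>, uniformly as \<open>n / Y\<close> tends to infinity.

  If the series diverges everywhere, then by Dini's argument \<open>exp (\<Sum> f(j) z\<^sup>j / j)\<close>, truncated at \<open>n\<close>, is
  \<open>o(n powr \<theta>)\<close> uniformly on the unit circle. Parseval's identity for its logarithmic derivative times
  itself bounds the mean square of the coefficients, and the recursion for the coefficients turns
  this into a pointwise bound.

  If the series converges at \<open>x\<^sub>0\<close>, one may assume \<open>x\<^sub>0 = 0\<close>. Replacing \<open>f(j)\<close> by \<open>1\<close> for \<open>j \<ge> Y = n / D\<close>
  changes the coefficient by a negligible amount, because \<open>\<Sum> \<bar>f(j) - 1\<bar>\<^sup>2 / j\<close> converges; for the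
  modified \<open>f\<close> the asymptotics of the first part show that the lengths \<open>j < Y\<close> contribute
  the factor \<open>exp (\<Sum> (f(j) - 1) / j)\<close> up to an error that is small for large \<open>D\<close>.
\<close>

section \<open>Cycle counts\<close>

text \<open>Summing the coefficient recursion over \<open>k\<close> consecutive indices separates
  the characters up to a second order error. The sum twisted by the \<open>r\<close>-th character
  then grows like \<open>n\<close> to the real part of the \<open>r\<close>-th Fourier coefficient
  of the coprimality indicator. For \<open>r\<close> prime to nothing but different from 0 this is
  below theta, since the residue 1 is a unit at which the character is not 1. The recursion yields a
  limit L(Y) that is not explicit. Splitting the lengths at \<open>Y\<close> identifies its
  dependence on \<open>Y\<close>: the short lengths have total mass exp (H(Y - 1)), so exp (H(Y -
  1)) L(Y) does not depend on \<open>Y\<close>. In the convergent case the rough coefficients at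
  small arguments may be far larger than the main term, so no two-sided estimate covers the whole
  convolution. A lower bound on a range suffices: the weighted deviations from the main term add up
  to 0, so their absolute values sum to twice the negative parts. The factor exp (sum of (f(j) - 1)
  / j) need not converge. It varies slowly, and a convolution with an absolutely summable sequence
  cannot tell it from a constant.\<close>

definition cycle_count :: "'a set \<Rightarrow> ('a \<Rightarrow> 'a) \<Rightarrow> nat \<Rightarrow> nat" where
  "cycle_count X \<sigma> j = card {C \<in> orbit \<sigma> ` X. card C = j}"

lemma orbit_eq_if_mem:
  assumes "permutation f" "y \<in> orbit f x"
  shows "orbit f y = orbit f x"
  using orbit_cyclic_eq3[OF cyclic_on_orbit'[OF assms(1)] assms(2)] .

lemma orbits_eq_or_disjnt:
  assumes "permutation f"
  shows "orbit f x = orbit f y \<or> orbit f x \<inter> orbit f y = {}"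
  using orbit_eq_if_mem[OF assms] by blast

lemma Union_orbits:
  assumes "f permutes X" "finite X"
  shows "\<Union> (orbit f ` X) = X"
  using permutes_orbit_subset[OF assms(1)]
    permutation_self_in_orbit[OF permutation_permutes[THEN iffD2, OF exI, OF conjI, OF assms(2,1)]]
  by blast

text \<open>As \<open>q\<close> fixes \<open>a\<close>, the composite sends \<open>a\<close> to
  \<open>b\<close> and the \<open>q\<close>-preimage of \<open>b\<close> to \<open>a\<close>. So
  \<open>a\<close> is spliced into the cycle of \<open>b\<close>, and no other cycle changes. This
  is the combinatorial step of the exponential formula.\<close>

lemma orbits_insert_transpose:
  assumes "finite S" "q permutes S" "a \<notin> S" "b \<in> S"
  shows "orbit (Transposition.transpose a b \<circ> q) ` insert a S
         = insert (insert a (orbit q b)) (orbit q ` S - {orbit q b})"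
proof -
  define r where "r = Transposition.transpose a b \<circ> q"
  have pq: "permutation q" using assms permutation_permutes by blast
  have rp: "r permutes insert a S" unfolding r_def
    by (rule permutes_compose[OF permutes_subset[OF assms(2)] permutes_swap_id]) (use assms in auto)
  then have pr: "permutation r" using assms permutation_permutes by blast
  have qa: "q a = a" using assms permutes_not_in by metis
  have bb: "b \<in> orbit q b" using permutation_self_in_orbit[OF pq] .
  have sub: "orbit q b \<subseteq> S" using permutes_orbit_subset assms by metis
  have other: "orbit r x = orbit q x" if "x \<in> S" "orbit q x \<noteq> orbit q b" for x
  proof (rule orbit_cong)
    show "x \<in> orbit q x" using permutation_self_in_orbit[OF pq] .
    fix s assume s: "s \<in> orbit q x"
    then have "q s \<in> orbit q x" by (rule orbit.step)
    then have "q s \<in> S" "q s \<noteq> b"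
      using permutes_orbit_subset[OF assms(2) that(1)] that(2) orbit_eq_if_mem[OF pq] by blast+
    then show "r s = q s" using assms(3) by (auto simp: r_def Transposition.transpose_def)
  qed
  have ra: "r a = b" by (simp add: r_def qa)
  have "orbit r a = insert a (orbit q b)"
  proof
    have "y \<in> insert a (orbit q b)" if "y \<in> orbit r a" for y
      using that
    proof induction
      case base then show ?case using ra bb by simp
    next
      case (step y)
      show ?case
      proof (cases "y = a")
        case False
        with step have "q y \<in> orbit q b" by (auto intro: orbit.step)
        then show ?thesis using bb by (auto simp: r_def Transposition.transpose_def)
      qed (use ra bb in simp)
    qed
    then show "orbit r a \<subseteq> insert a (orbit q b)" by blast
    \<comment> \<open>On the \<open>q\<close>-orbit of \<open>b\<close> the maps \<open>r\<close>
      and \<open>q\<close> agree except where \<open>q\<close> returns to \<open>b\<close>; there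
      the point \<open>b = r a\<close> is in the \<open>r\<close>-orbit anyway.\<close>
    have "(q ^^ n) b \<in> orbit r a" for n
    proof (induction n)
      case 0 show ?case using orbit.base[of r a] ra by simp
    next
      case (Suc n)
      have "(q ^^ Suc n) b \<in> orbit q b" using bb by (rule funpow_in_orbit)
      then have "(q ^^ Suc n) b \<noteq> a" using sub assms by blast
      show ?case
      proof (cases "(q ^^ Suc n) b = b")
        case True then show ?thesis using orbit.base[of r a] ra by simp
      next
        case False
        then have "r ((q ^^ n) b) = (q ^^ Suc n) b"
          using \<open>_ \<noteq> a\<close> by (simp add: r_def Transposition.transpose_def)
        then show ?thesis using orbit.step[OF Suc] by metis
      qed
    qed
    then show "insert a (orbit q b) \<subseteq> orbit r a"
      using orbit_altdef_permutation[OF pq, of b] permutation_self_in_orbit[OF pr, of a] by auto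
  qed
  then have same: "orbit r x = insert a (orbit q b)" if "x \<in> insert a (orbit q b)" for x
    using orbit_eq_if_mem[OF pr] that by metis
  have "orbit r x \<in> insert (insert a (orbit q b)) (orbit q ` S - {orbit q b})"
    if "x \<in> insert a S" for x
  proof (cases "x \<in> insert a (orbit q b)")
    case True
    then show ?thesis using same by simp
  next
    case False
    then have "x \<in> S" "orbit q x \<noteq> orbit q b"
      using that permutation_self_in_orbit[OF pq, of x] by auto
    then show ?thesis using other by simp
  qed
  moreover have "insert a (orbit q b) \<in> orbit r ` insert a S" using same[of a] by blast
  moreover have "orbit q ` S - {orbit q b} \<subseteq> orbit r ` insert a S"
  proof
    fix C assume "C \<in> orbit q ` S - {orbit q b}"
    then obtain x where x: "x \<in> S" "C = orbit q x" "orbit q x \<noteq> orbit q b" by blast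
    then have "C = orbit r x" using other by simp
    then show "C \<in> orbit r ` insert a S" using x(1) by (metis imageI insertCI)
  qed
  ultimately show ?thesis unfolding r_def[symmetric]
    by (intro equalityI image_subsetI insert_subset[THEN iffD2] conjI)
qed

lemma cycle_count_insert_transpose:
  assumes "finite S" "q permutes S" "a \<notin> S" "b \<in> S"
  defines "l \<equiv> card (orbit q b)"
  shows "cycle_count S q l \<ge> 1"
    and "cycle_count (insert a S) (Transposition.transpose a b \<circ> q) =
         (cycle_count S q)(l := cycle_count S q l - 1, Suc l := cycle_count S q (Suc l) + 1)"
proof -
  have sub: "orbit q x \<subseteq> S" if "x \<in> S" for x using permutes_orbit_subset assms(2) that by metis
  have fin: "finite (orbit q b)" using sub assms(1,4) finite_subset by blast
  have l: "card (insert a (orbit q b)) = Suc l" 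
  proof -
    have "a \<notin> orbit q b" using sub[OF assms(4)] assms(3) by blast
    then show ?thesis using fin by (simp add: l_def)
  qed
  have mem: "orbit q b \<in> {C \<in> orbit q ` S. card C = l}" using assms(4) l_def by simp
  have fin': "finite {C \<in> orbit q ` S. card C = j}" for j using assms(1) by simp
  show "cycle_count S q l \<ge> 1" unfolding cycle_count_def
    using mem fin' by (metis (no_types, lifting) One_nat_def Suc_leI card_gt_0_iff empty_iff)
  have notin: "insert a (orbit q b) \<notin> orbit q ` S" using sub assms(3) by blast
  have "cycle_count (insert a S) (Transposition.transpose a b \<circ> q) j =
         ((cycle_count S q)(l := cycle_count S q l - 1, Suc l := cycle_count S q (Suc l) + 1)) j" for j
  proof -
    have *: "{C \<in> insert (insert a (orbit q b)) (orbit q ` S - {orbit q b}). card C = j}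
       = (if j = Suc l then insert (insert a (orbit q b)) {C \<in> orbit q ` S. card C = j}
          else if j = l then {C \<in> orbit q ` S. card C = j} - {orbit q b} else {C \<in> orbit q ` S. card C = j})"
      using l l_def by (auto simp del: card_insert_disjoint)
    show ?thesis unfolding cycle_count_def orbits_insert_transpose[OF assms(1-4)] *
      using notin mem fin' by auto
  qed
  then show "cycle_count (insert a S) (Transposition.transpose a b \<circ> q) =
         (cycle_count S q)(l := cycle_count S q l - 1, Suc l := cycle_count S q (Suc l) + 1)" by blast
qed

lemma cycle_count_insert_fixed:
  assumes "finite S" "q permutes S" "a \<notin> S"
  shows "cycle_count (insert a S) q = (cycle_count S q)(1 := cycle_count S q 1 + 1)"
proof -
  have "q a = a" using assms permutes_not_in by metis
  then have o: "orbit q a = {a}" by (simp add: orbit_eq_singleton_iff)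
  have notin: "{a} \<notin> orbit q ` S" using permutes_orbit_subset[OF assms(2)] assms(3) by blast
  have "cycle_count (insert a S) q j = ((cycle_count S q)(1 := cycle_count S q 1 + 1)) j" for j
  proof -
    have *: "{C \<in> orbit q ` insert a S. card C = j}
      = (if j = 1 then insert {a} {C \<in> orbit q ` S. card C = j} else {C \<in> orbit q ` S. card C = j})"
      using o by auto
    show ?thesis unfolding cycle_count_def * using assms(1) notin by auto
  qed
  then show ?thesis by blast
qed

lemma card_points_in_cycles_of_length:
  assumes "finite S" "q permutes S"
  shows "card {b \<in> S. card (orbit q b) = j} = j * cycle_count S q j"
proof -
  have pq: "permutation q" using assms permutation_permutes by blast
  have "{b \<in> S. card (orbit q b) = j} = \<Union> {C \<in> orbit q ` S. card C = j}"
  proof (intro equalityI subsetI)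
    fix b assume "b \<in> {b \<in> S. card (orbit q b) = j}"
    then show "b \<in> \<Union> {C \<in> orbit q ` S. card C = j}"
      using permutation_self_in_orbit[OF pq, of b] by blast
  next
    fix b assume "b \<in> \<Union> {C \<in> orbit q ` S. card C = j}"
    then obtain x where x: "x \<in> S" "card (orbit q x) = j" "b \<in> orbit q x" by blast
    then show "b \<in> {b \<in> S. card (orbit q b) = j}"
      using permutes_orbit_subset[OF assms(2) x(1)] orbit_eq_if_mem[OF pq x(3)] by auto
  qed
  also have "j * card {C \<in> orbit q ` S. card C = j} = card (\<Union> {C \<in> orbit q ` S. card C = j})"
  proof (rule card_partition)
    show "finite {C \<in> orbit q ` S. card C = j}" using assms by simp
    show "finite (\<Union> {C \<in> orbit q ` S. card C = j})"
      using assms(1) permutes_orbit_subset[OF assms(2)] by (intro finite_subset[OF _ assms(1)]) blast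
    show "c1 \<inter> c2 = {}" if "c1 \<in> {C \<in> orbit q ` S. card C = j}"
      "c2 \<in> {C \<in> orbit q ` S. card C = j}" "c1 \<noteq> c2" for c1 c2
      using that orbits_eq_or_disjnt[OF pq] by blast
  qed simp
  finally show ?thesis unfolding cycle_count_def by simp
qed

lemma card_orbit_bounds:
  assumes "finite S" "q permutes S" "x \<in> S"
  shows "card (orbit q x) \<in> {1..card S}"
proof -
  have sub: "orbit q x \<subseteq> S" using permutes_orbit_subset[OF assms(2,3)] .
  then have "card (orbit q x) \<le> card S" "finite (orbit q x)"
    using assms(1) card_mono finite_subset by blast+
  then show ?thesis using orbit_nonempty[of q x] by (simp add: Suc_leI card_gt_0_iff)
qed

lemma cycle_count_eq_0:
  assumes "finite S" "q permutes S" "j = 0 \<or> j > card S"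
  shows "cycle_count S q j = 0"
proof -
  have "{C \<in> orbit q ` S. card C = j} = {}"
    using card_orbit_bounds[OF assms(1,2)] assms(3) by fastforce
  then show ?thesis unfolding cycle_count_def by (simp only: card.empty)
qed

lemma sum_cycle_count:
  assumes "finite S" "q permutes S" "card S \<le> J"
  shows "(\<Sum>j=1..J. j * cycle_count S q j) = card S"
proof -
  have "card (orbit q b) \<in> {1..J}" if "b \<in> S" for b
    using card_orbit_bounds[OF assms(1,2) that] assms(3) by simp
  then have "S = (\<Union>j\<in>{1..J}. {b \<in> S. card (orbit q b) = j})" by auto
  then have "card S = card (\<Union>j\<in>{1..J}. {b \<in> S. card (orbit q b) = j})" by simp
  also have "\<dots> = (\<Sum>j=1..J. card {b \<in> S. card (orbit q b) = j})"
    by (rule card_UN_disjoint) (use assms(1) in auto)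
  finally show ?thesis using card_points_in_cycles_of_length[OF assms(1,2)] by simp
qed

lemma prod_over_cycles:
  fixes d :: "nat \<Rightarrow> 'b::comm_monoid_mult"
  assumes "finite S" "q permutes S" "card S \<le> J"
  shows "(\<Prod>C\<in>orbit q ` S. d (card C)) = (\<Prod>j=1..J. d j ^ cycle_count S q j)"
proof -
  have "card ` (orbit q ` S) \<subseteq> {1..J}"
    using card_orbit_bounds[OF assms(1,2)] assms(3) by fastforce
  then have "(\<Prod>C\<in>orbit q ` S. d (card C)) =
    (\<Prod>j\<in>{1..J}. \<Prod>C\<in>{C \<in> orbit q ` S. card C = j}. d (card C))"
    by (intro prod.group[symmetric]) (use assms(1) in auto)
  also have "\<dots> = (\<Prod>j\<in>{1..J}. d j ^ cycle_count S q j)"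
    unfolding cycle_count_def by (intro prod.cong refl) simp
  finally show ?thesis .
qed

section \<open>Powers of permutations\<close>

lemma q_part_dvd: "k > 0 \<Longrightarrow> q_part k j dvd k"
proof -
  assume k: "k > 0"
  have "q_part k j dvd (\<Prod>p\<in>prime_factors k. p ^ multiplicity p k)"
    unfolding q_part_def by (intro prod_dvd_prod_subset) (use k in \<open>auto simp: prime_factors_dvd\<close>)
  also have "\<dots> = k" using k by (simp add: prod_prime_factors)
  finally show ?thesis .
qed

text \<open>Every prime of \<open>q_part k j\<close> divides \<open>j\<close>, hence does not divide
  a number coprime to \<open>j\<close>.\<close>

lemma q_part_coprime: "coprime k' j \<Longrightarrow> coprime (q_part k j) k'"
  unfolding q_part_def
  by (intro prod_coprime_left coprime_power_left_iff[THEN iffD2] disjI1)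
     (metis coprime_commute coprime_divisors dvd_refl gcd_dvd2 dvd_trans in_prime_factors_iff)

lemma prime_power_dvd_q_part:
  assumes "k > 0" "prime p" "p dvd k" "p dvd j"
  shows "p ^ multiplicity p k dvd q_part k j"
  unfolding q_part_def using assms by (intro dvd_prodI) (auto simp: prime_factors_dvd)

text \<open>\<open>q_part\<close> takes the full power of each prime of \<open>k\<close> that
  divides \<open>j\<close>. A prime common to \<open>j\<close> and the cofactor would therefore
  divide \<open>k\<close> once more than its multiplicity allows.\<close>

lemma coprime_div_q_part: "k > 0 \<Longrightarrow> coprime (k div q_part k j) j"
proof (rule ccontr)
  assume k: "k > 0" and "\<not> coprime (k div q_part k j) j"
  then obtain p where p: "prime p" "p dvd k div q_part k j" "p dvd j"
    using prime_factor_nat[of "gcd (k div q_part k j) j"] by (auto simp: coprime_iff_gcd_eq_1)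
  have k': "k = q_part k j * (k div q_part k j)" using q_part_dvd[OF k] by simp
  then have pk: "p dvd k" using p(2) by (metis dvd_mult)
  have "p ^ multiplicity p k * p dvd q_part k j * (k div q_part k j)"
    by (intro mult_dvd_mono prime_power_dvd_q_part[OF k p(1) pk p(3)] p(2))
  then have "p ^ Suc (multiplicity p k) dvd k" using k' by (simp add: mult.commute)
  then show False using k p(1)
    by (metis multiplicity_geI not_prime_unit Suc_n_not_le_n not_gr_zero)
qed

lemma q_part_eq_1: "coprime j k \<Longrightarrow> q_part k j = 1"
  unfolding q_part_def by (simp add: coprime_iff_gcd_eq_1 gcd.commute)

text \<open>This is what makes non-coprime lengths harmless: cycles of such a length occur at least
  in pairs, so the corresponding factor has no linear term.\<close>

lemma q_part_ge_2: "k > 0 \<Longrightarrow> gcd j k > 1 \<Longrightarrow> q_part k j \<ge> 2"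
proof -
  assume k: "k > 0" and g: "gcd j k > 1"
  then obtain p where p: "prime p" "p dvd gcd j k" by (metis prime_factor_nat less_numeral_extra(4))
  then have pk: "p dvd k" "p dvd j" by auto
  have "multiplicity p k \<ge> 1" using p(1) pk(1) k
    by (metis multiplicity_geI not_prime_unit power_one_right not_gr_zero)
  then have "p dvd p ^ multiplicity p k" by (simp add: dvd_power)
  then have "p dvd q_part k j" using prime_power_dvd_q_part[OF k p(1) pk] dvd_trans by blast
  moreover have "q_part k j > 0" using q_part_dvd[OF k, of j] k dvd_pos_nat by blast
  ultimately have "p \<le> q_part k j" by (simp add: dvd_imp_le)
  then show ?thesis using prime_ge_2_nat[OF p(1)] by linarith
qed

section \<open>Cycle counts of a \<open>k\<close>-th power, and the construction of
  \<open>k\<close>-th roots\<close>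

lemma funpow_card_orbit:
  assumes "x \<in> orbit f x"
  shows "(f ^^ card (orbit f x)) x = x"
    and "(f ^^ i) x = x \<Longrightarrow> card (orbit f x) dvd i"
proof -
  let ?n = "funpow_dist1 f x x"
  have "card (orbit f x) = card ((\<lambda>i. (f ^^ i) x) ` {0..<?n})"
    using orbit_conv_funpow_dist1[OF assms] by simp
  also have "\<dots> = ?n" using inj_on_funpow_dist1[OF assms] by (simp add: card_image)
  finally have n: "card (orbit f x) = ?n" .
  show c: "(f ^^ card (orbit f x)) x = x" unfolding n using funpow_dist1_prop[OF assms] .
  assume i: "(f ^^ i) x = x"
  have m: "(f ^^ (i mod ?n)) x = x" using funpow_mod_eq[OF c[unfolded n], of i] i by simp
  show "card (orbit f x) dvd i"
  proof (rule ccontr)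
    assume "\<not> ?thesis"
    then have "0 < i mod ?n" "i mod ?n < ?n" unfolding n by (auto simp: mod_greater_zero_iff_not_dvd)
    then show False using funpow_dist1_least[of "i mod ?n" f x x] m by blast
  qed
qed

lemma permutes_funpow: "x permutes X \<Longrightarrow> (x ^^ n) permutes X"
  by (induction n) (auto simp: id_def[symmetric] permutes_id intro: permutes_compose)

lemma image_orbit_commute:
  assumes "permutation s" "\<And>y. s (x y) = x (s y)"
  shows "x ` orbit s a = orbit s (x a)"
  using orbit_inverse[of a s s x] permutation_self_in_orbit[OF assms(1)] assms(2) by blast

text \<open>As \<open>x\<close> commutes with \<open>s = x ^^ k\<close>, it permutes the
  \<open>j\<close>-cycles of \<open>s\<close>; every orbit of this action has size divisible by
  \<open>q_part k j\<close>. Indeed, let \<open>g\<close> be the size of the orbit of a cycle and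
  \<open>k = g * k'\<close>. Then \<open>x ^^ g\<close> acts on that cycle like some
  \<open>s ^^ b\<close>, so \<open>s\<close> acts like \<open>s ^^ (b * k')\<close>. Hence
  \<open>b * k'\<close> is 1 mod \<open>j\<close>, \<open>k'\<close> is coprime to \<open>j\<close>,
  and \<open>q_part k j\<close> must divide \<open>g\<close>.\<close>

lemma q_part_dvd_cycle_count_power:
  assumes "finite X" "x permutes X" "k > 0"
  shows "q_part k j dvd cycle_count X (x ^^ k) j"
proof -
  define s where "s = x ^^ k"
  have sX: "s permutes X" unfolding s_def by (rule permutes_funpow[OF assms(2)])
  have ps: "permutation s" using sX assms(1) permutation_permutes by blast
  have comm: "(s ^^ n) ((x ^^ m) y) = (x ^^ m) ((s ^^ n) y)" for n m y
    unfolding s_def funpow_mult by (metis add.commute comp_apply funpow_add)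
  define O' where "O' = {C \<in> orbit s ` X. card C = j}"
  have finO: "finite O'" using assms(1) by (simp add: O'_def)
  have inj: "inj x" using assms(2) permutes_inj by blast
  have img: "(x ^^ i) ` orbit s a = orbit s ((x ^^ i) a)" for i a
    using comm[of 1] by (intro image_orbit_commute[OF ps]) simp
  have hO: "(x ^^ i) ` C \<in> O'" if CO: "C \<in> O'" for C i
  proof -
    obtain a where a: "a \<in> X" "C = orbit s a" "card C = j"
      using CO unfolding O'_def by blast
    have "(x ^^ i) a \<in> X" using a(1) permutes_in_image[OF permutes_funpow[OF assms(2)]] by blast
    moreover have "inj (x ^^ i)" using permutes_inj[OF permutes_funpow[OF assms(2)]] .
    ultimately show ?thesis using a img[of i a] card_image[of "x ^^ i" C]
      by (auto simp: O'_def intro: inj_on_subset)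
  qed
  \<comment> \<open>The action of \<open>x\<close> on the set of \<open>j\<close>-cycles, extended
    by the identity to all sets so that \<open>permutes\<close> applies.\<close>
  define p where "p = (\<lambda>C. if C \<in> O' then x ` C else C)"
  have pO: "p permutes O'"
  proof (rule bij_imp_permutes)
    have "p ` O' \<subseteq> O'" using hO[of _ 1] by (auto simp: p_def)
    moreover have "inj_on p O'"
      by (rule inj_onI) (auto simp: p_def inj_image_eq_iff[OF inj])
    ultimately show "bij_betw p O' O'" using finO by (simp add: bij_betw_def endo_inj_surj)
  qed (simp add: p_def)
  have pp: "permutation p" using pO finO permutation_permutes by blast
  have pow: "(p ^^ i) C = (x ^^ i) ` C" if "C \<in> O'" for i C
  proof (induction i)
    case (Suc i)
    have "(p ^^ Suc i) C = p ((x ^^ i) ` C)" using Suc by simp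
    also have "\<dots> = x ` (x ^^ i) ` C" using hO[OF that, of i] by (simp add: p_def)
    finally show ?case by (simp add: image_comp)
  qed simp
  have "q_part k j dvd card C'" if C': "C' \<in> orbit p ` O'" for C'
  proof -
    obtain C where C: "C \<in> O'" "C' = orbit p C" using C' by blast
    obtain a where a: "a \<in> X" "C = orbit s a" "card (orbit s a) = j"
      using C(1) unfolding O'_def by blast
    define g where "g = card C'"
    have "(p ^^ g) C = C" unfolding g_def C(2)
      by (rule funpow_card_orbit(1)[OF permutation_self_in_orbit[OF pp]])
    then have gC: "(x ^^ g) ` C = C" using pow[OF C(1)] by simp
    have "(p ^^ k) C = C"
      using pow[OF C(1), of k] img[of k a] permutation_orbit_step[OF ps, of a] a(2) by (simp add: s_def)
    then have "g dvd k" unfolding g_def C(2)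
      by (rule funpow_card_orbit(2)[OF permutation_self_in_orbit[OF pp]])
    then obtain k' where k': "k = g * k'" by blast
    have "(x ^^ g) a \<in> orbit s a"
      using gC permutation_self_in_orbit[OF ps, of a] a(2) by blast
    then obtain b where b: "(x ^^ g) a = (s ^^ b) a"
      unfolding orbit_altdef_permutation[OF ps] by blast
    have it: "(x ^^ (g * i)) a = (s ^^ (b * i)) a" for i
    proof (induction i)
      case (Suc i)
      have "(x ^^ (g * Suc i)) a = (x ^^ g) ((s ^^ (b * i)) a)" using Suc by (simp add: funpow_add)
      also have "\<dots> = (s ^^ (b * i)) ((s ^^ b) a)" by (simp add: comm[symmetric] b)
      also have "\<dots> = (s ^^ (b * Suc i)) a"
        by (metis add.commute comp_apply funpow_add mult_Suc_right)
      finally show ?case .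
    qed simp
    have sa: "s a = (s ^^ (b * k')) a" using it[of k'] k' by (simp add: s_def)
    \<comment> \<open>Subtraction is truncated: for \<open>b * k' = 0\<close> this reads
      \<open>j dvd 0\<close>. In that case \<open>s\<close> fixes \<open>a\<close>, so
      \<open>j = 1\<close>, and the coprimality below is trivial.\<close>
    have j: "j dvd b * k' - 1"
    proof (cases "b * k' = 0")
      case True
      then show ?thesis by (simp only: True diff_0_eq_0 dvd_0_right)
    next
      case False
      then obtain t where t: "b * k' = Suc t" using not0_implies_Suc by blast
      have "s ((s ^^ t) a) = s a" using sa t by simp
      then have "(s ^^ t) a = a" using permutes_inj[OF sX] by (simp add: inj_eq)
      then have "card (orbit s a) dvd t"
        by (rule funpow_card_orbit(2)[OF permutation_self_in_orbit[OF ps]])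
      then show ?thesis using a(3) t by simp
    qed
    have "coprime k' j"
    proof (cases "b * k' = 0")
      case True
      have "s a = a" using sa by (simp only: True funpow_0)
      then have "orbit s a = {a}" by (simp add: orbit_eq_singleton_iff)
      then have "j = 1" using a(3) by simp
      then show ?thesis by simp
    next
      case False
      have "c dvd 1" if c: "c dvd k'" "c dvd j" for c
      proof -
        have "c dvd b * k' - 1" "c dvd b * k'" using c j dvd_trans by auto
        then have "c dvd b * k' - (b * k' - 1)" by (rule dvd_diff_nat[rotated])
        then show ?thesis using False by simp
      qed
      then show ?thesis by (rule coprimeI)
    qed
    then have "coprime (q_part k j) k'" by (rule q_part_coprime)
    moreover have "q_part k j dvd g * k'" using q_part_dvd[OF assms(3)] k' by metis
    ultimately show ?thesis unfolding g_def[symmetric] by (simp add: coprime_dvd_mult_left_iff)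
  qed
  moreover have "finite (\<Union> (orbit p ` O'))" using Union_orbits[OF pO finO] finO by simp
  ultimately have "q_part k j dvd card (\<Union> (orbit p ` O'))"
    by (intro dvd_partition) (use orbits_eq_or_disjnt[OF pp] in blast)+
  then show ?thesis using Union_orbits[OF pO finO] by (simp add: cycle_count_def O'_def s_def)
qed


text \<open>The \<open>q\<close> cycles are interleaved into one cycle of length
  \<open>q * j\<close>. Advancing by \<open>q * k'\<close> places stays within each of the old
  cycles and moves \<open>k'\<close> places there; if one place is \<open>s ^^ m\<close> with
  \<open>m\<close> inverse to \<open>k'\<close> mod \<open>j\<close>, the total effect is
  \<open>s\<close>.\<close>

lemma cyclic_root:
  assumes fin: "finite U" and ps: "permutation s"
    and C: "\<And>i. i < q \<Longrightarrow> C i = orbit s (pt i)" "\<And>i. i < q \<Longrightarrow> card (C i) = j"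
    and disj: "\<And>i i'. i < q \<Longrightarrow> i' < q \<Longrightarrow> i \<noteq> i' \<Longrightarrow> C i \<inter> C i' = {}"
    and U: "U = (\<Union>i<q. C i)"
    and q: "q > 0" and j: "j > 0" and cop: "coprime k' j" and k': "k' > 0"
  shows "\<exists>y. y permutes U \<and> (\<forall>u\<in>U. (y ^^ (q * k')) u = s u)"
proof -
  obtain m t where mt: "k' * m = j * t + 1"
    using bezout_nat[of k' j] k' cop by auto
  \<comment> \<open>The interleaved enumeration: \<open>n mod q\<close> selects the cycle,
    \<open>n div q\<close> counts the steps of size \<open>m\<close> made in it.\<close>
  define P where "P = (\<lambda>n. (s ^^ (m * (n div q))) (pt (n mod q)))"
  define N where "N = q * j"
  have N: "N > 0" using q j by (simp add: N_def)
  have per: "(s ^^ j) (pt i) = pt i" if "i < q" for i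
    using funpow_card_orbit(1)[OF permutation_self_in_orbit[OF ps, of "pt i"]] C[OF that] by simp
  have per': "(s ^^ (j * a)) (pt i) = pt i" if "i < q" for i a
    using per[OF that] by (induction a) (simp_all add: funpow_add)
  have PN: "P (n + N) = P n" for n
  proof -
    have "(n + N) div q = n div q + j" "(n + N) mod q = n mod q" using q by (simp_all add: N_def)
    then have "P (n + N) = (s ^^ (m * (n div q))) ((s ^^ (j * m)) (pt (n mod q)))"
      by (simp add: P_def funpow_add distrib_left mult.commute)
    also have "\<dots> = P n" using per'[of "n mod q"] q by (simp add: P_def)
    finally show ?thesis .
  qed
  have PNi: "P (n + N * i) = P n" for n i
    by (induction i) (simp_all add: PN add.assoc[symmetric] add.commute[of N])
  have Pmod: "P (n mod N) = P n" for n
    using PNi[of "n mod N" "n div N"] by (simp add: mult.commute)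
  have PU: "P n \<in> U" for n
  proof -
    have i: "n mod q < q" using q by simp
    have "P n \<in> orbit s (pt (n mod q))" unfolding P_def
      by (rule funpow_in_orbit[OF permutation_self_in_orbit[OF ps]])
    then show ?thesis unfolding U using C(1)[OF i] i by blast
  qed
  have surj: "U \<subseteq> P ` {..<N}"
  proof
    fix u assume "u \<in> U"
    then obtain i where "i < q" "u \<in> C i" unfolding U by blast
    then have i: "i < q" "u \<in> orbit s (pt i)" using C(1) by simp_all
    from i(2) obtain a where a: "u = (s ^^ a) (pt i)" unfolding orbit_altdef_permutation[OF ps] by blast
    have "P (q * (a * k') + i) = (s ^^ (m * (a * k'))) (pt i)" using i(1) by (simp add: P_def)
    also have "m * (a * k') = a + j * (t * a)" using mt
      by (metis add.commute mult.assoc mult.commute mult.left_neutral distrib_right)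
    also have "(s ^^ (a + j * (t * a))) (pt i) = u" using per'[OF i(1)] a by (simp add: funpow_add)
    finally have "u = P ((q * (a * k') + i) mod N)" using Pmod by simp
    then show "u \<in> P ` {..<N}" using N by (metis imageI lessThan_iff mod_less_divisor)
  qed
  have PUeq: "P ` {..<N} = U" by (rule equalityI[OF image_subsetI surj]) (rule PU)
  \<comment> \<open>By counting, the surjection \<open>P\<close> from \<open>N = q * j\<close>
    indices onto \<open>U\<close> is injective, so "next index" is a well-defined permutation of
    \<open>U\<close>.\<close>
  have "card U = (\<Sum>i<q. card (C i))" unfolding U
  proof (rule card_UN_disjoint)
    show "\<forall>i\<in>{..<q}. finite (C i)" using fin U by (auto intro: finite_subset)
  qed (use disj in auto)
  also have "\<dots> = N" using C(2) by (simp add: N_def)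
  finally have inj: "inj_on P {..<N}" using PUeq by (intro eq_card_imp_inj_on) auto
  define y where "y = (\<lambda>u. if u \<in> U then P (Suc (inv_into {..<N} P u)) else u)"
  have yP: "y (P n) = P (Suc n)" for n
  proof -
    have "inv_into {..<N} P (P n) = n mod N"
      using inv_into_f_f[OF inj, of "n mod N"] N Pmod[of n] by simp
    then have "y (P n) = P (Suc (n mod N))" using PU by (simp add: y_def)
    also have "\<dots> = P (Suc (n mod N) mod N)" by (simp only: Pmod)
    also have "\<dots> = P (Suc n)" by (simp only: mod_Suc_eq Pmod)
    finally show ?thesis .
  qed
  have yi: "(y ^^ i) (P n) = P (n + i)" for i n by (induction i) (simp_all add: yP)
  have "U \<subseteq> y ` U"
  proof
    fix u assume "u \<in> U"
    then obtain n where n: "u = P n" using surj by blast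
    have "u = P (n + N)" using n PN by simp
    also have "\<dots> = y (P (n + N - 1))" using yP[of "n + N - 1"] N by simp
    finally show "u \<in> y ` U" using PU by blast
  qed
  moreover have "y ` U \<subseteq> U" using PU by (auto simp: y_def)
  ultimately have "y ` U = U" by blast
  then have "bij_betw y U U" using fin by (simp add: bij_betw_def eq_card_imp_inj_on)
  then have "y permutes U" by (rule bij_imp_permutes) (simp add: y_def)
  moreover have "(y ^^ (q * k')) u = s u" if uU: "u \<in> U" for u
  proof -
    obtain n where n: "u = P n" using uU surj by blast
    have i: "n mod q < q" using q by simp
    have "(y ^^ (q * k')) u = P (n + q * k')" using yi n by simp
    also have "\<dots> = (s ^^ (m * (n div q + k'))) (pt (n mod q))" using q by (simp add: P_def add.commute)
    also have "m * (n div q + k') = Suc (m * (n div q)) + j * t"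
      using mt by (simp add: distrib_left mult.commute[of m k'])
    also have "(s ^^ \<dots>) (pt (n mod q)) = (s ^^ Suc (m * (n div q))) ((s ^^ (j * t)) (pt (n mod q)))"
      by (simp only: funpow_add comp_apply)
    also have "\<dots> = s u" using per'[OF i] n by (simp add: P_def)
    finally show ?thesis .
  qed
  ultimately show ?thesis by blast
qed

text \<open>Induction on the set: take a cycle, of length \<open>j\<close> say. There are at least
  \<open>q = q_part k j\<close> cycles of this length. Merge \<open>q\<close> of them by
  \<open>cyclic_root\<close>, applicable because \<open>k div q\<close> is coprime to
  \<open>j\<close>, and treat the remaining points by induction; the count at \<open>j\<close> drops
  by exactly \<open>q\<close>, so divisibility persists.\<close>

lemma exists_root_of_q_part_dvd:
  assumes "finite X" "k > 0" "s permutes X" "\<And>j. q_part k j dvd cycle_count X s j"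
  shows "\<exists>x. x permutes X \<and> x ^^ k = s"
  using assms(1,3,4)
proof (induction X arbitrary: s rule: finite_psubset_induct)
  case (psubset X)
  note sX = psubset.prems(1)
  have ps: "permutation s" using sX psubset.hyps permutation_permutes by blast
  show ?case
  proof (cases "X = {}")
    case True
    have "s = id" using True sX by simp
    moreover have "(id ^^ k) = (id :: 'a \<Rightarrow> 'a)" by (induction k) simp_all
    ultimately show ?thesis using permutes_id by blast
  next
    case False
    then obtain x where x: "x \<in> X" by blast
    define j where "j = card (orbit s x)"
    define q where "q = q_part k j"
    define O' where "O' = {C \<in> orbit s ` X. card C = j}"
    have finO: "finite O'" using psubset.hyps by (simp add: O'_def)
    have jp: "j > 0" using card_orbit_bounds[OF psubset.hyps sX x] by (simp add: j_def)
    have "orbit s x \<in> O'" using x by (simp add: O'_def j_def)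
    then have "card O' > 0" using finO card_gt_0_iff by blast
    moreover have qO: "q dvd card O'"
      using psubset.prems(2)[of j] by (simp add: q_def cycle_count_def O'_def)
    ultimately have "q \<le> card O'" using dvd_imp_le by blast
    then obtain Q where Q: "Q \<subseteq> O'" "card Q = q" "finite Q"
      using obtain_subset_with_card_n by metis
    have qp: "q > 0" using q_part_dvd[OF assms(2), of j] assms(2) dvd_pos_nat q_def by blast
    obtain C where C: "bij_betw C {0..<q} Q" using ex_bij_betw_nat_finite[OF Q(3)] Q(2) by blast
    have "\<exists>a. a \<in> X \<and> C i = orbit s a \<and> card (C i) = j" if "i < q" for i
    proof -
      have "C i \<in> O'" using C that Q(1) bij_betwE by fastforce
      then show ?thesis unfolding O'_def by blast
    qed
    then obtain pt where pt: "pt i \<in> X" "C i = orbit s (pt i)" "card (C i) = j" if "i < q" for i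
      by metis
    define U where "U = \<Union> Q"
    have QC: "Q = C ` {..<q}" using C by (simp add: bij_betw_def lessThan_atLeast0)
    have U: "U = (\<Union>i<q. C i)" unfolding U_def QC by blast
    have UX: "U \<subseteq> X" unfolding U using pt(1,2) permutes_orbit_subset[OF sX] by blast
    have finU: "finite U" using UX psubset.hyps finite_subset by blast
    have "\<exists>y. y permutes U \<and> (\<forall>u\<in>U. (y ^^ (q * (k div q))) u = s u)"
    proof (rule cyclic_root[OF finU ps pt(2,3) _ U qp jp])
      show "C i \<inter> C i' = {}" if "i < q" "i' < q" "i \<noteq> i'" for i i'
      proof -
        have "C i \<noteq> C i'" using C that by (auto simp: bij_betw_def dest: inj_onD)
        then show ?thesis using orbits_eq_or_disjnt[OF ps] pt(2) that by metis
      qed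
      show "coprime (k div q) j" unfolding q_def by (rule coprime_div_q_part[OF assms(2)])
      show "k div q > 0" using q_part_dvd[OF assms(2), of j] assms(2) qp
        by (metis q_def dvd_div_eq_0_iff not_gr_zero)
    qed
    then obtain y where y: "y permutes U" "\<And>u. u \<in> U \<Longrightarrow> (y ^^ k) u = s u"
      using q_part_dvd[OF assms(2), of j] by (auto simp: q_def)
    have sU: "s u \<in> U \<longleftrightarrow> u \<in> U" for u
    proof -
      have "s u \<in> C i \<longleftrightarrow> u \<in> C i" if "i < q" for i
        using pt(2)[OF that] cyclic_on_f_in[OF sX cyclic_on_orbit[OF sX psubset.hyps]]
          orbit.step[of u s] by metis
      then show ?thesis unfolding U by blast
    qed
    define V where "V = X - U"
    define r where "r = perm_restrict s V"
    have rV: "r permutes V"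
    proof (rule bij_imp_permutes)
      have "s ` V = V"
      proof
        show "s ` V \<subseteq> V" using sU permutes_in_image[OF sX] by (auto simp: V_def)
        show "V \<subseteq> s ` V"
        proof
          fix v assume "v \<in> V"
          then obtain u where "v = s u" "u \<in> X" using permutes_image[OF sX] by (auto simp: V_def)
          then show "v \<in> s ` V" using sU \<open>v \<in> V\<close> by (auto simp: V_def)
        qed
      qed
      then have "bij_betw s V V" using permutes_inj_on[OF sX] by (simp add: bij_betw_def)
      then show "bij_betw r V V" by (rule bij_betw_cong[THEN iffD1, rotated]) (simp add: r_def perm_restrict_def)
    qed (simp add: r_def perm_restrict_def)
    have Vsub: "V \<subset> X"
    proof -
      have "pt 0 \<in> U" unfolding U using pt(2)[OF qp] qp permutation_self_in_orbit[OF ps] by blast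
      then show ?thesis using UX by (auto simp: V_def)
    qed
    have rs: "orbit r v = orbit s v" if "v \<in> V" for v
    proof (rule orbit_cong0[OF that])
      show "r \<in> V \<rightarrow> V" using permutes_in_image[OF rV] by blast
    qed (simp add: r_def perm_restrict_def)
    have orbV: "orbit r ` V = orbit s ` X - Q"
    proof (intro equalityI subsetI)
      fix D assume "D \<in> orbit r ` V"
      then obtain v where v: "v \<in> V" "D = orbit s v" using rs by blast
      have "D \<notin> Q" using v permutation_self_in_orbit[OF ps, of v] by (auto simp: V_def U_def)
      then show "D \<in> orbit s ` X - Q" using v by (auto simp: V_def)
    next
      fix D assume D: "D \<in> orbit s ` X - Q"
      then obtain v where v: "v \<in> X" "D = orbit s v" by blast
      have "v \<notin> U"
      proof
        assume "v \<in> U"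
        then obtain i where i: "i < q" "v \<in> C i" unfolding U by blast
        then have "D = C i" using v(2) pt(2)[OF i(1)] orbit_eq_if_mem[OF ps] by simp
        then show False using D i(1) QC by blast
      qed
      then have "v \<in> V" using v(1) by (simp add: V_def)
      then show "D \<in> orbit r ` V" using rs[of v] v(2) by blast
    qed
    have "q_part k i dvd cycle_count V r i" for i
    proof -
      have "{D \<in> orbit s ` X - Q. card D = i} = {D \<in> orbit s ` X. card D = i} - (if i = j then Q else {})"
        using Q(1) by (auto simp: O'_def)
      then have "cycle_count V r i = cycle_count X s i - (if i = j then q else 0)"
        unfolding cycle_count_def orbV using Q O'_def by (auto simp: card_Diff_subset)
      then show ?thesis using psubset.prems(2)[of i] by (auto simp: q_def intro: dvd_diff_nat)
    qed
    then obtain z where z: "z permutes V" "z ^^ k = r"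
      using psubset.IH[OF Vsub rV] by blast
    define w where "w = (\<lambda>u. if u \<in> U then y u else z u)"
    have wU: "(w ^^ i) u = (y ^^ i) u \<and> (y ^^ i) u \<in> U" if "u \<in> U" for u i
      using that by (induction i) (auto simp: w_def permutes_in_image[OF y(1)])
    have zU: "z u \<in> U \<longleftrightarrow> u \<in> U" for u
      using permutes_in_image[OF z(1)] permutes_not_in[OF z(1)] UX unfolding V_def by (cases "u \<in> V") (auto simp: V_def)
    have wV: "(w ^^ i) u = (z ^^ i) u \<and> (z ^^ i) u \<notin> U" if "u \<notin> U" for u i
      using that by (induction i) (auto simp: w_def zU)
    have "w permutes X"
    proof (rule bij_imp_permutes)
      have "bij_betw w U U"
        using permutes_imp_bij[OF y(1)] by (rule bij_betw_cong[THEN iffD1, rotated]) (simp add: w_def)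
      moreover have "bij_betw w V V"
        using permutes_imp_bij[OF z(1)]
        by (rule bij_betw_cong[THEN iffD1, rotated]) (auto simp: w_def V_def)
      ultimately have "bij_betw w (U \<union> V) (U \<union> V)"
        by (rule bij_betw_combine) (auto simp: V_def)
      then show "bij_betw w X X" using UX by (simp add: V_def Un_absorb1)
    next
      fix u assume "u \<notin> X"
      then show "w u = u" using UX permutes_not_in[OF z(1), of u] by (auto simp: w_def V_def)
    qed
    moreover have "(w ^^ k) u = s u" for u
    proof (cases "u \<in> U")
      case True
      then show ?thesis using wU y(2) by simp
    next
      case False
      then have "(w ^^ k) u = r u" using wV z(2) by simp
      then show ?thesis using False permutes_not_in[OF sX, of u] by (auto simp: r_def perm_restrict_def V_def)
    qed
    ultimately show ?thesis by blast
  qed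
qed

lemma power_perms_iff:
  assumes "k > 0"
  shows "power_perms k n = {s. s permutes {1..n} \<and> (\<forall>j. q_part k j dvd cycle_count {1..n} s j)}"
proof (intro equalityI subsetI)
  fix s assume "s \<in> power_perms k n"
  then obtain x where "x permutes {1..n}" "s = x ^^ k" by (auto simp: power_perms_def)
  then show "s \<in> {s. s permutes {1..n} \<and> (\<forall>j. q_part k j dvd cycle_count {1..n} s j)}"
    using q_part_dvd_cycle_count_power[of "{1..n}" x k] permutes_funpow assms by auto
next
  fix s assume "s \<in> {s. s permutes {1..n} \<and> (\<forall>j. q_part k j dvd cycle_count {1..n} s j)}"
  then show "s \<in> power_perms k n"
    using exists_root_of_q_part_dvd[of "{1..n}" k s] assms by (auto simp: power_perms_def)
qed

section \<open>The exponential formula\<close>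

lemma fps_nth_prod_0: "fps_nth (\<Prod>i\<in>A. f i) 0 = (\<Prod>i\<in>A. fps_nth (f i :: 'a::comm_ring_1 fps) 0)"
  by (induction A rule: infinite_finite_induct) auto

lemma fps_deriv_prod:
  fixes f :: "'i \<Rightarrow> 'a::comm_ring_1 fps"
  assumes "finite A"
  shows "fps_deriv (\<Prod>i\<in>A. f i) = (\<Sum>i\<in>A. fps_deriv (f i) * (\<Prod>j\<in>A - {i}. f j))"
  using assms
proof (induction A)
  case (insert a A)
  have "fps_deriv (f i) * (\<Prod>j\<in>insert a A - {i}. f j) = f a * (fps_deriv (f i) * (\<Prod>j\<in>A - {i}. f j))"
    if "i \<in> A" for i
  proof -
    have "insert a A - {i} = insert a (A - {i})" using that insert.hyps by auto
    then show ?thesis using insert.hyps by (simp add: mult_ac)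
  qed
  then have "(\<Sum>i\<in>A. fps_deriv (f i) * (\<Prod>j\<in>insert a A - {i}. f j)) =
    f a * (\<Sum>i\<in>A. fps_deriv (f i) * (\<Prod>j\<in>A - {i}. f j))"
    by (simp add: sum_distrib_left)
  then show ?case using insert by (simp add: mult.commute add.commute)
qed simp

text \<open>The exponential of z^j / j whose \<open>s\<close>-th term carries the weight
  \<open>\<phi> s\<close>. For \<open>\<phi> s = c ^ s\<close> it is the exponential of c z^j / j; a
  weight supported on multiples of \<open>q_part k j\<close> encodes the condition on
  \<open>k\<close>-th powers.\<close>

definition cycle_fps :: "nat \<Rightarrow> (nat \<Rightarrow> 'a::field_char_0) \<Rightarrow> 'a fps" where
  "cycle_fps j \<phi> =
     Abs_fps (\<lambda>m. if j dvd m then \<phi> (m div j) / (of_nat j ^ (m div j) * fact (m div j)) else 0)"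

lemma cycle_fps_nth:
  "fps_nth (cycle_fps j \<phi>) m =
     (if j dvd m then \<phi> (m div j) / (of_nat j ^ (m div j) * fact (m div j)) else 0)"
  by (simp add: cycle_fps_def)

lemma fps_deriv_cycle_fps:
  assumes "j \<ge> 1"
  shows "fps_deriv (cycle_fps j \<phi>) = fps_X ^ (j - 1) * cycle_fps j (\<lambda>s. \<phi> (Suc s))"
proof (rule fps_ext)
  fix m
  show "fps_nth (fps_deriv (cycle_fps j \<phi>)) m = fps_nth (fps_X ^ (j - 1) * cycle_fps j (\<lambda>s. \<phi> (Suc s))) m"
  proof (cases "j dvd Suc m")
    case True
    then obtain t where t: "Suc m = j * t" by blast
    then obtain s where s: "t = Suc s" by (cases t) auto
    have m: "m - (j - 1) = j * s" "\<not> m < j - 1" using t s assms by (auto simp: algebra_simps)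
    have ts: "of_nat t \<noteq> (0::'a)" "fact t = (of_nat t * fact s :: 'a)" "\<phi> t = \<phi> (Suc s)"
      "of_nat j ^ t = (of_nat j * of_nat j ^ s :: 'a)" using s by (auto simp del: of_nat_Suc)
    have j0: "of_nat j \<noteq> (0::'a)" using assms by simp
    have "fps_nth (fps_deriv (cycle_fps j \<phi>)) m = of_nat (Suc m) * (\<phi> t / (of_nat j ^ t * fact t))"
      using t assms by (simp add: cycle_fps_nth del: of_nat_Suc)
    also have "of_nat (Suc m) = (of_nat j * of_nat t :: 'a)" using t by (metis of_nat_mult)
    also have "\<dots> * (\<phi> t / (of_nat j ^ t * fact t)) = \<phi> (Suc s) / (of_nat j ^ s * fact s)"
      using j0 ts(1) unfolding ts(2-4) by (simp add: field_simps)
    also have "\<dots> = fps_nth (fps_X ^ (j - 1) * cycle_fps j (\<lambda>s. \<phi> (Suc s))) m"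
      using m assms by (simp add: cycle_fps_nth fps_X_power_mult_nth)
    finally show ?thesis .
  next
    case False
    have "\<not> j dvd m - (j - 1)" if "\<not> m < j - 1"
    proof
      assume "j dvd m - (j - 1)"
      then have "j dvd m - (j - 1) + j" by simp
      moreover have "m - (j - 1) + j = Suc m" using that assms by simp
      ultimately show False using False by simp
    qed
    then show ?thesis using False by (simp add: cycle_fps_nth fps_X_power_mult_nth)
  qed
qed

text \<open>The weight on the left counts the choice of a point on a \<open>j\<close>-cycle, which
  is then destroyed. At \<open>s = 0\<close> the factor \<open>j * s\<close> removes the meaningless
  \<open>\<phi> (0 - 1)\<close>.\<close>

lemma cycle_fps_mult_index:
  assumes "j \<ge> 1"
  shows "cycle_fps j (\<lambda>s. of_nat (j * s) * \<phi> (s - 1)) = fps_X ^ j * cycle_fps j \<phi>"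
proof (rule fps_ext)
  fix m
  show "fps_nth (cycle_fps j (\<lambda>s. of_nat (j * s) * \<phi> (s - 1))) m = fps_nth (fps_X ^ j * cycle_fps j \<phi>) m"
  proof (cases "m < j")
    case True
    then show ?thesis by (auto simp: cycle_fps_nth fps_X_power_mult_nth dest: dvd_imp_le)
  next
    case False
    then obtain r where r: "m = r + j" by (metis add.commute le_add_diff_inverse not_less)
    show ?thesis
    proof (cases "j dvd r")
      case True
      then obtain s where "r = j * s" by blast
      then have m: "m = j * Suc s" "m - j = j * s" using r by auto
      have j0: "of_nat j \<noteq> (0::'a)" "of_nat (Suc s) \<noteq> (0::'a)" using assms by (simp_all del: of_nat_Suc)
      have "fps_nth (cycle_fps j (\<lambda>s. of_nat (j * s) * \<phi> (s - 1))) m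
         = of_nat j * of_nat (Suc s) * \<phi> s / (of_nat j * of_nat j ^ s * (of_nat (Suc s) * fact s))"
        unfolding m(1) using assms by (simp add: cycle_fps_nth del: of_nat_Suc mult_Suc_right)
      also have "\<dots> = \<phi> s / (of_nat j ^ s * fact s)" using j0 by (simp add: field_simps del: of_nat_Suc)
      also have "\<dots> = fps_nth (fps_X ^ j * cycle_fps j \<phi>) m"
        using m(2) assms False by (simp add: cycle_fps_nth fps_X_power_mult_nth)
      finally show ?thesis .
    qed (use r in \<open>simp add: cycle_fps_nth fps_X_power_mult_nth\<close>)
  qed
qed

lemma prod_fun_upd:
  assumes "finite A" "l \<in> A"
  shows "(\<Prod>j\<in>A. g j ((f(l := x)) j)) = g l x * (\<Prod>j\<in>A - {l}. g j (f j))"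
proof -
  have "(\<Prod>j\<in>A. g j ((f(l := x)) j)) = g l ((f(l := x)) l) * (\<Prod>j\<in>A - {l}. g j ((f(l := x)) j))"
    by (rule prod.remove[OF assms])
  also have "(\<Prod>j\<in>A - {l}. g j ((f(l := x)) j)) = (\<Prod>j\<in>A - {l}. g j (f j))"
    by (rule prod.cong) auto
  finally show ?thesis by simp
qed

text \<open>Exponential formula for arbitrary weights, by induction on the set. The new point is
  either fixed or spliced into a cycle of length \<open>l\<close>, which trades one
  \<open>l\<close>-cycle for one of length \<open>Suc l\<close>. Such an exchange changes the
  weights, so the induction is over all \<open>\<phi>\<close>.\<close>

lemma sum_permutations_cycle_counts:
  fixes \<phi> :: "nat \<Rightarrow> nat \<Rightarrow> 'a::field_char_0"
  assumes "finite X" "card X \<le> J"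
  shows "(\<Sum>\<sigma> | \<sigma> permutes X. \<Prod>j=1..J. \<phi> j (cycle_count X \<sigma> j))
         = fact (card X) * fps_nth (\<Prod>j=1..J. cycle_fps j (\<phi> j)) (card X)"
  using assms
proof (induction X arbitrary: \<phi> rule: finite_induct)
  case empty
  have "cycle_count {} q j = 0" for q :: "'b \<Rightarrow> 'b" and j by (simp add: cycle_count_def)
  then show ?case by (simp add: fps_nth_prod_0 cycle_fps_nth)
next
  case (insert a X)
  define n where "n = card X"
  have nJ: "Suc n \<le> J" using insert.prems insert.hyps by (simp add: n_def)
  \<comment> \<open>\<open>sh l\<close> evaluates the weight of length \<open>Suc l\<close> at one
    cycle more, the cycle just created. \<open>psi l\<close> also lowers the count at
    \<open>l\<close> by one and multiplies by \<open>l * s\<close>, the number of points after which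
    to splice.\<close>
  define sh where "sh = (\<lambda>l. \<phi>(Suc l := (\<lambda>s. \<phi> (Suc l) (Suc s))))"
  define psi where "psi = (\<lambda>l. (sh l)(l := (\<lambda>s. of_nat (l * s) * \<phi> l (s - 1))))"
  define T where "T = (\<lambda>c. \<Prod>j=1..J. \<phi> j (c j :: nat))"
  have psi_T: "of_nat (l * c l) * T (c(l := c l - 1, Suc l := c (Suc l) + 1)) = (\<Prod>j=1..J. psi l j (c j))"
    if "l \<in> {1..<J}" for l and c :: "nat \<Rightarrow> nat"
  proof -
    have l: "Suc l \<in> {1..J}" "l \<in> {1..J} - {Suc l}" using that by auto
    have "T (c(l := c l - 1, Suc l := c (Suc l) + 1)) =
        \<phi> (Suc l) (Suc (c (Suc l))) * (\<Prod>j\<in>{1..J} - {Suc l}. \<phi> j ((c(l := c l - 1)) j))"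
      unfolding T_def using l(1) by (subst prod_fun_upd) auto
    also have "(\<Prod>j\<in>{1..J} - {Suc l}. \<phi> j ((c(l := c l - 1)) j)) =
        \<phi> l (c l - 1) * (\<Prod>j\<in>{1..J} - {Suc l} - {l}. \<phi> j (c j))"
      using l(2) by (subst prod_fun_upd) auto
    finally have 1: "T (c(l := c l - 1, Suc l := c (Suc l) + 1)) = \<phi> (Suc l) (Suc (c (Suc l))) *
        (\<phi> l (c l - 1) * (\<Prod>j\<in>{1..J} - {Suc l} - {l}. \<phi> j (c j)))" .
    have "(\<Prod>j=1..J. psi l j (c j)) =
        psi l (Suc l) (c (Suc l)) * (psi l l (c l) * (\<Prod>j\<in>{1..J} - {Suc l} - {l}. psi l j (c j)))"
      using l by (subst prod.remove[of _ "Suc l"], simp, simp, subst prod.remove[of _ l]) auto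
    also have "(\<Prod>j\<in>{1..J} - {Suc l} - {l}. psi l j (c j)) = (\<Prod>j\<in>{1..J} - {Suc l} - {l}. \<phi> j (c j))"
      by (rule prod.cong) (auto simp: psi_def sh_def)
    finally show ?thesis unfolding 1 by (simp add: psi_def sh_def mult_ac)
  qed
  have psi_fps: "(\<Prod>j=1..J. cycle_fps j (psi l j)) = fps_X ^ l * (\<Prod>j=1..J. cycle_fps j (sh l j))"
    if "l \<in> {1..<J}" for l
  proof -
    have l: "l \<in> {1..J}" using that by auto
    have "(\<Prod>j=1..J. cycle_fps j (psi l j)) =
       cycle_fps l (\<lambda>s. of_nat (l * s) * \<phi> l (s - 1)) * (\<Prod>j\<in>{1..J} - {l}. cycle_fps j (sh l j))"
      unfolding psi_def using l by (subst prod_fun_upd) auto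
    also have "cycle_fps l (\<lambda>s. of_nat (l * s) * \<phi> l (s - 1)) = fps_X ^ l * cycle_fps l (sh l l)"
      using cycle_fps_mult_index[of l "\<phi> l"] l by (simp add: sh_def)
    finally show ?thesis using l by (simp add: prod.remove[of _ l] mult.assoc)
  qed
  have fixed: "(\<Sum>q | q permutes X. T (cycle_count (insert a X) q))
      = fact n * fps_nth (\<Prod>j=1..J. cycle_fps j (sh 0 j)) n"
  proof -
    have "T (cycle_count (insert a X) q) = (\<Prod>j=1..J. sh 0 j (cycle_count X q j))" if "q permutes X" for q
      unfolding cycle_count_insert_fixed[OF insert.hyps(1) that insert.hyps(2)] T_def
      by (rule prod.cong) (auto simp: sh_def)
    then have "(\<Sum>q | q permutes X. T (cycle_count (insert a X) q)) =
       (\<Sum>q | q permutes X. \<Prod>j=1..J. sh 0 j (cycle_count X q j))" by simp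
    then show ?thesis using insert.IH[of "sh 0"] nJ by (simp add: n_def)
  qed
  have moved: "(\<Sum>b\<in>X. T (cycle_count (insert a X) (Transposition.transpose a b \<circ> q)))
      = (\<Sum>l\<in>{1..<J}. \<Prod>j=1..J. psi l j (cycle_count X q j))" if q: "q permutes X" for q
  proof -
    let ?c = "cycle_count X q"
    let ?U = "\<lambda>l. T (?c(l := ?c l - 1, Suc l := ?c (Suc l) + 1))"
    have sub: "(\<lambda>b. card (orbit q b)) ` X \<subseteq> {1..<J}"
      using card_orbit_bounds[OF insert.hyps(1) q] nJ by (fastforce simp: n_def)
    have "(\<Sum>b\<in>X. T (cycle_count (insert a X) (Transposition.transpose a b \<circ> q)))
       = (\<Sum>b\<in>X. ?U (card (orbit q b)))"
      by (rule sum.cong) (simp_all add: cycle_count_insert_transpose[OF insert.hyps(1) q insert.hyps(2)])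
    also have "\<dots> = (\<Sum>l\<in>{1..<J}. \<Sum>b\<in>{b \<in> X. card (orbit q b) = l}. ?U (card (orbit q b)))"
      by (rule sum.group[symmetric]) (use insert.hyps sub in auto)
    also have "\<dots> = (\<Sum>l\<in>{1..<J}. \<Sum>b\<in>{b \<in> X. card (orbit q b) = l}. ?U l)"
      by (intro sum.cong) auto
    also have "\<dots> = (\<Sum>l\<in>{1..<J}. of_nat (l * ?c l) * ?U l)"
      using card_points_in_cycles_of_length[OF insert.hyps(1) q] by simp
    also have "\<dots> = (\<Sum>l\<in>{1..<J}. \<Prod>j=1..J. psi l j (?c j))"
      by (rule sum.cong[OF refl]) (rule psi_T)
    finally show ?thesis .
  qed
  have "(\<Sum>\<sigma> | \<sigma> permutes insert a X. \<Prod>j=1..J. \<phi> j (cycle_count (insert a X) \<sigma> j))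
      = (\<Sum>b\<in>insert a X. \<Sum>q | q permutes X. T (cycle_count (insert a X) (Transposition.transpose a b \<circ> q)))"
    unfolding T_def by (rule sum_over_permutations_insert[OF insert.hyps])
  also have "\<dots> = (\<Sum>q | q permutes X. T (cycle_count (insert a X) q)) +
      (\<Sum>b\<in>X. \<Sum>q | q permutes X. T (cycle_count (insert a X) (Transposition.transpose a b \<circ> q)))"
    using insert.hyps by (simp add: o_def id_def)
  also have "(\<Sum>b\<in>X. \<Sum>q | q permutes X. T (cycle_count (insert a X) (Transposition.transpose a b \<circ> q)))
      = (\<Sum>q | q permutes X. \<Sum>l\<in>{1..<J}. \<Prod>j=1..J. psi l j (cycle_count X q j))"
    by (subst sum.swap) (rule sum.cong[OF refl], simp add: moved)
  also have "\<dots> = (\<Sum>l\<in>{1..<J}. fact n * fps_nth (\<Prod>j=1..J. cycle_fps j (psi l j)) n)"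
    by (subst sum.swap) (rule sum.cong[OF refl], use insert.IH nJ in \<open>simp add: n_def\<close>)
  also have "\<dots> = (\<Sum>l\<in>{1..<J}. fact n * fps_nth (fps_X ^ l * (\<Prod>j=1..J. cycle_fps j (sh l j))) n)"
    by (rule sum.cong[OF refl]) (simp only: psi_fps)
  \<comment> \<open>A fixed new point is the case \<open>l = 0\<close>: a cycle of length 1 is
    created and none is destroyed.\<close>
  also have "(\<Sum>q | q permutes X. T (cycle_count (insert a X) q)) + \<dots>
      = (\<Sum>l\<in>insert 0 {1..<J}. fact n * fps_nth (fps_X ^ l * (\<Prod>j=1..J. cycle_fps j (sh l j))) n)"
    unfolding fixed by simp
  also have "insert 0 {1..<J} = {0..<J}" using nJ by auto
  also have "(\<Sum>l\<in>{0..<J}. fact n * fps_nth (fps_X ^ l * (\<Prod>j=1..J. cycle_fps j (sh l j))) n)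
      = fact n * fps_nth (\<Sum>l\<in>{0..<J}. fps_X ^ l * (\<Prod>j=1..J. cycle_fps j (sh l j))) n"
    by (simp add: fps_sum_nth sum_distrib_left)
  \<comment> \<open>Term \<open>l\<close> is the summand of the product rule in which the factor of
    length \<open>Suc l\<close> is differentiated. So the sum is the derivative of the product, and
    its \<open>n\<close>-th coefficient is \<open>Suc n\<close> times the desired one.\<close>
  also have "(\<Sum>l\<in>{0..<J}. fps_X ^ l * (\<Prod>j=1..J. cycle_fps j (sh l j)))
      = (\<Sum>i\<in>{1..J}. fps_deriv (cycle_fps i (\<phi> i)) * (\<Prod>j\<in>{1..J} - {i}. cycle_fps j (\<phi> j)))"
  proof (rule sum.reindex_bij_witness[of _ "\<lambda>i. i - 1" Suc])
    fix l assume "l \<in> {0..<J}"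
    then have l: "Suc l \<in> {1..J}" by auto
    have "(\<Prod>j=1..J. cycle_fps j (sh l j)) =
       cycle_fps (Suc l) (\<lambda>s. \<phi> (Suc l) (Suc s)) * (\<Prod>j\<in>{1..J} - {Suc l}. cycle_fps j (\<phi> j))"
      unfolding sh_def by (rule prod_fun_upd[where g = cycle_fps]) (use l in auto)
    then show "fps_deriv (cycle_fps (Suc l) (\<phi> (Suc l))) * (\<Prod>j\<in>{1..J} - {Suc l}. cycle_fps j (\<phi> j)) =
      fps_X ^ l * (\<Prod>j=1..J. cycle_fps j (sh l j))"
      by (simp add: fps_deriv_cycle_fps mult.assoc)
  qed auto
  also have "\<dots> = fps_deriv (\<Prod>j=1..J. cycle_fps j (\<phi> j))" by (simp add: fps_deriv_prod)
  finally show ?case using insert.hyps by (simp add: n_def mult_ac)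
qed

section \<open>Exponentials of power series\<close>

text \<open>The exponential of the sum of a_j z^j / j. Since \<open>a 0 / 0 = 0\<close>, the inner
  series has constant term 0 and the composition is the intended one.\<close>

definition exp_fps :: "(nat \<Rightarrow> 'a::field_char_0) \<Rightarrow> 'a fps" where
  "exp_fps a = fps_exp 1 oo Abs_fps (\<lambda>j. a j / of_nat j)"

lemma exp_fps_nth_0 [simp]: "fps_nth (exp_fps a) 0 = 1"
  by (simp add: exp_fps_def)

lemma fps_deriv_exp_fps: "fps_deriv (exp_fps a) = exp_fps a * Abs_fps (\<lambda>j. a (Suc j))"
proof -
  have "fps_deriv (Abs_fps (\<lambda>j. a j / of_nat j)) = Abs_fps (\<lambda>j. a (Suc j))"
    by (rule fps_ext) (simp del: of_nat_Suc)
  then show ?thesis unfolding exp_fps_def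
    by (subst fps_compose_deriv) simp_all
qed

text \<open>Comparison of coefficients in z F' = F (a_1 z + a_2 z^2 + ...). For nonnegative or
  bounded \<open>a\<close> this recursion replaces complex analysis throughout.\<close>

lemma nth_of_log_deriv:
  fixes F :: "'a::field_char_0 fps"
  assumes "fps_deriv F = F * Abs_fps (\<lambda>j. a (Suc j))"
  shows "of_nat n * fps_nth F n = (\<Sum>j=1..n. a j * fps_nth F (n - j))"
proof (cases n)
  case (Suc m)
  have "of_nat n * fps_nth F n = fps_nth (F * Abs_fps (\<lambda>j. a (Suc j))) m"
    unfolding Suc assms[symmetric] by simp
  also have "\<dots> = (\<Sum>i=0..m. a (Suc (m - i)) * fps_nth F i)"
    by (simp add: fps_mult_nth mult.commute)
  also have "\<dots> = (\<Sum>j=1..n. a j * fps_nth F (n - j))"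
    by (rule sum.reindex_bij_witness[of _ "\<lambda>j. n - j" "\<lambda>i. n - i"]) (auto simp: Suc Suc_diff_le)
  finally show ?thesis .
qed simp

lemma exp_fps_rec:
  "of_nat n * fps_nth (exp_fps a) n = (\<Sum>j=1..n. a j * fps_nth (exp_fps a) (n - j))"
  by (rule nth_of_log_deriv[OF fps_deriv_exp_fps])

text \<open>The recursion and the constant term determine all coefficients, so identities between
  exponentials reduce to their logarithmic derivatives.\<close>

lemma exp_fps_unique:
  fixes F :: "'a::field_char_0 fps"
  assumes "fps_deriv F = F * Abs_fps (\<lambda>j. a (Suc j))" "fps_nth F 0 = 1"
  shows "F = exp_fps a"
proof (rule fps_ext)
  fix n show "fps_nth F n = fps_nth (exp_fps a) n"
  proof (induction n rule: less_induct)
    case (less n)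
    show ?case
    proof (cases "n = 0")
      case False
      have "(\<Sum>j=1..n. a j * fps_nth F (n - j)) = (\<Sum>j=1..n. a j * fps_nth (exp_fps a) (n - j))"
        by (rule sum.cong) (use less in auto)
      then have "of_nat n * fps_nth F n = of_nat n * fps_nth (exp_fps a) n"
        using nth_of_log_deriv[OF assms(1), of n] exp_fps_rec[of n a] by simp
      then show ?thesis using False by simp
    qed (use assms in simp)
  qed
qed

lemma exp_fps_add: "exp_fps (\<lambda>j. a j + b j) = exp_fps a * exp_fps b"
proof -
  have "Abs_fps (\<lambda>j. a (Suc j) + b (Suc j)) = Abs_fps (\<lambda>j. a (Suc j)) + Abs_fps (\<lambda>j. b (Suc j))"
    by (rule fps_ext) simp
  then have "fps_deriv (exp_fps a * exp_fps b)
      = exp_fps a * exp_fps b * Abs_fps (\<lambda>j. a (Suc j) + b (Suc j))"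
    by (simp add: fps_deriv_exp_fps algebra_simps)
  then show ?thesis by (rule exp_fps_unique[symmetric]) simp
qed

text \<open>Substitution of \<open>z\<close> times the variable. With \<open>exp_fps_sums\<close>,
  which evaluates at 1, it gives the values at all other points.\<close>

lemma exp_fps_scale: "fps_nth (exp_fps (\<lambda>j. a j * z ^ j)) n = fps_nth (exp_fps a) n * z ^ n"
proof (induction n rule: less_induct)
  case (less n)
  show ?case
  proof (cases "n = 0")
    case False
    have "of_nat n * fps_nth (exp_fps (\<lambda>j. a j * z ^ j)) n
        = (\<Sum>j=1..n. a j * z ^ j * (fps_nth (exp_fps a) (n - j) * z ^ (n - j)))"
      unfolding exp_fps_rec by (rule sum.cong) (use less in auto)
    also have "\<dots> = (\<Sum>j=1..n. a j * fps_nth (exp_fps a) (n - j) * z ^ n)"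
      by (rule sum.cong) (auto simp: mult_ac simp flip: power_add)
    also have "\<dots> = of_nat n * (fps_nth (exp_fps a) n * z ^ n)"
      by (simp add: exp_fps_rec sum_distrib_right flip: mult.assoc)
    finally show ?thesis using False by simp
  qed simp
qed

lemma exp_fps_cong:
  assumes "\<And>j. 1 \<le> j \<Longrightarrow> j \<le> n \<Longrightarrow> a j = b j"
  shows "fps_nth (exp_fps a) n = fps_nth (exp_fps b) n"
  using assms
proof (induction n rule: less_induct)
  case (less n)
  show ?case
  proof (cases "n = 0")
    case False
    have "of_nat n * fps_nth (exp_fps a) n = of_nat n * fps_nth (exp_fps b) n"
      unfolding exp_fps_rec by (rule sum.cong) (use less in auto)
    then show ?thesis using False by simp
  qed simp
qed

text \<open>Majorant principle: the recursion has only positive coefficients, so it preserves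
  domination.\<close>

lemma norm_exp_fps_le:
  fixes a :: "nat \<Rightarrow> 'a::{real_normed_field,field_char_0}"
  assumes "\<And>j. 1 \<le> j \<Longrightarrow> norm (a j) \<le> b j"
  shows "norm (fps_nth (exp_fps a) n) \<le> fps_nth (exp_fps b) n"
proof (induction n rule: less_induct)
  case (less n)
  show ?case
  proof (cases "n = 0")
    case False
    have "real n * norm (fps_nth (exp_fps a) n) = norm (of_nat n * fps_nth (exp_fps a) n)"
      by (simp add: norm_mult)
    also have "\<dots> \<le> (\<Sum>j=1..n. norm (a j * fps_nth (exp_fps a) (n - j)))"
      unfolding exp_fps_rec by (rule norm_sum)
    also have "\<dots> \<le> (\<Sum>j=1..n. b j * fps_nth (exp_fps b) (n - j))"
    proof (rule sum_mono)
      fix j assume j: "j \<in> {1..n}"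
      then have "norm (a j) \<le> b j" using assms by simp
      moreover have "norm (fps_nth (exp_fps a) (n - j)) \<le> fps_nth (exp_fps b) (n - j)"
        using less j False by simp
      ultimately show "norm (a j * fps_nth (exp_fps a) (n - j)) \<le> b j * fps_nth (exp_fps b) (n - j)"
        unfolding norm_mult by (intro mult_mono) (auto intro: order_trans[OF norm_ge_zero])
    qed
    also have "\<dots> = real n * fps_nth (exp_fps b) n" by (rule exp_fps_rec[symmetric])
    finally show ?thesis using False by simp
  qed simp
qed

lemma exp_fps_nonneg:
  fixes b :: "nat \<Rightarrow> real"
  assumes "\<And>j. 1 \<le> j \<Longrightarrow> 0 \<le> b j"
  shows "0 \<le> fps_nth (exp_fps b) n"
  using order_trans[OF norm_ge_zero norm_exp_fps_le[of b b n]] assms by simp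

lemma exp_fps_mono:
  fixes a b :: "nat \<Rightarrow> real"
  assumes "\<And>j. 1 \<le> j \<Longrightarrow> 0 \<le> a j" "\<And>j. 1 \<le> j \<Longrightarrow> a j \<le> b j"
  shows "fps_nth (exp_fps a) n \<le> fps_nth (exp_fps b) n"
  using order_trans[OF abs_ge_self norm_exp_fps_le[of a b n, unfolded real_norm_def]] assms by simp

lemma exp_fps_of_real:
  "fps_nth (exp_fps (\<lambda>j. of_real (a j) :: 'a::{real_field,field_char_0})) n
     = of_real (fps_nth (exp_fps a) n)"
proof (induction n rule: less_induct)
  case (less n)
  show ?case
  proof (cases "n = 0")
    case False
    have "of_nat n * fps_nth (exp_fps (\<lambda>j. of_real (a j) :: 'a)) n =
       (\<Sum>j=1..n. of_real (a j) * of_real (fps_nth (exp_fps a) (n - j)))"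
      unfolding exp_fps_rec by (rule sum.cong) (use less in auto)
    also have "\<dots> = of_real (real n * fps_nth (exp_fps a) n)"
      unfolding exp_fps_rec by simp
    finally show ?thesis using False by simp
  qed simp
qed

lemma cycle_fps_power_eq_exp_fps:
  assumes "j \<ge> 1"
  shows "cycle_fps j (\<lambda>s. c ^ s) = exp_fps (\<lambda>i. if i = j then c else 0)"
proof (rule exp_fps_unique)
  have "cycle_fps j (\<lambda>s. c ^ Suc s) = fps_const c * cycle_fps j (\<lambda>s. c ^ s)"
    by (rule fps_ext) (simp add: cycle_fps_nth)
  moreover have "Abs_fps (\<lambda>i. if Suc i = j then c else 0) = fps_const c * fps_X ^ (j - 1)"
    using assms by (intro fps_ext) (auto simp: fps_X_power_nth)
  ultimately show "fps_deriv (cycle_fps j (\<lambda>s. c ^ s)) =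
      cycle_fps j (\<lambda>s. c ^ s) * Abs_fps (\<lambda>i. if Suc i = j then c else 0)"
    using fps_deriv_cycle_fps[OF assms, of "\<lambda>s. c ^ s"] by (simp add: mult_ac)
qed (simp add: cycle_fps_nth)

lemma prod_cycle_fps_power:
  assumes "finite A" "0 \<notin> A"
  shows "(\<Prod>j\<in>A. cycle_fps j (\<lambda>s. c j ^ s)) = exp_fps (\<lambda>i. if i \<in> A then c i else 0)"
  using assms
proof (induction A)
  case empty
  show ?case by (rule exp_fps_unique) (auto simp: fps_eq_iff fps_mult_nth)
next
  case (insert k A)
  have "(\<lambda>i. if i \<in> insert k A then c i else 0)
      = (\<lambda>i. (if i = k then c k else 0) + (if i \<in> A then c i else 0))"
    using insert.hyps by (auto simp: fun_eq_iff)
  moreover have "k \<ge> 1" using insert.prems by (cases k) auto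
  ultimately show ?case
    using insert by (simp add: exp_fps_add cycle_fps_power_eq_exp_fps)
qed

lemma exp_fps_single_sums:
  fixes c :: "'a::{real_normed_field,banach,field_char_0}"
  assumes "N \<ge> 1"
  shows "fps_nth (exp_fps (\<lambda>i. if i = N then c else 0)) sums exp (c / of_nat N)"
proof -
  let ?F = "fps_nth (exp_fps (\<lambda>i. if i = N then c else 0))"
  have F: "?F m = (if N dvd m then c ^ (m div N) / (of_nat N ^ (m div N) * fact (m div N)) else 0)" for m
    using cycle_fps_nth[of N "\<lambda>s. c ^ s" m] cycle_fps_power_eq_exp_fps[OF assms, of c] by simp
  have "(\<lambda>s. (c / of_nat N) ^ s /\<^sub>R fact s) sums exp (c / of_nat N)" by (rule exp_converges)
  moreover have "(c / of_nat N) ^ s /\<^sub>R fact s = ?F (N * s)" for s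
    using assms by (simp add: F power_divide scaleR_conv_of_real field_simps)
  ultimately have "(\<lambda>s. ?F (N * s)) sums exp (c / of_nat N)" by simp
  then show ?thesis
    by (subst (asm) sums_mono_reindex) (use assms in \<open>auto simp: strict_mono_def F\<close>)
qed

text \<open>Lengths are added one at a time; each step is a Cauchy product of absolutely convergent
  series.\<close>

lemma exp_fps_sums:
  fixes a :: "nat \<Rightarrow> 'a::{real_normed_field,banach,field_char_0}"
  assumes "\<And>j. j > N \<Longrightarrow> a j = 0"
  shows "fps_nth (exp_fps a) sums exp (\<Sum>j=1..N. a j / of_nat j)"
    and "summable (\<lambda>n. norm (fps_nth (exp_fps a) n))"
proof -
  have "fps_nth (exp_fps a) sums exp (\<Sum>j=1..N. a j / of_nat j) \<and>
    summable (\<lambda>n. norm (fps_nth (exp_fps a) n))"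
    using assms
  proof (induction N arbitrary: a)
    case 0
    have "fps_nth (exp_fps a) n = fps_nth (exp_fps (\<lambda>_. 0)) n" for n
      by (rule exp_fps_cong) (use 0 in auto)
    moreover have "exp_fps (\<lambda>_. 0 :: 'a) = 1"
      by (rule exp_fps_unique[symmetric]) (auto simp: fps_eq_iff fps_mult_nth)
    ultimately have F: "fps_nth (exp_fps a) = (\<lambda>n. if n = 0 then 1 else 0)" by auto
    show ?case unfolding F using sums_single[of 0 "\<lambda>_. 1::'a"]
      by (auto intro!: summable_finite[of "{0}"] split: if_splits)
  next
    case (Suc N)
    define b where "b = (\<lambda>i. if i = Suc N then 0 else a i)"
    define e where "e = (\<lambda>i. if i = Suc N then a (Suc N) else 0)"
    have ab: "a = (\<lambda>i. b i + e i)" by (auto simp: b_def e_def)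
    have IH: "fps_nth (exp_fps b) sums exp (\<Sum>j=1..N. b j / of_nat j)"
      "summable (\<lambda>n. norm (fps_nth (exp_fps b) n))"
      using Suc.IH[of b] Suc.prems by (auto simp: b_def)
    have e: "fps_nth (exp_fps e) sums exp (a (Suc N) / of_nat (Suc N))"
      unfolding e_def by (rule exp_fps_single_sums) simp
    have "fps_nth (exp_fps (\<lambda>i. if i = Suc N then norm (a (Suc N)) else 0))
        sums exp (norm (a (Suc N)) / of_nat (Suc N))"
      by (rule exp_fps_single_sums) simp
    then have "summable (fps_nth (exp_fps (\<lambda>i. if i = Suc N then norm (a (Suc N)) else 0)))"
      by (rule sums_summable)
    then have es: "summable (\<lambda>n. norm (fps_nth (exp_fps e) n))"
      by (rule summable_comparison_test'[of _ 0]) (auto intro!: norm_exp_fps_le simp: e_def)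
    have prod: "fps_nth (exp_fps a) n = (\<Sum>i\<le>n. fps_nth (exp_fps b) i * fps_nth (exp_fps e) (n - i))" for n
      by (subst ab) (simp add: exp_fps_add fps_mult_nth atLeast0AtMost)
    have "fps_nth (exp_fps a) sums (exp (\<Sum>j=1..N. b j / of_nat j) * exp (a (Suc N) / of_nat (Suc N)))"
      using Cauchy_product_sums[OF IH(2) es] IH(1) e unfolding prod by (simp add: sums_unique[symmetric])
    moreover have "exp (\<Sum>j=1..N. b j / of_nat j) * exp (a (Suc N) / of_nat (Suc N))
       = exp (\<Sum>j=1..Suc N. a j / of_nat j)"
      by (simp add: exp_add b_def)
    moreover have "summable (\<lambda>n. norm (fps_nth (exp_fps a) n))"
    proof (rule summable_comparison_test'[of _ 0])
      show "summable (\<lambda>n. \<Sum>i\<le>n. norm (fps_nth (exp_fps b) i) * norm (fps_nth (exp_fps e) (n - i)))"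
        by (rule summable_Cauchy_product) (use IH(2) es in auto)
      show "norm (norm (fps_nth (exp_fps a) n)) \<le>
          (\<Sum>i\<le>n. norm (fps_nth (exp_fps b) i) * norm (fps_nth (exp_fps e) (n - i)))" for n
        unfolding prod by (simp add: norm_mult[symmetric] norm_sum)
    qed
    ultimately show ?case by simp
  qed
  then show "fps_nth (exp_fps a) sums exp (\<Sum>j=1..N. a j / of_nat j)"
    and "summable (\<lambda>n. norm (fps_nth (exp_fps a) n))" by blast+
qed

text \<open>The first \<open>N\<close> coefficients do not see lengths beyond \<open>N\<close>. Once
  these are cut off, a partial sum of nonnegative coefficients is at most the value at 1.\<close>

lemma sum_exp_fps_le:
  fixes b :: "nat \<Rightarrow> real"
  assumes "\<And>j. 1 \<le> j \<Longrightarrow> 0 \<le> b j"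
  shows "(\<Sum>n\<le>N. fps_nth (exp_fps b) n) \<le> exp (\<Sum>j=1..N. b j / j)"
proof -
  define c where "c = (\<lambda>j. if j \<le> N then b j else 0)"
  have s: "fps_nth (exp_fps c) sums exp (\<Sum>j=1..N. c j / of_nat j)"
    by (rule exp_fps_sums) (auto simp: c_def)
  have "(\<Sum>n\<le>N. fps_nth (exp_fps b) n) = (\<Sum>n\<le>N. fps_nth (exp_fps c) n)"
    by (intro sum.cong refl exp_fps_cong) (auto simp: c_def)
  also have "\<dots> \<le> (\<Sum>n. fps_nth (exp_fps c) n)"
    by (rule sum_le_suminf) (use s assms in \<open>auto simp: sums_iff c_def intro!: exp_fps_nonneg\<close>)
  also have "\<dots> = exp (\<Sum>j=1..N. b j / j)" using s by (simp add: sums_iff c_def)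
  finally show ?thesis .
qed

text \<open>The majorant is \<open>D = C * exp_fps b\<close>, where \<open>C\<close> has the
  coefficients \<open>norm (u j - v j) / j\<close>. The difference of the two exponentials satisfies
  the recursion of \<open>u\<close> with an inhomogeneous term, and \<open>D\<close> satisfies the
  corresponding recursion with norms.\<close>

lemma norm_exp_fps_diff_le:
  fixes u v :: "nat \<Rightarrow> 'a::{real_normed_field,field_char_0}"
  assumes "\<And>j. 1 \<le> j \<Longrightarrow> norm (u j) \<le> b j" "\<And>j. 1 \<le> j \<Longrightarrow> norm (v j) \<le> b j"
  shows "norm (fps_nth (exp_fps u) n - fps_nth (exp_fps v) n)
     \<le> (\<Sum>j=1..n. norm (u j - v j) / j * fps_nth (exp_fps b) (n - j))"
proof -
  define c where "c = (\<lambda>j. norm (u j - v j))"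
  define C where "C = Abs_fps (\<lambda>j. c j / real j)"
  define D where "D = C * exp_fps b"
  have D: "fps_nth D m = (\<Sum>j=1..m. c j / j * fps_nth (exp_fps b) (m - j))" for m
    unfolding D_def C_def by (simp add: fps_mult_nth sum.atLeast_Suc_atMost)
  have "fps_deriv C = Abs_fps (\<lambda>j. c (Suc j))"
    unfolding C_def by (rule fps_ext) (simp del: of_nat_Suc)
  then have dD: "fps_deriv D = exp_fps b * Abs_fps (\<lambda>j. c (Suc j)) + D * Abs_fps (\<lambda>j. b (Suc j))"
    unfolding D_def by (simp add: fps_deriv_exp_fps algebra_simps)
  have conv: "fps_nth (F * Abs_fps (\<lambda>j. a (Suc j))) m = (\<Sum>j=1..Suc m. a j * fps_nth F (Suc m - j))"
    for F :: "real fps" and a m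
    unfolding fps_mult_nth
    by (rule sum.reindex_bij_witness[of _ "\<lambda>j. Suc m - j" "\<lambda>i. Suc m - i"]) (auto simp: Suc_diff_le)
  have Drec: "real m * fps_nth D m = (\<Sum>j=1..m. c j * fps_nth (exp_fps b) (m - j)) + (\<Sum>j=1..m. b j * fps_nth D (m - j))" for m
  proof (cases m)
    case (Suc m')
    have "real m * fps_nth D m = fps_nth (fps_deriv D) m'" by (simp add: Suc)
    then show ?thesis unfolding dD fps_add_nth conv Suc .
  qed simp
  have "norm (fps_nth (exp_fps u) n - fps_nth (exp_fps v) n) \<le> fps_nth D n"
  proof (induction n rule: less_induct)
    case (less n)
    let ?d = "\<lambda>n. fps_nth (exp_fps u) n - fps_nth (exp_fps v) n"
    show ?case
    proof (cases "n = 0")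
      case True
      then show ?thesis by (simp add: D)
    next
      case False
      have "of_nat n * ?d n = (\<Sum>j=1..n. u j * ?d (n - j) + (u j - v j) * fps_nth (exp_fps v) (n - j))"
        by (simp add: right_diff_distrib exp_fps_rec sum_subtractf[symmetric]) (simp add: algebra_simps)
      then have "real n * norm (?d n) = norm (\<Sum>j=1..n. u j * ?d (n - j) + (u j - v j) * fps_nth (exp_fps v) (n - j))"
        by (metis norm_mult norm_of_nat)
      also have "\<dots> \<le> (\<Sum>j=1..n. b j * fps_nth D (n - j) + c j * fps_nth (exp_fps b) (n - j))"
      proof (rule sum_norm_le)
        fix j assume j: "j \<in> {1..n}"
        have "norm (u j * ?d (n - j)) \<le> b j * fps_nth D (n - j)"
          unfolding norm_mult using assms(1) j less False
          by (intro mult_mono) (auto intro: order_trans[OF norm_ge_zero])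
        moreover have "norm ((u j - v j) * fps_nth (exp_fps v) (n - j)) \<le> c j * fps_nth (exp_fps b) (n - j)"
          unfolding norm_mult c_def by (intro mult_left_mono norm_exp_fps_le assms(2)) auto
        ultimately show "norm (u j * ?d (n - j) + (u j - v j) * fps_nth (exp_fps v) (n - j)) \<le>
           b j * fps_nth D (n - j) + c j * fps_nth (exp_fps b) (n - j)"
          by (rule norm_triangle_mono)
      qed
      also have "\<dots> = real n * fps_nth D n" unfolding Drec by (simp add: sum.distrib)
      finally show ?thesis using False by simp
    qed
  qed
  then show ?thesis unfolding D c_def .
qed

section \<open>Coefficients with lengths coprime to k\<close>

definition root_char :: "nat \<Rightarrow> int \<Rightarrow> complex" where
  "root_char k t = cis (2 * pi * of_int t / of_nat k)"

lemma root_char_add: "root_char k (s + t) = root_char k s * root_char k t"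
  by (simp add: root_char_def cis_mult add_divide_distrib distrib_left)

lemma norm_root_char [simp]: "norm (root_char k t) = 1"
  by (simp add: root_char_def)

lemma root_char_0 [simp]: "root_char k 0 = 1"
  by (simp add: root_char_def)

lemma root_char_power: "root_char k t ^ n = root_char k (t * int n)"
  by (induction n) (simp_all add: root_char_add[symmetric] algebra_simps)

lemma root_char_eq_1: "k > 0 \<Longrightarrow> int k dvd t \<Longrightarrow> root_char k t = 1"
  using cis_multiple_2pi[of "real_of_int (t div int k)"]
  by (auto simp: root_char_def mult.assoc elim!: dvdE)

lemma Re_root_char_eq_1_iff:
  assumes "k > 0"
  shows "Re (root_char k t) = 1 \<longleftrightarrow> int k dvd t"
proof
  assume "Re (root_char k t) = 1"
  then obtain n :: int where "2 * pi * of_int t / of_nat k = of_int n * 2 * pi"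
    using cos_one_2pi_int by (auto simp: root_char_def)
  then have "of_int t = (of_int n * of_nat k :: real)" using assms by (simp add: field_simps)
  then have "t = n * int k" by (metis of_int_eq_iff of_int_mult of_int_of_nat_eq)
  then show "int k dvd t" by simp
next
  assume "int k dvd t"
  then show "Re (root_char k t) = 1" using root_char_eq_1[OF assms] by simp
qed

lemma root_char_eq_1_iff: "k > 0 \<Longrightarrow> root_char k t = 1 \<longleftrightarrow> int k dvd t"
  using Re_root_char_eq_1_iff[of k t] root_char_eq_1[of k t] by auto

lemma sum_root_char:
  assumes "k > 0"
  shows "(\<Sum>i<k. root_char k (t * (n + int i))) = (if int k dvd t then of_nat k else 0)"
proof -
  have "(\<Sum>i<k. root_char k (t * (n + int i))) = root_char k (t * n) * (\<Sum>i<k. root_char k t ^ i)"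
    by (simp add: sum_distrib_left root_char_power root_char_add distrib_left)
  also have "\<dots> = (if int k dvd t then of_nat k else 0)"
  proof (cases "int k dvd t")
    case True
    moreover from this have "root_char k (t * n) = 1" "root_char k t = 1"
      using root_char_eq_1_iff[OF assms] by (simp_all add: dvd_mult2)
    ultimately show ?thesis by simp
  next
    case False
    then have "root_char k t \<noteq> 1" using root_char_eq_1_iff[OF assms] by simp
    moreover have "root_char k t ^ k = 1"
      using root_char_eq_1_iff[OF assms] by (simp add: root_char_power)
    ultimately have "(\<Sum>i<k. root_char k t ^ i) = 0" by (simp add: sum_gp_strict)
    then show ?thesis using False by simp
  qed
  finally show ?thesis .
qed

section \<open>The integers coprime to \<open>k\<close>: density and Fourier coefficients\<close>

locale coprime_lengths =
  fixes k :: nat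
  assumes k_pos: "k > 0"
begin

definition chi :: "nat \<Rightarrow> real" where
  "chi j = (if coprime j k then 1 else 0)"

text \<open>Residues start at 0, so that \<open>k = 1\<close> gives \<open>{0}\<close> and density
  1.\<close>

definition units :: "nat set" where
  "units = {u. u < k \<and> coprime u k}"

definition theta :: real where
  "theta = card units / k"

lemma finite_units [simp]: "finite units"
  by (simp add: units_def)

lemma one_mod_in_units: "1 mod k \<in> units"
proof (cases "k = 1")
  case True
  then show ?thesis unfolding units_def by simp
next
  case False
  then show ?thesis using k_pos by (simp add: units_def)
qed

lemma theta_pos: "theta > 0" and theta_le_1: "theta \<le> 1"
proof -
  have "card units > 0" using one_mod_in_units card_gt_0_iff by fastforce
  then show "theta > 0" using k_pos by (simp add: theta_def)
  have "card units \<le> card {..<k}" by (rule card_mono) (auto simp: units_def)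
  then show "theta \<le> 1" using k_pos by (simp add: theta_def)
qed

lemma chi_nonneg [simp]: "0 \<le> chi j" and chi_le_1 [simp]: "chi j \<le> 1"
  by (simp_all add: chi_def)

lemma chi_mod: "chi (j mod k) = chi j"
  using k_pos by (simp add: chi_def)

text \<open>The Fourier coefficients of \<open>chi\<close> on the residues mod \<open>k\<close>,
  that is, Ramanujan sums divided by \<open>k\<close>.\<close>

definition char_coeff :: "nat \<Rightarrow> complex" where
  "char_coeff r = (\<Sum>u\<in>units. root_char k (- int (r * u))) / of_nat k"

lemma chi_expansion: "complex_of_real (chi j) = (\<Sum>r<k. char_coeff r * root_char k (int (r * j)))"
proof -
  have "char_coeff r * root_char k (int (r * j)) =
      (\<Sum>u\<in>units. root_char k ((int j - int u) * (0 + int r)) / of_nat k)" for r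
    unfolding char_coeff_def sum_divide_distrib sum_distrib_right
  proof (intro sum.cong refl)
    fix u
    have "(int j - int u) * (0 + int r) = - int (r * u) + int (r * j)" by (simp add: algebra_simps)
    then show "root_char k (- int (r * u)) / of_nat k * root_char k (int (r * j))
      = root_char k ((int j - int u) * (0 + int r)) / of_nat k"
      by (simp only: root_char_add times_divide_eq_left)
  qed
  then have "(\<Sum>r<k. char_coeff r * root_char k (int (r * j))) =
      (\<Sum>u\<in>units. (\<Sum>r<k. root_char k ((int j - int u) * (0 + int r))) / of_nat k)"
    unfolding sum_divide_distrib by (simp only: sum.swap[of _ units])
  also have "\<dots> = (\<Sum>u\<in>units. if int k dvd int j - int u then 1 else 0)"
    unfolding sum_root_char[OF k_pos] using k_pos by (intro sum.cong) auto
  also have "\<dots> = (\<Sum>u\<in>units. if u = j mod k then 1 else 0)"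
  proof (intro sum.cong refl)
    fix u assume "u \<in> units"
    then have "u < k" by (simp add: units_def)
    then have "int k dvd int j - int u \<longleftrightarrow> u = j mod k"
      by (metis mod_eq_dvd_iff mod_less of_nat_eq_iff zmod_int)
    then show "(if int k dvd int j - int u then 1 else 0) = (if u = j mod k then 1 else (0::complex))" by simp
  qed
  also have "\<dots> = complex_of_real (chi j)"
    using k_pos by (simp add: chi_def units_def)
  finally show ?thesis ..
qed

lemma char_coeff_0: "char_coeff 0 = complex_of_real theta"
  by (simp add: char_coeff_def theta_def)

lemma norm_char_coeff_le: "norm (char_coeff r) \<le> 1"
proof -
  have "norm (\<Sum>u\<in>units. root_char k (- int (r * u))) \<le> (\<Sum>u\<in>units. 1)"
    by (rule sum_norm_le) simp
  also have "\<dots> = theta * k" using k_pos by (simp add: theta_def)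
  also have "\<dots> \<le> k" using mult_right_mono[OF theta_le_1, of "real k"] by simp
  finally show ?thesis using k_pos by (simp add: char_coeff_def norm_divide)
qed

text \<open>The hypothesis forces \<open>k > 1\<close>, so 1 is a unit, and its term has real part
  below 1 while all others are at most 1. This strict inequality is the source of every power saving
  below.\<close>

lemma Re_char_coeff_less:
  assumes "0 < r" "r < k"
  shows "Re (char_coeff r) < theta"
proof -
  have "1 mod k = 1" using assms by simp
  then have "1 \<in> units" using one_mod_in_units by simp
  moreover have "Re (root_char k (- int (r * 1))) < 1"
  proof -
    have "\<not> int k dvd - int (r * 1)" using assms by (auto dest: dvd_imp_le)
    then have "Re (root_char k (- int (r * 1))) \<noteq> 1" using Re_root_char_eq_1_iff[OF k_pos] by blast
    moreover have "Re (root_char k (- int (r * 1))) \<le> 1" using complex_Re_le_cmod norm_root_char by metis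
    ultimately show ?thesis by simp
  qed
  moreover have "Re (root_char k (- int (r * u))) \<le> 1" for u using complex_Re_le_cmod norm_root_char by metis
  ultimately have "(\<Sum>u\<in>units. Re (root_char k (- int (r * u)))) < (\<Sum>u\<in>units. 1)"
    by (intro sum_strict_mono_ex1 bexI[of _ 1]) auto
  then show ?thesis using k_pos by (simp add: char_coeff_def theta_def divide_strict_right_mono)
qed

text \<open>\<open>2 * c\<close> is at most the smallest gap, which leaves two portions of size
  \<open>c\<close>: one is spent on error terms, the other is the final saving. The element
  \<open>theta / 2\<close> keeps the set nonempty and \<open>theta - 2 * c\<close>
  nonnegative.\<close>

lemma char_coeff_gap: "\<exists>c. 0 < c \<and> 2 * c \<le> theta \<and> (\<forall>r\<in>{0<..<k}. Re (char_coeff r) \<le> theta - 2 * c)"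
proof -
  define S where "S = insert (theta / 2) ((\<lambda>r. (theta - Re (char_coeff r)) / 2) ` {0<..<k})"
  have S: "finite S" "S \<noteq> {}" by (simp_all add: S_def)
  have "x > 0" if "x \<in> S" for x using that theta_pos Re_char_coeff_less by (auto simp: S_def)
  then have "Min S > 0" using S by simp
  moreover have "Min S \<le> theta / 2" using S by (intro Min_le) (auto simp: S_def)
  moreover have "Min S \<le> (theta - Re (char_coeff r)) / 2" if "r \<in> {0<..<k}" for r
    using S that by (intro Min_le) (auto simp: S_def)
  ultimately show ?thesis by (intro exI[of _ "Min S"]) (force simp: field_simps)
qed

section \<open>Harmonic sums over the integers coprime to \<open>k\<close>\<close>

definition coprime_harm :: "nat \<Rightarrow> real" where
  "coprime_harm n = (\<Sum>j=1..n. chi j / j)"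

text \<open>The partial sums are periodic because a full period contributes 0; fewer than
  \<open>k\<close> terms of size at most 1 remain.\<close>

lemma sum_chi_bound: "\<bar>\<Sum>j<n. chi j - theta\<bar> \<le> k"
proof -
  define S where "S = (\<lambda>n. \<Sum>j<n. chi j - theta)"
  have "(\<Sum>j<k. chi j) = card units"
  proof -
    have "{..<k} \<inter> {j. coprime j k} = units" by (auto simp: units_def)
    then show ?thesis by (simp add: chi_def sum.If_cases)
  qed
  then have Sk: "S k = 0" using k_pos by (simp add: S_def sum_subtractf theta_def)
  have S_add: "S (m + k) = S m" for m
  proof (induction m)
    case (Suc m)
    have "chi (m + k) = chi m" using chi_mod[of "m + k"] chi_mod[of m] by simp
    then show ?case using Suc by (simp add: S_def)
  qed (simp add: Sk, simp add: S_def)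
  have S_mod: "S (m + k * i) = S m" for m i
    by (induction i) (simp_all add: S_add add.assoc[symmetric] add.commute[of k])
  have "S n = S (n mod k)" using S_mod[of "n mod k" "n div k"] by simp
  also have "\<bar>\<dots>\<bar> \<le> (\<Sum>j<n mod k. \<bar>chi j - theta\<bar>)" unfolding S_def by (rule sum_abs)
  also have "\<dots> \<le> (\<Sum>j<n mod k. 1)"
    using theta_pos theta_le_1 by (intro sum_mono) (auto simp: chi_def abs_if)
  also have "\<dots> \<le> k" using k_pos by (simp add: less_imp_le)
  finally show ?thesis unfolding S_def .
qed

lemma coprime_harm_asymp: "\<exists>B\<ge>0. \<forall>n\<ge>1. \<bar>coprime_harm n - theta * ln n\<bar> \<le> B"
proof (intro exI[of _ "2 * (real k + 1) + 1"] conjI allI impI)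
  fix n :: nat assume n: "n \<ge> 1"
  define x where "x = (\<lambda>j. chi j - theta)"
  define T where "T = (\<lambda>n. \<Sum>j=1..n. x j)"
  have T: "\<bar>T n\<bar> \<le> k + 1" for n
  proof -
    have "{..<Suc n} = insert 0 {1..n}" by auto
    then have "(\<Sum>j<Suc n. x j) = x 0 + T n" by (simp add: T_def)
    moreover have "\<bar>\<Sum>j<Suc n. x j\<bar> \<le> k" unfolding x_def by (rule sum_chi_bound)
    moreover have "\<bar>x 0\<bar> \<le> 1" using theta_pos theta_le_1 by (auto simp: x_def chi_def abs_if)
    ultimately show ?thesis by linarith
  qed
  have frac: "a / (real n + 1) = a / (real (Suc n) + 1) + a / (real (Suc n) * (real (Suc n) + 1))"
    for a and n :: nat
    by (simp add: divide_simps) (simp add: algebra_simps)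
  \<comment> \<open>Summation by parts turns the bounded sums \<open>T\<close> into an absolutely
    convergent series with the telescoping weights 1 / (j (j + 1)).\<close>
  have abel: "(\<Sum>j=1..n. x j / j) = T n / (real n + 1) + (\<Sum>j=1..n. T j / (real j * (real j + 1)))" for n
  proof (induction n)
    case (Suc n)
    have T_Suc: "T (Suc n) = T n + x (Suc n)" by (simp add: T_def)
    have "(\<Sum>j=1..Suc n. x j / j) = (\<Sum>j=1..n. x j / j) + x (Suc n) / (real n + 1)"
      by (simp add: add.commute)
    also have "\<dots> = T (Suc n) / (real n + 1) + (\<Sum>j=1..n. T j / (real j * (real j + 1)))"
      unfolding Suc T_Suc by (simp add: add_divide_distrib)
    also have "\<dots> = T (Suc n) / (real (Suc n) + 1) + (\<Sum>j=1..Suc n. T j / (real j * (real j + 1)))"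
      using frac[of "T (Suc n)" n] by simp
    finally show ?case .
  qed (simp add: T_def)
  have tel: "(\<Sum>j=1..n. 1 / (real j * (real j + 1))) = 1 - 1 / (real n + 1)" for n :: nat
  proof (induction n)
    case (Suc n)
    then show ?case using frac[of 1 n] by simp
  qed simp
  have "\<bar>\<Sum>j=1..n. x j / j\<bar> \<le> \<bar>T n / (real n + 1)\<bar> + \<bar>\<Sum>j=1..n. T j / (real j * (real j + 1))\<bar>"
    unfolding abel by (rule abs_triangle_ineq)
  also have "\<bar>T n / (real n + 1)\<bar> \<le> real k + 1"
  proof -
    have "\<bar>T n / (real n + 1)\<bar> = \<bar>T n\<bar> / (real n + 1)" by simp
    also have "\<dots> \<le> \<bar>T n\<bar>" by (simp add: divide_le_eq mult_le_cancel_left1)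
    finally show ?thesis using T[of n] by simp
  qed
  also have "\<bar>\<Sum>j=1..n. T j / (real j * (real j + 1))\<bar> \<le> (\<Sum>j=1..n. (real k + 1) * (1 / (real j * (real j + 1))))"
  proof (rule order_trans[OF sum_abs sum_mono])
    fix j assume "j \<in> {1..n}"
    have "\<bar>T j / (real j * (real j + 1))\<bar> = \<bar>T j\<bar> * (1 / (real j * (real j + 1)))" by simp
    also have "\<dots> \<le> (real k + 1) * (1 / (real j * (real j + 1)))"
      using T[of j] by (intro mult_right_mono) auto
    finally show "\<bar>T j / (real j * (real j + 1))\<bar> \<le> (real k + 1) * (1 / (real j * (real j + 1)))" .
  qed
  also have "\<dots> = (real k + 1) * (1 - 1 / (real n + 1))" unfolding sum_distrib_left[symmetric] tel ..
  also have "\<dots> \<le> (real k + 1) * 1" by (intro mult_left_mono) auto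
  finally have 1: "\<bar>\<Sum>j=1..n. x j / j\<bar> \<le> 2 * (real k + 1)" by simp
  have "(\<Sum>j=1..n. x j / j) = coprime_harm n - theta * harm n"
    by (simp add: x_def coprime_harm_def harm_def left_diff_distrib sum_subtractf sum_distrib_left divide_inverse)
  moreover have "\<bar>theta * harm n - theta * ln n\<bar> \<le> 1"
  proof -
    have "harm n - ln n \<ge> (0::real)" using euler_mascheroni_sequence_nonneg[of n] n by simp
    moreover have "harm n - ln n \<le> (1::real)"
      using decseqD[OF decseq_harm_diff_ln, of 0 "n - 1"] n by (simp add: harm_Suc harm_def)
    ultimately have "\<bar>harm n - ln n\<bar> \<le> (1::real)" by simp
    moreover have "\<bar>theta * harm n - theta * ln n\<bar> = theta * \<bar>harm n - ln n\<bar>"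
      using theta_pos by (simp add: abs_mult flip: right_diff_distrib)
    ultimately show ?thesis using theta_le_1 theta_pos by (metis mult_le_one abs_ge_zero less_imp_le)
  qed
  ultimately show "\<bar>coprime_harm n - theta * ln n\<bar> \<le> 2 * (real k + 1) + 1" using 1 by linarith
qed simp

lemma exp_coprime_harm_bounds:
  "\<exists>B>0. (\<forall>n\<ge>1. exp (coprime_harm n) \<ge> real n powr theta / B) \<and> (\<forall>Y\<ge>1. exp (coprime_harm (Y - 1)) \<le> B * real Y powr theta)
     \<and> (\<forall>Y\<ge>1. \<forall>n\<ge>Y. exp (\<Sum>j=Y..n. chi j / j) \<le> B * (real n / real Y) powr theta)"
proof -
  obtain B where B: "B \<ge> 0" "\<And>n. n \<ge> 1 \<Longrightarrow> \<bar>coprime_harm n - theta * ln n\<bar> \<le> B" using coprime_harm_asymp by blast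
  have up: "coprime_harm (Y - 1) \<le> theta * ln Y + B" if "Y \<ge> 1" for Y
  proof -
    have "coprime_harm (Y - 1) \<le> coprime_harm Y" unfolding coprime_harm_def by (rule sum_mono2) auto
    then show ?thesis using B(2)[OF that] by linarith
  qed
  have low: "coprime_harm (Y - 1) \<ge> theta * ln Y - B - 1" if "Y \<ge> 1" for Y
  proof -
    have "coprime_harm Y = coprime_harm (Y - 1) + chi Y / Y" using that unfolding coprime_harm_def by (cases Y) auto
    moreover have "chi Y / Y \<le> 1"
      using order_trans[OF chi_le_1[of Y], of "real Y"] that by (simp add: divide_le_eq_1)
    ultimately show ?thesis using B(2)[OF that] by linarith
  qed
  have pw: "real n powr theta = exp (theta * ln n)" if "n \<ge> 1" for n :: nat using that by (simp add: powr_def)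
  show ?thesis
  \<comment> \<open>In the exponent, \<open>B\<close> is lost at either end of the range of
    summation and 1 at the term \<open>j = Y\<close>, when passing from \<open>Y\<close> to
    \<open>Y - 1\<close>.\<close>
  proof (intro exI[of _ "exp (2 * B + 1)"] conjI allI impI)
    fix n :: nat assume n: "n \<ge> 1"
    have "real n powr theta / exp (2 * B + 1) = exp (theta * ln n - (2 * B + 1))"
      using pw[OF n] by (simp add: exp_diff)
    also have "\<dots> \<le> exp (coprime_harm n)" using B(1) B(2)[OF n] by (simp only: exp_le_cancel_iff)
    finally show "exp (coprime_harm n) \<ge> real n powr theta / exp (2 * B + 1)" .
  next
    fix Y :: nat assume Y: "Y \<ge> 1"
    have "exp (coprime_harm (Y - 1)) \<le> exp (2 * B + 1 + theta * ln Y)"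
      using B(1) up[OF Y] by (simp only: exp_le_cancel_iff)
    then show "exp (coprime_harm (Y - 1)) \<le> exp (2 * B + 1) * real Y powr theta"
      using pw[OF Y] by (simp add: exp_add)
  next
    fix Y n :: nat assume Y: "Y \<ge> 1" "n \<ge> Y"
    have "{1..n} = {1..Y - 1} \<union> {Y..n}" using Y by auto
    then have "coprime_harm n = coprime_harm (Y - 1) + (\<Sum>j=Y..n. chi j / j)"
      unfolding coprime_harm_def using Y by (simp add: sum.union_disjoint)
    then have "(\<Sum>j=Y..n. chi j / j) \<le> theta * ln n - theta * ln Y + (2 * B + 1)"
      using low[OF Y(1)] B(2)[of n] Y by linarith
    then have "exp (\<Sum>j=Y..n. chi j / j) \<le> exp (2 * B + 1 + theta * (ln n - ln Y))"
      by (simp only: exp_le_cancel_iff) (simp add: algebra_simps)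
    also have "\<dots> = exp (2 * B + 1) * (real n / real Y) powr theta"
      using Y by (simp add: exp_add powr_def ln_div)
    finally show "exp (\<Sum>j=Y..n. chi j / j) \<le> exp (2 * B + 1) * (real n / real Y) powr theta" .
  qed simp
qed

text \<open>The proportion of permutations of \<open>n\<close> points all of whose cycle lengths are
  at least \<open>Y\<close> and coprime to \<open>k\<close>.\<close>

definition rough_coeff :: "nat \<Rightarrow> nat \<Rightarrow> real" where
  "rough_coeff Y = fps_nth (exp_fps (\<lambda>j. if Y \<le> j then chi j else 0))"

definition rough_sum :: "nat \<Rightarrow> nat \<Rightarrow> real" where
  "rough_sum Y n = (\<Sum>m<n. rough_coeff Y m)"

definition twisted_sum :: "nat \<Rightarrow> nat \<Rightarrow> nat \<Rightarrow> complex" where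
  "twisted_sum Y r n = (\<Sum>m<n. of_real (rough_coeff Y m) * root_char k (- int (r * m)))"

lemma rough_coeff_nonneg: "0 \<le> rough_coeff Y n"
  unfolding rough_coeff_def by (rule exp_fps_nonneg) simp

lemma rough_sum_nonneg: "0 \<le> rough_sum Y n"
  unfolding rough_sum_def by (intro sum_nonneg) (simp add: rough_coeff_nonneg)

lemma rough_sum_mono: "m \<le> n \<Longrightarrow> rough_sum Y m \<le> rough_sum Y n"
  unfolding rough_sum_def by (rule sum_mono2) (auto simp: rough_coeff_nonneg)

lemma twisted_sum_0: "twisted_sum Y 0 n = of_real (rough_sum Y n)"
  by (simp add: twisted_sum_def rough_sum_def)

lemma norm_twisted_sum_le: "norm (twisted_sum Y r n) \<le> rough_sum Y n"
  unfolding twisted_sum_def rough_sum_def by (rule sum_norm_le) (simp add: norm_mult rough_coeff_nonneg)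

text \<open>The lengths \<open>j \<ge> Y\<close> correspond to the indices
  \<open>m = n - j \<le> n - Y\<close>, whence the bound \<open>n + 1 - Y\<close>.\<close>

lemma rough_coeff_rec:
  assumes "Y \<ge> 1" "n \<ge> Y"
  shows "real n * rough_coeff Y n = (\<Sum>m<n + 1 - Y. rough_coeff Y m * chi (n - m))"
proof -
  have "real n * rough_coeff Y n = (\<Sum>j=1..n. (if Y \<le> j then chi j else 0) * rough_coeff Y (n - j))"
    unfolding rough_coeff_def by (rule exp_fps_rec)
  also have "\<dots> = (\<Sum>j=Y..n. chi j * rough_coeff Y (n - j))"
    by (rule sum.mono_neutral_cong_right) (use assms in auto)
  also have "\<dots> = (\<Sum>m<n + 1 - Y. rough_coeff Y m * chi (n - m))"
    by (rule sum.reindex_bij_witness[of _ "\<lambda>m. n - m" "\<lambda>j. n - j"]) (use assms in auto)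
  finally show ?thesis .
qed

text \<open>Expanding \<open>chi (n - m)\<close> in characters separates \<open>n\<close> from
  \<open>m\<close>, so that only the \<open>k\<close> twisted sums enter the recursion.\<close>

lemma rough_coeff_rec_char:
  assumes "Y \<ge> 1" "n \<ge> Y"
  shows "of_nat n * complex_of_real (rough_coeff Y n) =
    (\<Sum>r<k. char_coeff r * root_char k (int (r * n)) * twisted_sum Y r (n + 1 - Y))"
proof -
  have "of_nat n * complex_of_real (rough_coeff Y n) = complex_of_real (real n * rough_coeff Y n)" by simp
  also have "\<dots> = (\<Sum>m<n + 1 - Y. complex_of_real (rough_coeff Y m) * complex_of_real (chi (n - m)))"
    unfolding rough_coeff_rec[OF assms] by simp
  also have "\<dots> = (\<Sum>m<n + 1 - Y. \<Sum>r<k. complex_of_real (rough_coeff Y m) * (char_coeff r * root_char k (int (r * n)) * root_char k (- int (r * m))))"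
  proof (rule sum.cong[OF refl])
    fix m assume "m \<in> {..<n + 1 - Y}"
    then have "m \<le> n" using assms by auto
    then have eq: "int (r * (n - m)) = int (r * n) + - int (r * m)" for r
      by (simp add: of_nat_diff right_diff_distrib)
    show "complex_of_real (rough_coeff Y m) * complex_of_real (chi (n - m)) =
       (\<Sum>r<k. complex_of_real (rough_coeff Y m) * (char_coeff r * root_char k (int (r * n)) * root_char k (- int (r * m))))"
      unfolding chi_expansion sum_distrib_left
      by (intro sum.cong refl) (simp only: eq root_char_add mult.assoc)
  qed
  also have "\<dots> = (\<Sum>r<k. char_coeff r * root_char k (int (r * n)) * twisted_sum Y r (n + 1 - Y))"
    unfolding twisted_sum_def sum_distrib_left by (subst sum.swap) (simp add: mult_ac)
  finally show ?thesis .
qed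

text \<open>The sum is bounded by the value of the truncated exponential at 1; the recursion with
  \<open>chi \<le> 1\<close> passes the bound on to a single coefficient.\<close>

lemma rough_bounds:
  "\<exists>C>0. \<forall>Y\<ge>1. \<forall>n\<ge>Y. rough_sum Y n \<le> C * (real n / real Y) powr theta \<and> rough_coeff Y n \<le> C * (real n / real Y) powr theta / n"
proof -
  obtain B where B: "B > 0" "\<And>Y n. Y \<ge> 1 \<Longrightarrow> n \<ge> Y \<Longrightarrow> exp (\<Sum>j=Y..n. chi j / j) \<le> B * (real n / real Y) powr theta"
    using exp_coprime_harm_bounds by blast
  have "rough_sum Y n \<le> B * (real n / real Y) powr theta \<and> rough_coeff Y n \<le> B * (real n / real Y) powr theta / n"
    if Y: "Y \<ge> 1" "n \<ge> Y" for Y n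
  proof -
    have "rough_sum Y n \<le> (\<Sum>m\<le>n. rough_coeff Y m)" unfolding rough_sum_def by (rule sum_mono2) (auto simp: rough_coeff_nonneg)
    also have "\<dots> \<le> exp (\<Sum>j=1..n. (if Y \<le> j then chi j else 0) / j)"
      unfolding rough_coeff_def by (rule sum_exp_fps_le) simp
    also have "(\<Sum>j=1..n. (if Y \<le> j then chi j else 0) / j) = (\<Sum>j=Y..n. chi j / j)"
      by (rule sum.mono_neutral_cong_right) (use Y in auto)
    finally have 1: "rough_sum Y n \<le> B * (real n / real Y) powr theta" using B(2)[OF Y] by linarith
    have "real n * rough_coeff Y n \<le> (\<Sum>m<n + 1 - Y. rough_coeff Y m)"
      unfolding rough_coeff_rec[OF Y] by (intro sum_mono) (simp add: mult_left_le rough_coeff_nonneg)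
    also have "\<dots> \<le> rough_sum Y n" unfolding rough_sum_def[symmetric] by (rule rough_sum_mono) (use Y in auto)
    finally have "real n * rough_coeff Y n \<le> B * (real n / real Y) powr theta" using 1 by linarith
    then show ?thesis using 1 Y by (simp add: field_simps)
  qed
  then show ?thesis using B(1) by blast
qed

end

text \<open>To first order only \<open>Re x\<close> counts. The factors \<open>1 + x\<close> of the
  recursion for the twisted sums thus produce growth governed by the real part of the Fourier
  coefficient.\<close>

lemma norm_one_plus_le:
  assumes "cmod x \<le> 1 / 2"
  shows "cmod (1 + x) \<le> 1 + Re x + (cmod x)\<^sup>2"
proof (rule power2_le_imp_le)
  have q: "(cmod x)\<^sup>2 = (Re x)\<^sup>2 + (Im x)\<^sup>2" by (rule cmod_power2)
  have R: "1 + Re x \<ge> 1 / 2" using assms abs_Re_le_cmod[of x] by linarith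
  have "(1 + Re x + (cmod x)\<^sup>2)\<^sup>2 = (1 + Re x)\<^sup>2 + 2 * (1 + Re x) * (cmod x)\<^sup>2 + ((cmod x)\<^sup>2)\<^sup>2"
    by (simp add: power2_eq_square algebra_simps)
  moreover have "2 * (1 + Re x) * (cmod x)\<^sup>2 \<ge> 1 * (cmod x)\<^sup>2" using R by (intro mult_right_mono) auto
  moreover have "(cmod x)\<^sup>2 \<ge> (Im x)\<^sup>2" using q by simp
  moreover have "((cmod x)\<^sup>2)\<^sup>2 \<ge> 0" by simp
  moreover have "(cmod (1 + x))\<^sup>2 = (1 + Re x)\<^sup>2 + (Im x)\<^sup>2" by (simp add: cmod_power2)
  ultimately show "(cmod (1 + x))\<^sup>2 \<le> (1 + Re x + (cmod x)\<^sup>2)\<^sup>2" by linarith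
  show "0 \<le> 1 + Re x + (cmod x)\<^sup>2" using R by (simp add: add_nonneg_nonneg)
qed

lemma powr_one_plus_ge:
  fixes x \<alpha> :: real
  assumes "0 \<le> x" "x \<le> 1" "0 \<le> \<alpha>"
  shows "(1 + x) powr \<alpha> \<ge> 1 + \<alpha> * (x - x\<^sup>2)"
proof -
  have "1 + \<alpha> * (x - x\<^sup>2) \<le> 1 + \<alpha> * ln (1 + x)"
    using ln_one_plus_pos_lower_bound[OF assms(1,2)] assms(3) by (simp add: mult_left_mono)
  also have "\<dots> \<le> exp (\<alpha> * ln (1 + x))" by (rule exp_ge_add_one_self)
  also have "\<dots> = (1 + x) powr \<alpha>" using assms by (simp add: powr_def)
  finally show ?thesis .
qed

lemma powr_one_plus_le:
  fixes x \<alpha> :: real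
  assumes "0 \<le> x" "0 \<le> \<alpha>" "\<alpha> \<le> 1"
  shows "(1 + x) powr \<alpha> \<le> 1 + \<alpha> * x"
  using Youngs_inequality_0[of \<alpha> "1 - \<alpha>" "1 + x" 1] assms by (simp add: algebra_simps)

section \<open>The almost diagonal recursion for the twisted sums\<close>

context coprime_lengths
begin

lemma powr_shift_le:
  assumes "Y \<ge> (1::nat)" "n \<ge> 1" "m \<le> n + k"
  shows "(real m / real Y) powr theta \<le> (1 + k) * (real n / real Y) powr theta"
proof -
  have "real m \<le> (1 + real k) * real n"
  proof -
    have "real k * 1 \<le> real k * real n" using assms(2) by (intro mult_left_mono) auto
    then show ?thesis using assms(3) by (simp add: distrib_right flip: of_nat_add)
  qed
  then have "real m / real Y \<le> (1 + real k) * (real n / real Y)"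
    using assms(1) by (simp add: divide_right_mono)
  then have "(real m / real Y) powr theta \<le> ((1 + real k) * (real n / real Y)) powr theta"
    using theta_pos by (intro powr_mono2) auto
  also have "\<dots> = (1 + real k) powr theta * (real n / real Y) powr theta" by (rule powr_mult)
  also have "\<dots> \<le> (1 + real k) powr 1 * (real n / real Y) powr theta"
    using theta_le_1 by (intro mult_right_mono powr_mono) auto
  finally show ?thesis by (simp add: add.commute)
qed

lemma norm_twisted_sum_diff_le:
  assumes "a \<le> b"
  shows "norm (twisted_sum Y r b - twisted_sum Y r a) \<le> (\<Sum>m\<in>{a..<b}. rough_coeff Y m)"
proof -
  have "{..<b} = {..<a} \<union> {a..<b}" using assms by auto
  then have "twisted_sum Y r b - twisted_sum Y r a = (\<Sum>m\<in>{a..<b}. of_real (rough_coeff Y m) * root_char k (- int (r * m)))"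
    unfolding twisted_sum_def by (simp add: sum.union_disjoint ivl_disj_int)
  also have "norm \<dots> \<le> (\<Sum>m\<in>{a..<b}. rough_coeff Y m)" by (rule sum_norm_le) (simp add: norm_mult rough_coeff_nonneg)
  finally show ?thesis .
qed

text \<open>In \<open>rough_coeff_rec_char\<close> at \<open>n + i\<close> the sums end near
  \<open>n - Y\<close> and the divisor is \<open>n + i\<close>. Moving both to \<open>n\<close>
  concerns at most \<open>Y + k\<close> coefficients, each of size (n / Y)^theta / n. The base point
  \<open>n\<close> is then common to a whole period of indices.\<close>

lemma rough_coeff_near:
  "\<exists>C>0. \<forall>Y\<ge>1. \<forall>n\<ge>2*Y. \<forall>i\<le>k.
     norm (of_real (rough_coeff Y (n + i)) - (\<Sum>s<k. char_coeff s * root_char k (int (s * (n + i))) * twisted_sum Y s n) / of_nat n)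
       \<le> C * Y * (real n / real Y) powr theta / (real n)\<^sup>2"
proof -
  obtain C1 where C1: "C1 > 0" "\<And>Y n. Y \<ge> 1 \<Longrightarrow> n \<ge> Y \<Longrightarrow> rough_coeff Y n \<le> C1 * (real n / real Y) powr theta / n"
    using rough_bounds by blast
  \<comment> \<open>The 2 comes from \<open>n \<le> 2 * m\<close> in the denominator, the factor
    \<open>1 + k\<close> from \<open>powr_shift_le\<close>.\<close>
  define C2 where "C2 = 2 * C1 * (1 + k)"
  have C2: "C2 > 0" using C1 by (simp add: C2_def)
  define C where "C = k * (C2 * (1 + k)) + k * C2"
  have "norm (of_real (rough_coeff Y (n + i)) - (\<Sum>s<k. char_coeff s * root_char k (int (s * (n + i))) * twisted_sum Y s n) / of_nat n)
       \<le> C * Y * (real n / real Y) powr theta / (real n)\<^sup>2"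
    if Y: "Y \<ge> 1" "n \<ge> 2 * Y" and i: "i \<le> k" for Y n i
  proof -
    define psi where "psi = (real n / real Y) powr theta"
    have psi: "psi \<ge> 0" by (simp add: psi_def)
    have n: "n \<ge> 1" using Y by simp
    have gm: "rough_coeff Y m \<le> C2 * psi / n" if m: "m \<ge> n + 1 - Y" "m \<le> n + k" for m
    proof -
      have mY: "m \<ge> Y" "n \<le> 2 * m" using m Y by auto
      have "rough_coeff Y m \<le> C1 * (real m / real Y) powr theta / m" by (rule C1(2)) (use Y mY in auto)
      also have "\<dots> \<le> C1 * ((1 + k) * psi) / m"
        unfolding psi_def using powr_shift_le[OF Y(1) n m(2)] C1(1)
        by (intro divide_right_mono mult_left_mono) auto
      also have "\<dots> \<le> C1 * ((1 + k) * psi) / (n / 2)"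
        using mY n C1(1) psi Y by (intro divide_left_mono) auto
      finally show ?thesis by (simp add: C2_def mult_ac)
    qed
    define N where "N = n + i + 1 - Y"
    have Xd: "norm (twisted_sum Y s N - twisted_sum Y s n) \<le> (1 + k) * Y * (C2 * psi / n)" for s
    proof -
      \<comment> \<open>The end point \<open>N\<close> lies on either side of \<open>n\<close>,
        depending on \<open>i\<close> and \<open>Y\<close>.\<close>
      define a where "a = min N n"
      define b where "b = max N n"
      have ab: "a \<le> b" by (simp add: a_def b_def)
      have "norm (twisted_sum Y s N - twisted_sum Y s n) = norm (twisted_sum Y s b - twisted_sum Y s a)"
        by (auto simp: a_def b_def min_def max_def norm_minus_commute)
      also have "\<dots> \<le> (\<Sum>m\<in>{a..<b}. rough_coeff Y m)" by (rule norm_twisted_sum_diff_le[OF ab])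
      also have "\<dots> \<le> (\<Sum>m\<in>{a..<b}. C2 * psi / n)"
        by (rule sum_mono, rule gm) (use Y i in \<open>auto simp: a_def b_def N_def min_def max_def split: if_splits\<close>)
      also have "\<dots> = real (b - a) * (C2 * psi / n)" by simp
      also have "\<dots> \<le> (1 + k) * Y * (C2 * psi / n)"
      proof (rule mult_right_mono)
        have "b - a \<le> Y + k" using Y i by (auto simp: a_def b_def N_def)
        also have "\<dots> \<le> (1 + k) * Y" using Y(1) by (simp add: mult_le_mono2[of 1 Y k, simplified])
        finally show "real (b - a) \<le> (1 + k) * Y" by (metis of_nat_le_iff of_nat_mult of_nat_add of_nat_1)
      qed (use C2 psi in auto)
      finally show ?thesis .
    qed
    let ?c = "\<lambda>s. char_coeff s * root_char k (int (s * (n + i)))"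
    have nc: "norm (?c s) \<le> 1" for s using norm_char_coeff_le[of s] by (simp add: norm_mult)
    have rec: "of_nat (n + i) * complex_of_real (rough_coeff Y (n + i)) = (\<Sum>s<k. ?c s * twisted_sum Y s N)"
      unfolding N_def by (rule rough_coeff_rec_char) (use Y in auto)
    have h: "of_nat n * complex_of_real (rough_coeff Y (n + i)) =
        of_nat (n + i) * of_real (rough_coeff Y (n + i)) - of_nat i * of_real (rough_coeff Y (n + i))"
      by (simp add: distrib_right)
    have sd: "(\<Sum>s<k. ?c s * (twisted_sum Y s N - twisted_sum Y s n)) = (\<Sum>s<k. ?c s * twisted_sum Y s N) - (\<Sum>s<k. ?c s * twisted_sum Y s n)"
      by (simp only: right_diff_distrib sum_subtractf)
    have diff: "of_nat n * complex_of_real (rough_coeff Y (n + i)) - (\<Sum>s<k. ?c s * twisted_sum Y s n)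
       = (\<Sum>s<k. ?c s * (twisted_sum Y s N - twisted_sum Y s n)) - of_nat i * of_real (rough_coeff Y (n + i))"
    proof -
      have comm: "a - c - b = a - b - c" for a b c :: complex by (simp add: algebra_simps)
      show ?thesis unfolding h rec sd by (rule comm)
    qed
    have "norm (of_nat n * complex_of_real (rough_coeff Y (n + i)) - (\<Sum>s<k. ?c s * twisted_sum Y s n)) \<le> norm (\<Sum>s<k. ?c s * (twisted_sum Y s N - twisted_sum Y s n)) + norm (of_nat i * complex_of_real (rough_coeff Y (n + i)))"
      unfolding diff by (rule norm_triangle_ineq4)
    also have "\<dots> \<le> k * ((1 + k) * Y * (C2 * psi / n)) + k * (Y * (C2 * psi / n))"
    proof (rule add_mono)
      have "norm (?c s * (twisted_sum Y s N - twisted_sum Y s n)) \<le> 1 * ((1 + k) * Y * (C2 * psi / n))" for s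
        by (subst norm_mult, rule mult_mono[OF nc Xd]) auto
      then have "norm (\<Sum>s<k. ?c s * (twisted_sum Y s N - twisted_sum Y s n)) \<le> (\<Sum>s<k. (1 + k) * Y * (C2 * psi / n))"
        by (intro sum_norm_le) simp
      then show "norm (\<Sum>s<k. ?c s * (twisted_sum Y s N - twisted_sum Y s n)) \<le> k * ((1 + k) * Y * (C2 * psi / n))" by simp
      have "rough_coeff Y (n + i) \<le> C2 * psi / n" by (rule gm) (use Y i in auto)
      also have "\<dots> \<le> Y * (C2 * psi / n)"
        using mult_right_mono[of 1 "real Y" "C2 * psi / n"] Y C2 psi by simp
      finally have "i * rough_coeff Y (n + i) \<le> k * (Y * (C2 * psi / n))"
        using i rough_coeff_nonneg by (intro mult_mono) auto
      then show "norm (of_nat i * complex_of_real (rough_coeff Y (n + i))) \<le> k * (Y * (C2 * psi / n))"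
        by (simp add: norm_mult rough_coeff_nonneg)
    qed
    also have "\<dots> = C * Y * psi / n" by (simp add: C_def algebra_simps add_divide_distrib)
    finally have 1: "norm (of_nat n * complex_of_real (rough_coeff Y (n + i)) - (\<Sum>s<k. ?c s * twisted_sum Y s n)) \<le> C * Y * psi / n" .
    have "of_real (rough_coeff Y (n + i)) - (\<Sum>s<k. ?c s * twisted_sum Y s n) / of_nat n
       = (of_nat n * complex_of_real (rough_coeff Y (n + i)) - (\<Sum>s<k. ?c s * twisted_sum Y s n)) / of_nat n"
      using n by (simp add: diff_divide_distrib)
    also have "norm \<dots> \<le> C * Y * psi / n / n"
      unfolding norm_divide using divide_right_mono[OF 1, of n] by simp
    finally show ?thesis by (simp add: psi_def power2_eq_square)
  qed
  moreover have "C > 0" using C2 k_pos by (simp add: C_def add_nonneg_pos)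
  ultimately show ?thesis by blast
qed

text \<open>Over \<open>k\<close> consecutive indices, the orthogonality of characters removes all
  twisted sums except the \<open>r\<close>-th. The system decouples up to the error of
  \<open>rough_coeff_near\<close>.\<close>

lemma twisted_sum_step:
  "\<exists>C>0. \<forall>Y\<ge>1. \<forall>n\<ge>2*Y. \<forall>r<k.
     norm (twisted_sum Y r (n + k) - (1 + of_nat k * char_coeff r / of_nat n) * twisted_sum Y r n)
       \<le> C * Y * (real n / real Y) powr theta / (real n)\<^sup>2"
proof -
  obtain C where C: "C > 0" "\<And>Y n i. Y \<ge> 1 \<Longrightarrow> n \<ge> 2 * Y \<Longrightarrow> i \<le> k \<Longrightarrow>
    norm (of_real (rough_coeff Y (n + i)) - (\<Sum>s<k. char_coeff s * root_char k (int (s * (n + i))) * twisted_sum Y s n) / of_nat n)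
       \<le> C * Y * (real n / real Y) powr theta / (real n)\<^sup>2"
    using rough_coeff_near by blast
  have "norm (twisted_sum Y r (n + k) - (1 + of_nat k * char_coeff r / of_nat n) * twisted_sum Y r n)
       \<le> (k * C) * Y * (real n / real Y) powr theta / (real n)\<^sup>2"
    if Y: "Y \<ge> 1" "n \<ge> 2 * Y" and r: "r < k" for Y n r
  proof -
    define S where "S = (\<lambda>i. (\<Sum>s<k. char_coeff s * root_char k (int (s * (n + i))) * twisted_sum Y s n) / of_nat n)"
    define E where "E = C * Y * (real n / real Y) powr theta / (real n)\<^sup>2"
    have split: "twisted_sum Y r (n + m) = twisted_sum Y r n + (\<Sum>i<m. root_char k (- int (r * (n + i))) * of_real (rough_coeff Y (n + i)))" for m
      by (induction m) (simp_all add: twisted_sum_def mult.commute)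
    have "(\<Sum>i<k. root_char k (- int (r * (n + i))) * S i)
       = (\<Sum>s<k. char_coeff s * twisted_sum Y s n / of_nat n * (\<Sum>i<k. root_char k ((int s - int r) * (int n + int i))))"
      unfolding S_def sum_divide_distrib sum_distrib_left
      by (subst sum.swap, intro sum.cong refl)
         (simp add: mult_ac left_diff_distrib distrib_left root_char_add[symmetric] algebra_simps)
    also have "\<dots> = (\<Sum>s<k. if s = r then of_nat k * char_coeff r * twisted_sum Y r n / of_nat n else 0)"
    proof (rule sum.cong[OF refl])
      fix s assume "s \<in> {..<k}"
      then have "int k dvd int s - int r \<longleftrightarrow> s = r"
        using r by (metis lessThan_iff mod_eq_dvd_iff mod_less of_nat_eq_iff zmod_int)
      then show "char_coeff s * twisted_sum Y s n / of_nat n * (\<Sum>i<k. root_char k ((int s - int r) * (int n + int i)))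
        = (if s = r then of_nat k * char_coeff r * twisted_sum Y r n / of_nat n else 0)"
        unfolding sum_root_char[OF k_pos] by simp
    qed
    also have "\<dots> = of_nat k * char_coeff r * twisted_sum Y r n / of_nat n" using r by simp
    finally have "twisted_sum Y r (n + k) - (1 + of_nat k * char_coeff r / of_nat n) * twisted_sum Y r n
      = (\<Sum>i<k. root_char k (- int (r * (n + i))) * (of_real (rough_coeff Y (n + i)) - S i))"
      unfolding split by (simp add: right_diff_distrib sum_subtractf algebra_simps)
    also have "norm \<dots> \<le> (\<Sum>i<k. E)"
    proof (rule sum_norm_le)
      fix i assume "i \<in> {..<k}"
      then show "norm (root_char k (- int (r * (n + i))) * (of_real (rough_coeff Y (n + i)) - S i)) \<le> E"
        using C(2)[OF Y, of i] by (simp add: norm_mult S_def E_def)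
    qed
    also have "\<dots> = (k * C) * Y * (real n / real Y) powr theta / (real n)\<^sup>2" by (simp add: E_def)
    finally show ?thesis .
  qed
  moreover have "k * C > 0" using C k_pos by simp
  ultimately show ?thesis by blast
qed

text \<open>Induction in steps of \<open>k\<close>: a step multiplies by about 1 + k (theta - 2c) /
  m, whereas the claimed bound grows by (1 + k / m)^(theta - c). The difference of the exponents
  pays for the second order terms and the inhomogeneous error.\<close>

lemma twisted_sum_small:
  "\<exists>c>0. \<exists>K>0. 2 * c \<le> theta \<and> (\<forall>Y\<ge>1. \<forall>n\<ge>2*Y. \<forall>r\<in>{0<..<k}.
     norm (twisted_sum Y r n) \<le> K * (real n / real Y) powr (theta - c))"
proof -
  obtain c where c: "c > 0" "2 * c \<le> theta" "\<And>r. r \<in> {0<..<k} \<Longrightarrow> Re (char_coeff r) \<le> theta - 2 * c"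
    using char_coeff_gap by blast
  obtain C1 where C1: "C1 > 0" "\<And>Y n. Y \<ge> 1 \<Longrightarrow> n \<ge> Y \<Longrightarrow> rough_sum Y n \<le> C1 * (real n / real Y) powr theta"
    using rough_bounds by blast
  obtain C where C: "C > 0" "\<And>Y n r. Y \<ge> 1 \<Longrightarrow> n \<ge> 2 * Y \<Longrightarrow> r < k \<Longrightarrow>
     norm (twisted_sum Y r (n + k) - (1 + of_nat k * char_coeff r / of_nat n) * twisted_sum Y r n)
       \<le> C * Y * (real n / real Y) powr theta / (real n)\<^sup>2"
    using twisted_sum_step by blast
  have c1: "c \<le> 1" "theta - c \<ge> 0" "theta - c \<le> 1" "theta - 2 * c \<ge> 0" using c theta_le_1 by auto
  \<comment> \<open>From \<open>m \<ge> N0\<close> follow \<open>k / m \<le> c / 2\<close> and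
    \<open>k / m \<le> 1 / 2\<close>; \<open>N0 \<ge> 2\<close> yields
    \<open>m \<ge> 2 * Y\<close>.\<close>
  define N0 where "N0 = nat \<lceil>2 * real k / c\<rceil> + 2 * k + 2"
  have N0: "real N0 \<ge> 2 * real k / c" "N0 \<ge> 2 * k" "N0 \<ge> 2" unfolding N0_def by linarith+
  \<comment> \<open>\<open>C4\<close> collects the error \<open>C\<close> of one step and the square
    term of \<open>norm_one_plus_le\<close>. The first summand of \<open>K\<close> makes
    \<open>C4 / K\<close> at most \<open>c * k / 2\<close>; the second covers the initial range,
    where only the trivial bound is used.\<close>
  define C4 where "C4 = real k * real k * C1 + C"
  define K where "K = 2 * C4 / (c * k) + C1 * (N0 + k)"
  have C4: "C4 > 0" using C C1 by (simp add: C4_def add_nonneg_pos)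
  have K: "K > 0" using c C4 C1 k_pos by (simp add: K_def add_pos_nonneg)
  have "norm (twisted_sum Y r n) \<le> K * (real n / real Y) powr (theta - c)"
    if Y: "Y \<ge> 1" and r: "r \<in> {0<..<k}" and n: "n \<ge> 2 * Y" for Y n r
    using n
  proof (induction n rule: less_induct)
    case (less n)
    define P where "P = (\<lambda>n. (real n / real Y) powr (theta - c))"
    show ?case
    proof (cases "n < N0 * Y + k")
      case True
      have "norm (twisted_sum Y r n) \<le> C1 * (real n / real Y) powr theta"
        using order_trans[OF norm_twisted_sum_le C1(2)[OF Y]] less.prems Y by simp
      also have "(real n / real Y) powr theta \<le> real (N0 + k)"
      proof -
        have "n \<le> N0 * Y + k * Y" using True mult_le_mono2[OF Y, of k] by linarith
        then have "real n \<le> real (N0 + k) * real Y" by (metis distrib_right of_nat_le_iff of_nat_mult)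
        then have "real n / real Y \<le> real (N0 + k)" using Y by (simp add: pos_divide_le_eq)
        moreover have "real n / real Y \<ge> 1" using less.prems Y by (simp add: pos_le_divide_eq)
        moreover from this have "(real n / real Y) powr theta \<le> (real n / real Y) powr 1"
          using theta_le_1 by (intro powr_mono) auto
        ultimately show ?thesis by simp
      qed
      also have "C1 * real (N0 + k) \<le> K" using c C4 k_pos by (simp add: K_def)
      also have "K \<le> K * (real n / real Y) powr (theta - c)"
      proof -
        have "real n / real Y \<ge> 1" using less.prems Y by (simp add: pos_le_divide_eq)
        then have "(real n / real Y) powr (theta - c) \<ge> 1" using c1 by (simp add: ge_one_powr_ge_zero)
        then show ?thesis using K by simp
      qed
      finally show ?thesis using C1(1) by simp
    next
      case False
      define m where "m = n - k"
      have m: "n = m + k" "m \<ge> N0 * Y" using False by (auto simp: m_def)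
      have "N0 * Y \<ge> 2 * Y" "N0 * Y \<ge> N0" using N0(3) Y by auto
      then have m2: "m \<ge> 2 * Y" "m \<ge> N0" using m by linarith+
      then have mk: "real m \<ge> 2 * k / c" "m \<ge> 2 * k" "m \<ge> 1" "m \<ge> Y" using N0 by linarith+
      have IH: "norm (twisted_sum Y r m) \<le> K * P m"
        unfolding P_def by (rule less.IH) (use m k_pos m2 in auto)
      let ?x = "of_nat k * char_coeff r / of_nat m :: complex"
      have xk: "cmod ?x \<le> k / m" using norm_char_coeff_le[of r] mk
        by (simp add: norm_mult norm_divide divide_right_mono mult_left_le)
      have xh: "cmod ?x \<le> 1 / 2"
        using mk by (intro order_trans[OF xk]) (simp add: field_simps)
      have ratio: "real m / real Y \<ge> 1" using mk Y by (simp add: pos_le_divide_eq)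
      have psi: "(real m / real Y) powr theta \<le> P m * (real m / real Y)"
      proof -
        have "(real m / real Y) powr theta = P m * (real m / real Y) powr c"
          by (simp add: P_def powr_add[symmetric])
        also have "\<dots> \<le> P m * (real m / real Y) powr 1"
          using c1 ratio by (intro mult_left_mono powr_mono) (auto simp: P_def)
        finally show ?thesis using ratio by simp
      qed
      have unit: "Y * (real m / real Y) powr theta / (real m)\<^sup>2 \<le> P m / m"
      proof -
        have "Y * (real m / real Y) powr theta / (real m)\<^sup>2 \<le> Y * (P m * (real m / real Y)) / (real m)\<^sup>2"
          using psi by (intro divide_right_mono mult_left_mono) auto
        also have "\<dots> = P m / m" using Y mk by (simp add: power2_eq_square)
        finally show ?thesis .
      qed
      have "norm (twisted_sum Y r n) \<le> norm (twisted_sum Y r (m + k) - (1 + ?x) * twisted_sum Y r m) + norm ((1 + ?x) * twisted_sum Y r m)"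
        unfolding m(1) by (metis diff_add_cancel norm_triangle_ineq)
      also have "norm (twisted_sum Y r (m + k) - (1 + ?x) * twisted_sum Y r m) \<le> C * Y * (real m / real Y) powr theta / (real m)\<^sup>2"
        using C(2)[OF Y m2(1)] r by auto
      also have "\<dots> = C * (Y * (real m / real Y) powr theta / (real m)\<^sup>2)" by simp
      also have "\<dots> \<le> C * (P m / m)" using unit C(1) by (intro mult_left_mono) auto
      also have "norm ((1 + ?x) * twisted_sum Y r m) \<le> (1 + Re ?x) * (K * P m) + k * k * C1 * (P m / m)"
      proof -
        have R: "1 + Re ?x \<ge> 0" using xh abs_Re_le_cmod[of ?x] by linarith
        have "norm ((1 + ?x) * twisted_sum Y r m) \<le> (1 + Re ?x + (cmod ?x)\<^sup>2) * norm (twisted_sum Y r m)"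
          unfolding norm_mult by (rule mult_right_mono[OF norm_one_plus_le[OF xh]]) simp
        also have "\<dots> = (1 + Re ?x) * norm (twisted_sum Y r m) + (cmod ?x)\<^sup>2 * norm (twisted_sum Y r m)"
          by (simp add: distrib_right)
        also have "\<dots> \<le> (1 + Re ?x) * (K * P m) + (k / m)\<^sup>2 * (C1 * (real m / real Y) powr theta)"
          using R IH xk order_trans[OF norm_twisted_sum_le C1(2)[OF Y mk(4)]]
          by (intro add_mono mult_mono power_mono) auto
        also have "(k / m)\<^sup>2 * (C1 * (real m / real Y) powr theta) =
           k * k * C1 * (1 * (real m / real Y) powr theta / (real m)\<^sup>2)"
          by (simp add: power2_eq_square)
        also have "\<dots> \<le> k * k * C1 * (Y * (real m / real Y) powr theta / (real m)\<^sup>2)"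
          using Y C1 by (intro mult_left_mono divide_right_mono mult_right_mono) auto
        also have "\<dots> \<le> k * k * C1 * (P m / m)" using C1 by (intro mult_left_mono[OF unit]) auto
        finally show ?thesis by simp
      qed
      also have "C * (P m / m) + ((1 + Re ?x) * (K * P m) + k * k * C1 * (P m / m))
         = (1 + Re ?x) * (K * P m) + C4 * (P m / m)" by (simp add: C4_def algebra_simps)
      also have "\<dots> \<le> (1 + k * (theta - 2 * c) / m) * (K * P m) + C4 * (P m / m)"
      proof -
        have "Re ?x = k * Re (char_coeff r) / m" by simp
        also have "\<dots> \<le> k * (theta - 2 * c) / m"
          using c(3)[OF r] by (intro divide_right_mono mult_left_mono) auto
        finally show ?thesis using K by (intro add_right_mono mult_right_mono) (auto simp: P_def)
      qed
      also have "\<dots> = (K * P m) * (1 + k * (theta - 2 * c) / m + C4 / (K * m))"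
        using K mk by (simp add: field_simps)
      \<comment> \<open>The exponent \<open>theta - c\<close> in place of
        \<open>theta - 2 * c\<close> gains \<open>c * k / m\<close>: half is spent on
        \<open>C4 / (K * m)\<close>, half on the square term.\<close>
      also have "\<dots> \<le> (K * P m) * (1 + (theta - c) * (k / m - (k / m)\<^sup>2))"
      proof (rule mult_left_mono)
        have "2 * C4 / (c * k) \<le> K" using C1 by (simp add: K_def)
        then have "C4 / K \<le> c * k / 2" using K c k_pos by (simp add: field_simps)
        then have 1: "C4 / (K * m) \<le> (c * k / 2) / m"
          using divide_right_mono[of "C4 / K" "c * k / 2" "real m"] by simp
        have "k / m \<le> c / 2" using mk c k_pos by (simp add: field_simps)
        then have "(k / m)\<^sup>2 \<le> c / 2 * (k / m)" unfolding power2_eq_square by (intro mult_right_mono) auto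
        moreover have "(theta - c) * (k / m)\<^sup>2 \<le> 1 * (k / m)\<^sup>2" using c1 by (intro mult_right_mono) auto
        ultimately have 2: "(theta - c) * (k / m)\<^sup>2 \<le> c / 2 * (k / m)" by linarith
        have "k * (theta - 2 * c) / m + c * k / 2 / m = (theta - c) * (k / m) - c / 2 * (k / m)"
          using mk by (simp add: field_simps)
        then show "1 + k * (theta - 2 * c) / m + C4 / (K * m) \<le> 1 + (theta - c) * (k / m - (k / m)\<^sup>2)"
          using 1 2 by (simp add: right_diff_distrib)
      qed (use K in \<open>auto simp: P_def\<close>)
      also have "\<dots> \<le> (K * P m) * (1 + k / m) powr (theta - c)"
        using mk c1 K by (intro mult_left_mono powr_one_plus_ge) (auto simp: P_def)
      also have "\<dots> = K * P n"
      proof -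
        have "real n = real m * (1 + k / m)" using m mk by (simp add: distrib_left)
        then have "real n / real Y = (real m / real Y) * (1 + k / m)" by simp
        then have "P n = P m * (1 + k / m) powr (theta - c)" unfolding P_def by (simp only: powr_mult)
        then show ?thesis by simp
      qed
      finally have "norm (twisted_sum Y r n) \<le> K * P n" by this simp_all
      then show ?thesis unfolding P_def .
    qed
  qed
  then show ?thesis using c K by blast
qed

text \<open>Only the trivial character, whose coefficient is \<open>theta\<close>, keeps the full
  order of growth. As \<open>c \<le> 1\<close>, the error of \<open>rough_coeff_near\<close> is
  absorbed too.\<close>

lemma rough_coeff_near_rough_sum:
  "\<exists>c>0. \<exists>K>0. 2 * c \<le> theta \<and> (\<forall>Y\<ge>1. \<forall>n\<ge>2*Y.
     \<bar>rough_coeff Y n - theta * rough_sum Y n / n\<bar> \<le> K * (real n / real Y) powr (theta - c) / n)"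
proof -
  obtain c K where c: "c > 0" "K > 0" "2 * c \<le> theta"
    and XK: "\<And>Y n r. Y \<ge> 1 \<Longrightarrow> n \<ge> 2 * Y \<Longrightarrow> r \<in> {0<..<k} \<Longrightarrow> norm (twisted_sum Y r n) \<le> K * (real n / real Y) powr (theta - c)"
    using twisted_sum_small by blast
  obtain C where C: "C > 0" "\<And>Y n i. Y \<ge> 1 \<Longrightarrow> n \<ge> 2 * Y \<Longrightarrow> i \<le> k \<Longrightarrow>
    norm (of_real (rough_coeff Y (n + i)) - (\<Sum>s<k. char_coeff s * root_char k (int (s * (n + i))) * twisted_sum Y s n) / of_nat n)
       \<le> C * Y * (real n / real Y) powr theta / (real n)\<^sup>2"
    using rough_coeff_near by blast
  have "\<bar>rough_coeff Y n - theta * rough_sum Y n / n\<bar> \<le> (C + k * K) * (real n / real Y) powr (theta - c) / n"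
    if Y: "Y \<ge> 1" "n \<ge> 2 * Y" for Y n
  proof -
    define P where "P = (real n / real Y) powr (theta - c)"
    have n: "n \<ge> 1" using Y by simp
    have ratio: "real n / real Y \<ge> 1" using Y by (simp add: pos_le_divide_eq)
    let ?c = "\<lambda>s. char_coeff s * root_char k (int (s * n))"
    define R where "R = (\<Sum>s\<in>{0<..<k}. ?c s * twisted_sum Y s n)"
    have "{..<k} = insert 0 {0<..<k}" using k_pos by auto
    then have S: "(\<Sum>s<k. ?c s * twisted_sum Y s n) = of_real (theta * rough_sum Y n) + R"
      by (simp add: R_def char_coeff_0 twisted_sum_0)
    have R: "norm R \<le> k * K * P"
    proof -
      have "norm R \<le> (\<Sum>s\<in>{0<..<k}. 1 * (K * P))" unfolding R_def
      proof (rule sum_norm_le)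
        fix s assume s: "s \<in> {0<..<k}"
        have "norm (?c s) \<le> 1" using norm_char_coeff_le[of s] by (simp add: norm_mult)
        then show "norm (?c s * twisted_sum Y s n) \<le> 1 * (K * P)"
          unfolding norm_mult[of "?c s"] P_def by (intro mult_mono XK[OF Y s]) auto
      qed
      also have "\<dots> = real (k - 1) * (K * P)" by simp
      also have "\<dots> \<le> k * (K * P)" using c by (intro mult_right_mono) (auto simp: P_def)
      finally show ?thesis by simp
    qed
    have psi: "(real n / real Y) powr theta \<le> P * (real n / real Y)"
    proof -
      have "(real n / real Y) powr theta = P * (real n / real Y) powr c"
        by (simp add: P_def powr_add[symmetric])
      also have "\<dots> \<le> P * (real n / real Y) powr 1"
        using c theta_le_1 ratio by (intro mult_left_mono powr_mono) (auto simp: P_def)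
      finally show ?thesis using ratio by simp
    qed
    have eq: "complex_of_real (rough_coeff Y n - theta * rough_sum Y n / n) =
       (of_real (rough_coeff Y n) - (\<Sum>s<k. ?c s * twisted_sum Y s n) / of_nat n) + R / of_nat n"
      unfolding S by (simp add: add_divide_distrib)
    have "\<bar>rough_coeff Y n - theta * rough_sum Y n / n\<bar> = norm (complex_of_real (rough_coeff Y n - theta * rough_sum Y n / n))"
      by (simp only: norm_of_real)
    also have "\<dots> \<le> norm (of_real (rough_coeff Y n) - (\<Sum>s<k. ?c s * twisted_sum Y s n) / of_nat n) + norm (R / of_nat n)"
      unfolding eq by (rule norm_triangle_ineq)
    also have "\<dots> \<le> C * Y * (real n / real Y) powr theta / (real n)\<^sup>2 + k * K * P / n"
    proof (rule add_mono)
      show "norm (of_real (rough_coeff Y n) - (\<Sum>s<k. ?c s * twisted_sum Y s n) / of_nat n) \<le> C * Y * (real n / real Y) powr theta / (real n)\<^sup>2"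
        using C(2)[OF Y, of 0] by simp
      show "norm (R / of_nat n) \<le> k * K * P / n"
        unfolding norm_divide using divide_right_mono[OF R, of n] by simp
    qed
    also have "C * Y * (real n / real Y) powr theta / (real n)\<^sup>2 \<le> C * Y * (P * (real n / real Y)) / (real n)\<^sup>2"
      using psi C by (intro divide_right_mono mult_left_mono) auto
    also have "\<dots> = C * P / n" using Y n by (simp add: power2_eq_square)
    finally show ?thesis by (simp add: P_def algebra_simps add_divide_distrib)
  qed
  moreover have "C + k * K > 0" using C c by (simp add: add_pos_nonneg)
  ultimately show ?thesis using c by blast
qed

end

text \<open>The increments are dominated by those of a null sequence that telescopes; this gives the
  Cauchy property and the rate together.\<close>

lemma convergent_with_rate:
  fixes Q :: "nat \<Rightarrow> real"
  assumes "c > 0" "D \<ge> 0" "N \<ge> 1"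
    and step: "\<And>n. n \<ge> N \<Longrightarrow> \<bar>Q (Suc n) - Q n\<bar> \<le> D * (real n powr (-c) - real (Suc n) powr (-c))"
  shows "\<exists>L. \<forall>n\<ge>N. \<bar>Q n - L\<bar> \<le> D * real n powr (-c)"
proof -
  have diff: "\<bar>Q m - Q n\<bar> \<le> D * real n powr (-c)" if "N \<le> n" "n \<le> m" for n m
  proof -
    have "\<bar>Q m - Q n\<bar> \<le> D * (real n powr (-c) - real m powr (-c))"
      using that(2)
    proof (induction m rule: dec_induct)
      case (step m)
      have "\<bar>Q (Suc m) - Q m\<bar> \<le> D * (real m powr (-c) - real (Suc m) powr (-c))"
        by (rule assms(4)) (use step that in auto)
      then show ?case using step.IH by (simp add: algebra_simps)
    qed simp
    also have "\<dots> \<le> D * real n powr (-c)" using assms(2) by (intro mult_left_mono) auto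
    finally show ?thesis .
  qed
  have lim0: "(\<lambda>n. D * real n powr (-c)) \<longlonglongrightarrow> 0"
    using assms(1) by real_asymp
  have "Cauchy Q"
  proof (rule metric_CauchyI)
    fix e :: real assume e: "e > 0"
    have "eventually (\<lambda>n. D * real n powr (-c) < e / 2) sequentially"
      using lim0 e by (intro order_tendstoD(2)) auto
    then obtain M where M: "\<And>n. n \<ge> M \<Longrightarrow> D * real n powr (-c) < e / 2"
      unfolding eventually_sequentially by blast
    define n0 where "n0 = max M N"
    have "dist (Q m) (Q n) < e" if "m \<ge> n0" "n \<ge> n0" for m n
    proof -
      have "\<bar>Q m - Q n0\<bar> < e / 2" "\<bar>Q n - Q n0\<bar> < e / 2"
        using diff[of n0 m] diff[of n0 n] M[of n0] that by (auto simp: n0_def)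
      then show ?thesis unfolding dist_real_def by linarith
    qed
    then show "\<exists>M. \<forall>m\<ge>M. \<forall>n\<ge>M. dist (Q m) (Q n) < e" by blast
  qed
  then obtain L where L: "Q \<longlonglongrightarrow> L" using real_Cauchy_convergent convergent_def by blast
  have "\<bar>Q n - L\<bar> \<le> D * real n powr (-c)" if "n \<ge> N" for n
  proof (rule Lim_bounded)
    show "(\<lambda>m. \<bar>Q n - Q m\<bar>) \<longlonglongrightarrow> \<bar>Q n - L\<bar>" using L by (intro tendsto_intros)
    show "\<forall>m\<ge>n. \<bar>Q n - Q m\<bar> \<le> D * real n powr (-c)"
      using diff[OF that] by (simp add: abs_minus_commute)
  qed
  then show ?thesis by blast
qed

text \<open>Brings an error of order n^(-c-1) into the telescoping form that
  \<open>convergent_with_rate\<close> asks for.\<close>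

lemma powr_neg_diff_ge:
  fixes c :: real
  assumes "0 < c" "c \<le> 1" "n \<ge> 2"
  shows "real n powr (-c) - real (Suc n) powr (-c) \<ge> c / 4 * (real n powr (-c) / n)"
proof -
  define x where "x = 1 / real n"
  have x: "0 < x" "x \<le> 1 / 2" using assms by (auto simp: x_def field_simps)
  have "c * (x / 2) \<le> c * (x - x\<^sup>2)" using assms x
    by (intro mult_left_mono) (auto simp: power2_eq_square field_simps)
  moreover have "(1 + x) powr c \<ge> 1 + c * (x - x\<^sup>2)" by (rule powr_one_plus_ge) (use x assms in auto)
  ultimately have 1: "(1 + x) powr c \<ge> 1 + c * x / 2" by linarith
  define z where "z = c * x / 2"
  have z: "0 < z" "z \<le> 1" using assms x mult_le_one[of c x] by (auto simp: z_def)
  have "inverse ((1 + x) powr c) \<le> inverse (1 + z)" using 1 z unfolding z_def by (intro le_imp_inverse_le) auto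
  also have "\<dots> \<le> 1 - z / 2" using z
    by (simp add: field_simps)
  finally have "(1 + x) powr (-c) \<le> 1 - c / 4 * x" by (simp add: powr_minus z_def)
  then have "real n powr (-c) * (1 + x) powr (-c) \<le> real n powr (-c) * (1 - c / 4 * x)"
    by (rule mult_left_mono) simp
  moreover have "real (Suc n) = real n * (1 + x)" using assms by (simp add: x_def field_simps)
  then have "real (Suc n) powr (-c) = real n powr (-c) * (1 + x) powr (-c)"
    using x by (simp add: powr_mult)
  ultimately show ?thesis by (simp add: x_def algebra_simps)
qed

text \<open>Markov's inequality: by the recursion, the sum of \<open>m * w m\<close> is at most
  \<open>N\<close> times the total mass, so at most the fraction \<open>N / t\<close> of the mass
  lies at indices from \<open>t\<close> on.\<close>

lemma exp_fps_markov:
  fixes a :: "nat \<Rightarrow> real"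
  assumes a: "\<And>j. 0 \<le> a j" "\<And>j. a j \<le> 1" "\<And>j. j > N \<Longrightarrow> a j = 0" and t: "t \<ge> (1::nat)"
  shows "(\<Sum>m<t. fps_nth (exp_fps a) m) \<ge> (1 - N / t) * exp (\<Sum>j=1..N. a j / j)"
proof -
  define w where "w = fps_nth (exp_fps a)"
  define S where "S = exp (\<Sum>j=1..N. a j / j)"
  have w0: "w m \<ge> 0" for m unfolding w_def by (rule exp_fps_nonneg) (use a in auto)
  have w: "w sums S" unfolding w_def S_def by (rule exp_fps_sums) (use a in auto)
  have part: "(\<Sum>m\<in>A. w m) \<le> S" if "finite A" for A
    using sum_le_suminf[of w A] w w0 that by (simp add: sums_iff)
  have mom: "(\<Sum>m\<le>M. m * w m) \<le> N * S" for M
  proof -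
    have "(\<Sum>m\<le>M. m * w m) = (\<Sum>m\<le>M. \<Sum>j=1..m. a j * w (m - j))"
      unfolding w_def exp_fps_rec ..
    also have "\<dots> \<le> (\<Sum>m\<le>M. \<Sum>j=1..N. if j \<le> m then w (m - j) else 0)"
    proof (rule sum_mono)
      fix m
      have "(\<Sum>j=1..m. a j * w (m - j)) = (\<Sum>j\<in>{1..m} \<inter> {1..N}. a j * w (m - j))"
        by (rule sum.mono_neutral_right) (use a in auto)
      also have "\<dots> \<le> (\<Sum>j\<in>{1..m} \<inter> {1..N}. w (m - j))"
        using a w0 by (intro sum_mono) (simp add: mult_left_le_one_le)
      also have "\<dots> = (\<Sum>j=1..N. if j \<le> m then w (m - j) else 0)"
        by (rule sum.mono_neutral_cong_left) auto
      finally show "(\<Sum>j=1..m. a j * w (m - j)) \<le> (\<Sum>j=1..N. if j \<le> m then w (m - j) else 0)" .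
    qed
    also have "\<dots> = (\<Sum>j=1..N. \<Sum>m\<le>M. if j \<le> m then w (m - j) else 0)" by (rule sum.swap)
    also have "\<dots> \<le> (\<Sum>j=1..N. S)"
    proof (rule sum_mono)
      fix j
      have "(\<Sum>m\<le>M. if j \<le> m then w (m - j) else 0) = (\<Sum>m\<in>{j..M}. w (m - j))"
        by (rule sum.mono_neutral_cong_right) auto
      also have "\<dots> = (\<Sum>i\<in>(\<lambda>m. m - j) ` {j..M}. w i)"
        by (subst sum.reindex) (auto simp: inj_on_def)
      also have "\<dots> \<le> S" by (rule part) simp
      finally show "(\<Sum>m\<le>M. if j \<le> m then w (m - j) else 0) \<le> S" .
    qed
    finally show ?thesis by simp
  qed
  have "(\<Sum>m\<le>M. w m) \<le> (\<Sum>m<t. w m) + N / t * S" for M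
  proof -
    have "(\<Sum>m\<le>M. w m) \<le> (\<Sum>m\<in>{..<t} \<union> {t..M}. w m)"
      by (rule sum_mono2) (use w0 in auto)
    also have "\<dots> = (\<Sum>m<t. w m) + (\<Sum>m\<in>{t..M}. w m)" by (rule sum.union_disjoint) auto
    also have "(\<Sum>m\<in>{t..M}. w m) \<le> (\<Sum>m\<in>{t..M}. m * w m / t)"
    proof (rule sum_mono)
      fix m assume m: "m \<in> {t..M}"
      then have "t * w m \<le> m * w m" using w0 by (intro mult_right_mono) auto
      then show "w m \<le> m * w m / t" using t by (simp add: field_simps)
    qed
    also have "\<dots> = (\<Sum>m\<in>{t..M}. m * w m) / t" by (simp add: sum_divide_distrib)
    also have "\<dots> \<le> (\<Sum>m\<le>M. m * w m) / t"
      by (intro divide_right_mono sum_mono2) (use w0 in auto)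
    also have "\<dots> \<le> N * S / t" using mom by (intro divide_right_mono) auto
    finally show ?thesis by simp
  qed
  then have "S \<le> (\<Sum>m<t. w m) + N / t * S"
    using w unfolding sums_def_le by (intro Lim_bounded[of _ _ 0]) auto
  then show ?thesis unfolding w_def S_def by (simp add: algebra_simps)
qed

section \<open>Asymptotics of the rough coefficients, uniformly in the cut-off\<close>

context coprime_lengths
begin

text \<open>A coefficient is nearly \<open>theta / n\<close> times the sum up to \<open>n\<close>,
  which is the discrete form of G' = theta G / n. So the quotient of the sum by n^theta is almost
  constant and converges, with explicit dependence on \<open>Y\<close> in the error.\<close>

lemma rough_sum_asymp:
  "\<exists>c>0. \<exists>K>0. \<exists>L. \<forall>Y\<ge>1. \<forall>n\<ge>2*Y.
     \<bar>rough_sum Y n / real n powr theta - L Y\<bar> \<le> K * (real Y powr (-theta) * (real Y / real n) powr c) \<and>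
     \<bar>rough_coeff Y n - theta * L Y * real n powr (theta - 1)\<bar>
        \<le> K * (real n powr (theta - 1) * (real Y powr (-theta) * (real Y / real n) powr c))"
proof -
  obtain c K where c: "c > 0" "K > 0" "2 * c \<le> theta"
    and gG: "\<And>Y n. Y \<ge> 1 \<Longrightarrow> n \<ge> 2 * Y \<Longrightarrow>
       \<bar>rough_coeff Y n - theta * rough_sum Y n / n\<bar> \<le> K * (real n / real Y) powr (theta - c) / n"
    using rough_coeff_near_rough_sum by blast
  obtain C1 where C1: "C1 > 0" "\<And>Y n. Y \<ge> 1 \<Longrightarrow> n \<ge> Y \<Longrightarrow> rough_sum Y n \<le> C1 * (real n / real Y) powr theta"
    using rough_bounds by blast
  have c1: "c \<le> 1" "c > 0" using c theta_le_1 by auto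
  define U where "U = (\<lambda>Y n. real Y powr (-theta) * (real Y / real n) powr c)"
  define Q where "Q = (\<lambda>Y n. rough_sum Y n / real n powr theta)"
  have P: "(real n / real Y) powr (theta - c) = real n powr theta * U Y n" if "Y \<ge> 1" "n \<ge> 1" for Y n :: nat
    using that by (simp add: U_def powr_divide powr_diff powr_minus field_simps)
  \<comment> \<open>The factor \<open>4 / c\<close> inverts the constant of
    \<open>powr_neg_diff_ge\<close>.\<close>
  define D where "D = (K + C1) * (4 / c)"
  have D: "D > 0" using c C1 by (simp add: D_def)
  have Dc: "D * (c / 4) = K + C1" using c by (simp add: D_def)
  have step: "\<bar>Q Y (Suc n) - Q Y n\<bar> \<le> (D * real Y powr (c - theta)) * (real n powr (-c) - real (Suc n) powr (-c))"
    if Y: "Y \<ge> 1" "n \<ge> 2 * Y" for Y n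
  proof -
    have n: "n \<ge> 1" "real n \<ge> 1" "n \<ge> Y" "n \<ge> 2" using Y by auto
    define A where "A = real n powr theta"
    define w where "w = (1 + 1 / real n) powr theta"
    have A: "A > 0" using n by (simp add: A_def)
    have w: "1 + theta * (1 / n - (1 / n)\<^sup>2) \<le> w" "w \<le> 1 + theta / n" "w \<ge> 1"
      using powr_one_plus_ge[of "1 / real n" theta] powr_one_plus_le[of "1 / real n" theta]
        theta_pos theta_le_1 n by (auto simp: w_def ge_one_powr_ge_zero)
    have "real (Suc n) = real n * (1 + 1 / real n)" using n by (simp add: field_simps)
    then have A': "real (Suc n) powr theta = A * w"
      unfolding A_def w_def by (simp add: powr_mult)
    have rough_sum_Suc: "rough_sum Y (Suc n) = rough_sum Y n + rough_coeff Y n" by (simp add: rough_sum_def)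
    \<comment> \<open>The first term measures how far the coefficient is from its expected value,
      the second how far (1 + 1 / n)^theta is from 1 + theta / n.\<close>
    have eq: "Q Y (Suc n) - Q Y n = (rough_coeff Y n - theta * rough_sum Y n / n) / (A * w) + rough_sum Y n / A * ((1 + theta / n - w) / w)"
      unfolding Q_def A' rough_sum_Suc A_def[symmetric] using A w(3) n by (simp add: field_simps)
    have "\<bar>(rough_coeff Y n - theta * rough_sum Y n / n) / (A * w)\<bar> \<le> (K * (A * U Y n) / n) / A"
    proof -
      have "\<bar>(rough_coeff Y n - theta * rough_sum Y n / n) / (A * w)\<bar> = \<bar>rough_coeff Y n - theta * rough_sum Y n / n\<bar> / (A * w)"
        using A w by simp
      also have "\<dots> \<le> (K * (A * U Y n) / n) / (A * w)"
        using gG[OF Y] P[OF Y(1) n(1)] A w by (intro divide_right_mono) (auto simp: A_def)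
      also have "\<dots> \<le> (K * (A * U Y n) / n) / (A * 1)"
        using A w c by (intro divide_left_mono mult_left_mono) (auto simp: U_def)
      finally show ?thesis by simp
    qed
    also have "\<dots> = K * (U Y n / n)" using A by simp
    finally have 1: "\<bar>(rough_coeff Y n - theta * rough_sum Y n / n) / (A * w)\<bar> \<le> K * (U Y n / n)" .
    have "\<bar>rough_sum Y n / A * ((1 + theta / n - w) / w)\<bar> = rough_sum Y n / A * ((1 + theta / n - w) / w)"
      using A w rough_sum_nonneg by simp
    also have "\<dots> \<le> (C1 * (real n / real Y) powr theta) / A * ((1 / n)\<^sup>2 / 1)"
    proof (intro mult_mono divide_right_mono frac_le)
      show "rough_sum Y n \<le> C1 * (real n / real Y) powr theta" by (rule C1(2)[OF Y(1) n(3)])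
      have "theta * (1 / n)\<^sup>2 \<le> 1 * (1 / n)\<^sup>2" using theta_le_1 by (intro mult_right_mono) auto
      then show "1 + theta / n - w \<le> (1 / n)\<^sup>2" using w(1) by (simp add: algebra_simps)
    qed (use A w C1 in auto)
    also have "(C1 * (real n / real Y) powr theta) / A = C1 * real Y powr (-theta)"
      using n Y by (simp add: A_def powr_divide powr_minus field_simps)
    also have "C1 * real Y powr (-theta) * ((1 / n)\<^sup>2 / 1) \<le> C1 * (U Y n / n)"
    proof -
      have "1 / real n \<le> real Y / real n" using Y by (simp add: divide_right_mono)
      also have "\<dots> = (real Y / real n) powr 1" using Y by simp
      also have "\<dots> \<le> (real Y / real n) powr c" using c1 n Y by (intro powr_mono') auto
      finally have "real Y powr (-theta) * (1 / real n) \<le> U Y n" unfolding U_def by (intro mult_left_mono) auto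
      then have "C1 * (real Y powr (-theta) * (1 / real n)) / n \<le> C1 * U Y n / n"
        using C1 by (intro divide_right_mono mult_left_mono) auto
      then show ?thesis by (simp add: power2_eq_square)
    qed
    finally have "\<bar>Q Y (Suc n) - Q Y n\<bar> \<le> K * (U Y n / n) + C1 * (U Y n / n)"
      unfolding eq using 1 by linarith
    also have "\<dots> = (K + C1) * (real Y powr (c - theta) * (real n powr (-c) / n))"
      using Y n by (simp add: U_def powr_divide powr_diff powr_minus field_simps)
    also have "\<dots> = (D * real Y powr (c - theta)) * (c / 4 * (real n powr (-c) / n))"
      unfolding Dc[symmetric] by (simp only: mult_ac)
    also have "\<dots> \<le> (D * real Y powr (c - theta)) * (real n powr (-c) - real (Suc n) powr (-c))"
      using D by (intro mult_left_mono powr_neg_diff_ge c1 n) auto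
    finally show ?thesis .
  qed
  have "\<exists>L. \<forall>n\<ge>2*Y. \<bar>Q Y n - L\<bar> \<le> D * real Y powr (c - theta) * real n powr (-c)" if "Y \<ge> 1" for Y
    by (rule convergent_with_rate[OF c(1)]) (use step[OF that] D that in auto)
  then obtain L where L: "\<And>Y n. Y \<ge> 1 \<Longrightarrow> n \<ge> 2 * Y \<Longrightarrow> \<bar>Q Y n - L Y\<bar> \<le> D * real Y powr (c - theta) * real n powr (-c)"
    by metis
  have L': "\<bar>Q Y n - L Y\<bar> \<le> D * U Y n" if "Y \<ge> 1" "n \<ge> 2 * Y" for Y n
  proof -
    have "U Y n = real Y powr (c - theta) * real n powr (-c)"
      using that by (simp add: U_def powr_divide powr_diff powr_minus field_simps)
    then show ?thesis using L[OF that] by simp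
  qed
  have "\<bar>rough_coeff Y n - theta * L Y * real n powr (theta - 1)\<bar> \<le> (K + D) * (real n powr (theta - 1) * U Y n)"
    if Y: "Y \<ge> 1" "n \<ge> 2 * Y" for Y n
  proof -
    have n: "n \<ge> 1" using Y by simp
    define A where "A = real n powr theta"
    have A: "A > 0" using n by (simp add: A_def)
    have A1: "real n powr (theta - 1) = A / n" using n by (simp add: A_def powr_diff)
    have eq: "rough_coeff Y n - theta * L Y * (A / n) = (rough_coeff Y n - theta * rough_sum Y n / n) + theta * (A / n) * (Q Y n - L Y)"
      using A by (simp add: Q_def A_def[symmetric] algebra_simps)
    have "\<bar>rough_coeff Y n - theta * L Y * (A / n)\<bar> \<le> \<bar>rough_coeff Y n - theta * rough_sum Y n / n\<bar> + \<bar>theta * (A / n) * (Q Y n - L Y)\<bar>"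
      unfolding eq by (rule abs_triangle_ineq)
    also have "\<bar>rough_coeff Y n - theta * rough_sum Y n / n\<bar> \<le> K * (A * U Y n) / n"
      using gG[OF Y] P[OF Y(1) n] by (simp add: A_def)
    also have "\<bar>theta * (A / n) * (Q Y n - L Y)\<bar> = theta * (A / n) * \<bar>Q Y n - L Y\<bar>"
      using A theta_pos by (simp add: abs_mult)
    also have "\<dots> \<le> 1 * (A / n) * (D * U Y n)"
      using L'[OF Y] A theta_le_1 theta_pos by (intro mult_mono) auto
    finally show ?thesis unfolding A1 by (simp add: algebra_simps add_divide_distrib)
  qed
  moreover have "\<bar>Q Y n - L Y\<bar> \<le> (K + D) * U Y n" if "Y \<ge> 1" "n \<ge> 2 * Y" for Y n
  proof -
    have "D * U Y n \<le> (K + D) * U Y n" using c by (intro mult_right_mono) (auto simp: U_def)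
    then show ?thesis using L'[OF that] by linarith
  qed
  moreover have "K + D > 0" using c D by simp
  ultimately show ?thesis using c(1) unfolding Q_def U_def by blast
qed

section \<open>Identification of the limit by splitting the lengths at the cut-off\<close>

definition smooth_coeff :: "nat \<Rightarrow> nat \<Rightarrow> real" where
  "smooth_coeff Y = fps_nth (exp_fps (\<lambda>j. if j < Y then chi j else 0))"

lemma smooth_coeff_nonneg: "0 \<le> smooth_coeff Y n"
  unfolding smooth_coeff_def by (rule exp_fps_nonneg) simp

lemma smooth_coeff_sums: "Y \<ge> 1 \<Longrightarrow> smooth_coeff Y sums exp (coprime_harm (Y - 1))"
proof -
  assume Y: "Y \<ge> 1"
  have "smooth_coeff Y sums exp (\<Sum>j=1..Y-1. (if j < Y then chi j else 0) / of_nat j)"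
    unfolding smooth_coeff_def by (rule exp_fps_sums) (use Y in auto)
  also have "(\<Sum>j=1..Y-1. (if j < Y then chi j else 0) / of_nat j) = coprime_harm (Y - 1)"
    unfolding coprime_harm_def by (rule sum.cong) (use Y in auto)
  finally show ?thesis .
qed

lemma rough_coeff_1_eq: "rough_coeff 1 n = fps_nth (exp_fps chi) n"
  unfolding rough_coeff_def by (rule exp_fps_cong) simp

lemma rough_coeff_1_convolution: "rough_coeff 1 n = (\<Sum>m\<le>n. smooth_coeff Y m * rough_coeff Y (n - m))"
proof -
  have "chi = (\<lambda>j. (if j < Y then chi j else 0) + (if Y \<le> j then chi j else 0))" by auto
  then have "exp_fps chi = exp_fps (\<lambda>j. if j < Y then chi j else 0) * exp_fps (\<lambda>j. if Y \<le> j then chi j else 0)"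
    by (subst exp_fps_add[symmetric]) simp
  then show ?thesis unfolding rough_coeff_1_eq by (simp add: fps_mult_nth smooth_coeff_def rough_coeff_def atLeast0AtMost)
qed

lemma rough_sum_1_convolution: "rough_sum 1 n = (\<Sum>m<n. smooth_coeff Y m * rough_sum Y (n - m))"
proof (induction n)
  case (Suc n)
  have "(\<Sum>m<Suc n. smooth_coeff Y m * rough_sum Y (Suc n - m)) = (\<Sum>m\<le>n. smooth_coeff Y m * (rough_sum Y (n - m) + rough_coeff Y (n - m)))"
    by (rule sum.cong) (auto simp: rough_sum_def Suc_diff_le)
  also have "\<dots> = (\<Sum>m\<le>n. smooth_coeff Y m * rough_sum Y (n - m)) + rough_coeff 1 n"
    unfolding rough_coeff_1_convolution[of n Y] by (simp add: distrib_left sum.distrib)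
  also have "(\<Sum>m\<le>n. smooth_coeff Y m * rough_sum Y (n - m)) = (\<Sum>m<n. smooth_coeff Y m * rough_sum Y (n - m))"
    by (simp add: lessThan_Suc_atMost[symmetric] rough_sum_def)
  finally show ?case using Suc by (simp add: rough_sum_def)
qed (simp add: rough_sum_def)

text \<open>Divide \<open>rough_sum_1_convolution\<close> by n^theta and pass to the limit term by
  term; the short lengths contribute their total mass. This ties the limit for every
  \<open>Y\<close> to the one for \<open>Y = 1\<close>.\<close>

lemma rough_sum_limit_convolution:
  assumes Y: "Y \<ge> 1" and L: "(\<lambda>n. rough_sum Y n / real n powr theta) \<longlonglongrightarrow> L"
  shows "(\<lambda>n. rough_sum 1 n / real n powr theta) \<longlonglongrightarrow> exp (coprime_harm (Y - 1)) * L"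
proof -
  obtain C1 where C1: "C1 > 0" "\<And>Y n. Y \<ge> 1 \<Longrightarrow> n \<ge> Y \<Longrightarrow> rough_sum Y n \<le> C1 * (real n / real Y) powr theta"
    using rough_bounds by blast
  define a where "a = (\<lambda>m n. if m < n then smooth_coeff Y m * (rough_sum Y (n - m) / real n powr theta) else 0)"
  \<comment> \<open>A bound is wanted for all \<open>N \<le> n\<close>, also below \<open>Y\<close>,
    where the upper bound does not apply. By monotonicity the argument may be raised to
    \<open>n * Y\<close>.\<close>
  have Gb: "rough_sum Y N / real n powr theta \<le> C1 * real Y powr theta" if N: "1 \<le> n" "N \<le> n" for N n
  proof -
    have "rough_sum Y N \<le> rough_sum Y (n * Y)" by (rule rough_sum_mono) (use N Y in \<open>metis mult.right_neutral mult_le_mono\<close>)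
    also have "\<dots> \<le> C1 * (real (n * Y) / real Y) powr theta" by (rule C1(2)) (use N Y in auto)
    also have "\<dots> = C1 * real n powr theta" using Y by simp
    also have "\<dots> \<le> C1 * real Y powr theta * real n powr theta"
    proof -
      have "1 \<le> real Y powr theta" using Y theta_pos by (simp add: ge_one_powr_ge_zero)
      then show ?thesis using C1 by (intro mult_right_mono) auto
    qed
    finally show ?thesis using N by (simp add: pos_divide_le_eq)
  qed
  have "((\<lambda>n. \<Sum>m. a m n) \<longlonglongrightarrow> (\<Sum>m. smooth_coeff Y m * L))"
  proof (rule tannerys_theorem[THEN conjunct2, THEN conjunct2])
    fix m
    have "(\<lambda>n. smooth_coeff Y m * ((rough_sum Y n / real n powr theta) * (real n / real (n + m)) powr theta)) \<longlonglongrightarrow> smooth_coeff Y m * (L * 1)"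
    proof (intro tendsto_intros L)
      have "(\<lambda>n. (real n / (real n + real m)) powr theta) \<longlonglongrightarrow> 1" using theta_pos by real_asymp
      then show "(\<lambda>n. (real n / real (n + m)) powr theta) \<longlonglongrightarrow> 1" by simp
    qed
    moreover have "eventually (\<lambda>n. smooth_coeff Y m * ((rough_sum Y n / real n powr theta) * (real n / real (n + m)) powr theta) = a m (n + m)) sequentially"
      using eventually_gt_at_top[of 0]
      by eventually_elim (simp add: a_def powr_divide)
    ultimately have "(\<lambda>n. a m (n + m)) \<longlonglongrightarrow> smooth_coeff Y m * (L * 1)"
      by (rule Lim_transform_eventually)
    then show "(\<lambda>n. a m n) \<longlonglongrightarrow> smooth_coeff Y m * L" using LIMSEQ_offset by simp
  next
    have "norm (a m n) \<le> smooth_coeff Y m * (C1 * real Y powr theta)" for m n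
    proof (cases "m < n")
      case True
      then have "norm (a m n) = smooth_coeff Y m * (rough_sum Y (n - m) / real n powr theta)"
        using smooth_coeff_nonneg rough_sum_nonneg by (simp add: a_def abs_mult)
      also have "\<dots> \<le> smooth_coeff Y m * (C1 * real Y powr theta)"
        by (intro mult_left_mono Gb) (use True smooth_coeff_nonneg in auto)
      finally show ?thesis .
    qed (use smooth_coeff_nonneg C1 in \<open>simp add: a_def\<close>)
    then show "eventually (\<lambda>(m, n). norm (a m n) \<le> smooth_coeff Y m * (C1 * real Y powr theta)) (at_top \<times>\<^sub>F sequentially)"
      by (intro always_eventually) auto
    show "summable (\<lambda>m. smooth_coeff Y m * (C1 * real Y powr theta))"
      using smooth_coeff_sums[OF Y] by (intro summable_mult2) (simp add: sums_iff)
  qed simp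
  moreover have "(\<Sum>m. a m n) = rough_sum 1 n / real n powr theta" for n
  proof -
    have "(\<Sum>m. a m n) = (\<Sum>m<n. a m n)" by (rule suminf_finite) (auto simp: a_def)
    then show ?thesis unfolding rough_sum_1_convolution[of n Y] by (simp add: a_def sum_divide_distrib)
  qed
  moreover have "(\<Sum>m. smooth_coeff Y m * L) = exp (coprime_harm (Y - 1)) * L"
    using smooth_coeff_sums[OF Y] by (simp add: suminf_mult2[symmetric] sums_iff)
  ultimately show ?thesis by simp
qed

text \<open>Markov's inequality for lengths up to \<open>n\<close> and threshold
  \<open>2 * n\<close> retains half of the mass. This makes the limit at \<open>Y = 1\<close>
  positive.\<close>

lemma rough_sum_1_lower: "\<exists>B>0. \<forall>n\<ge>1. rough_sum 1 (2 * n) \<ge> B * real (2 * n) powr theta"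
proof -
  obtain B where B: "B > 0" "\<And>n. n \<ge> 1 \<Longrightarrow> exp (coprime_harm n) \<ge> real n powr theta / B" using exp_coprime_harm_bounds by blast
  have "rough_sum 1 (2 * n) \<ge> (1 / (4 * B)) * real (2 * n) powr theta" if n: "n \<ge> 1" for n
  proof -
    define a where "a = (\<lambda>j. if j < Suc n then chi j else 0)"
    have "real (2 * n) powr theta = 2 powr theta * real n powr theta" by (simp add: powr_mult)
    also have "\<dots> \<le> 2 powr 1 * real n powr theta" using theta_le_1 by (intro mult_right_mono powr_mono) auto
    finally have "(1 / (4 * B)) * real (2 * n) powr theta \<le> 1 / 2 * (real n powr theta / B)"
      using B(1) by (simp add: field_simps)
    also have "\<dots> \<le> 1 / 2 * exp (coprime_harm n)" using B(2)[OF n] by simp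
    also have "\<dots> = (1 - real n / real (2 * n)) * exp (\<Sum>j=1..n. a j / j)"
      using n by (simp add: coprime_harm_def a_def)
    also have "\<dots> \<le> (\<Sum>m<2*n. fps_nth (exp_fps a) m)"
      by (rule exp_fps_markov) (use n in \<open>auto simp: a_def\<close>)
    also have "\<dots> \<le> rough_sum 1 (2 * n)" unfolding rough_sum_def rough_coeff_1_eq
      by (intro sum_mono exp_fps_mono) (auto simp: a_def)
    finally show ?thesis .
  qed
  then show ?thesis using B(1) by (intro exI[of _ "1 / (4 * B)"]) auto
qed

text \<open>The witness for \<open>\<kappa>\<close> is \<open>theta * L 1\<close>. The factor
  \<open>exp (coprime_harm (Y - 1))\<close>, of order at most Y^theta, cancels both the dependence
  of \<open>L Y\<close> on \<open>Y\<close> and the Y^(-theta) in the error.\<close>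

lemma rough_coeff_regularity:
  "\<exists>\<kappa>>0. \<exists>c>0. \<exists>C>0. (\<forall>n\<ge>1. rough_coeff 1 n \<le> C * real n powr (theta - 1)) \<and>
     (\<forall>Y\<ge>1. \<forall>n\<ge>2*Y. \<bar>exp (coprime_harm (Y - 1)) * rough_coeff Y n - \<kappa> * real n powr (theta - 1)\<bar>
         \<le> C * real n powr (theta - 1) * (real Y / real n) powr c)"
proof -
  obtain c K L where c: "c > 0" "K > 0"
    and GL: "\<And>Y n. Y \<ge> 1 \<Longrightarrow> n \<ge> 2 * Y \<Longrightarrow>
      \<bar>rough_sum Y n / real n powr theta - L Y\<bar> \<le> K * (real Y powr (-theta) * (real Y / real n) powr c)"
    and gL: "\<And>Y n. Y \<ge> 1 \<Longrightarrow> n \<ge> 2 * Y \<Longrightarrow> \<bar>rough_coeff Y n - theta * L Y * real n powr (theta - 1)\<bar>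
        \<le> K * (real n powr (theta - 1) * (real Y powr (-theta) * (real Y / real n) powr c))"
    using rough_sum_asymp by metis
  obtain C1 where C1: "C1 > 0" "\<And>Y n. Y \<ge> 1 \<Longrightarrow> n \<ge> Y \<Longrightarrow> rough_coeff Y n \<le> C1 * (real n / real Y) powr theta / n"
    using rough_bounds by blast
  obtain B where B: "B > 0" "\<And>Y. Y \<ge> 1 \<Longrightarrow> exp (coprime_harm (Y - 1)) \<le> B * real Y powr theta" using exp_coprime_harm_bounds by blast
  have lim: "(\<lambda>n. rough_sum Y n / real n powr theta) \<longlonglongrightarrow> L Y" if Y: "Y \<ge> 1" for Y
  proof -
    have "(\<lambda>n. K * (real Y powr (-theta) * (real Y / real n) powr c)) \<longlonglongrightarrow> 0"
      using c Y by real_asymp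
    moreover have "eventually (\<lambda>n. norm (rough_sum Y n / real n powr theta - L Y) \<le> K * (real Y powr (-theta) * (real Y / real n) powr c)) sequentially"
      using eventually_ge_at_top[of "2 * Y"] by eventually_elim (use GL[OF Y] in auto)
    ultimately have "(\<lambda>n. rough_sum Y n / real n powr theta - L Y) \<longlonglongrightarrow> 0" by (rule Lim_null_comparison[rotated])
    then show ?thesis by (simp add: LIM_zero_iff)
  qed
  have L1: "L 1 = exp (coprime_harm (Y - 1)) * L Y" if "Y \<ge> 1" for Y
    using LIMSEQ_unique[OF lim[of 1] rough_sum_limit_convolution[OF that lim[OF that]]] by simp
  have "L 1 > 0"
  proof -
    obtain b where b: "b > 0" "\<And>n. n \<ge> 1 \<Longrightarrow> rough_sum 1 (2 * n) \<ge> b * real (2 * n) powr theta" using rough_sum_1_lower by blast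
    have "(\<lambda>n. rough_sum 1 (2 * n) / real (2 * n) powr theta) \<longlonglongrightarrow> L 1"
      using filterlim_compose[OF lim[of 1], of "\<lambda>n. 2 * n" sequentially] by (simp add: filterlim_at_top_mult_tendsto_pos mult_nat_left_at_top)
    moreover have "\<forall>n\<ge>1. b \<le> rough_sum 1 (2 * n) / real (2 * n) powr theta"
      using b by (simp add: pos_le_divide_eq)
    ultimately have "b \<le> L 1" by (rule Lim_bounded2)
    then show ?thesis using b by simp
  qed
  define C where "C = B * K + C1"
  have "\<bar>exp (coprime_harm (Y - 1)) * rough_coeff Y n - (theta * L 1) * real n powr (theta - 1)\<bar>
         \<le> C * real n powr (theta - 1) * (real Y / real n) powr c" if Y: "Y \<ge> 1" "n \<ge> 2 * Y" for Y n
  proof -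
    have "exp (coprime_harm (Y - 1)) * rough_coeff Y n - (theta * L 1) * real n powr (theta - 1) =
       exp (coprime_harm (Y - 1)) * (rough_coeff Y n - theta * L Y * real n powr (theta - 1))"
      unfolding L1[OF Y(1)] by (simp add: algebra_simps)
    then have "\<bar>exp (coprime_harm (Y - 1)) * rough_coeff Y n - (theta * L 1) * real n powr (theta - 1)\<bar>
       = exp (coprime_harm (Y - 1)) * \<bar>rough_coeff Y n - theta * L Y * real n powr (theta - 1)\<bar>" by (simp add: abs_mult)
    also have "\<dots> \<le> (B * real Y powr theta) * (K * (real n powr (theta - 1) * (real Y powr (-theta) * (real Y / real n) powr c)))"
      by (intro mult_mono B(2) gL Y) (use B in auto)
    also have "\<dots> = B * K * real n powr (theta - 1) * (real Y / real n) powr c"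
      using Y by (simp add: powr_minus)
    also have "\<dots> \<le> C * real n powr (theta - 1) * (real Y / real n) powr c"
      using C1 by (intro mult_right_mono) (auto simp: C_def)
    finally show ?thesis .
  qed
  moreover have "rough_coeff 1 n \<le> C * real n powr (theta - 1)" if n: "n \<ge> 1" for n
  proof -
    have "rough_coeff 1 n \<le> C1 * real n powr theta / n" using C1(2)[of 1 n] n by simp
    also have "\<dots> = C1 * real n powr (theta - 1)" using n by (simp add: powr_diff)
    also have "\<dots> \<le> C * real n powr (theta - 1)" using B c by (intro mult_right_mono) (auto simp: C_def)
    finally show ?thesis .
  qed
  moreover have "C > 0" unfolding C_def using B(1) c(2) C1(1) by (intro add_pos_pos mult_pos_pos)
  moreover have "theta * L 1 > 0" using theta_pos \<open>L 1 > 0\<close> by (rule mult_pos_pos)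
  ultimately show ?thesis using c(1) by blast
qed

end

section \<open>The divergent case\<close>

text \<open>A finite form of Parseval's identity: sampling at \<open>M\<close> roots of unity is
  exact for polynomials of degree below \<open>M\<close>.\<close>

lemma parseval_roots_of_unity:
  fixes c :: "nat \<Rightarrow> complex"
  assumes "M > 0"
  shows "(\<Sum>t<M. (cmod (\<Sum>m<M. c m * root_char M (int t) ^ m))\<^sup>2) = M * (\<Sum>m<M. (cmod (c m))\<^sup>2)"
proof -
  have cnj: "cnj (root_char M s) = root_char M (- s)" for s by (simp add: root_char_def cis_cnj)
  have "complex_of_real (\<Sum>t<M. (cmod (\<Sum>m<M. c m * root_char M (int t) ^ m))\<^sup>2) =
     (\<Sum>t<M. (\<Sum>m<M. c m * root_char M (int t) ^ m) * cnj (\<Sum>m<M. c m * root_char M (int t) ^ m))"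
    by (simp only: of_real_sum complex_norm_square)
  also have "\<dots> = (\<Sum>t<M. \<Sum>m<M. \<Sum>l<M. (c m * cnj (c l)) * root_char M ((int m - int l) * (0 + int t)))"
  proof (rule sum.cong[OF refl])
    fix t
    have "root_char M (int t) ^ m * root_char M (- int t) ^ l = root_char M ((int m - int l) * (0 + int t))" for m l
      unfolding root_char_power root_char_add[symmetric] by (simp add: algebra_simps)
    then show "(\<Sum>m<M. c m * root_char M (int t) ^ m) * cnj (\<Sum>m<M. c m * root_char M (int t) ^ m) =
       (\<Sum>m<M. \<Sum>l<M. (c m * cnj (c l)) * root_char M ((int m - int l) * (0 + int t)))"
      unfolding cnj_sum complex_cnj_mult complex_cnj_power cnj sum_product
      by (intro sum.cong refl) (metis (no_types, lifting) mult.assoc mult.left_commute)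
  qed
  also have "\<dots> = (\<Sum>m<M. \<Sum>l<M. (c m * cnj (c l)) * (\<Sum>t<M. root_char M ((int m - int l) * (0 + int t))))"
    by (subst sum.swap, rule sum.cong[OF refl], subst sum.swap) (simp add: sum_distrib_left)
  also have "\<dots> = (\<Sum>m<M. \<Sum>l<M. if l = m then of_nat M * (c m * cnj (c m)) else 0)"
  proof (intro sum.cong refl)
    fix m l assume "m \<in> {..<M}" "l \<in> {..<M}"
    then have "int M dvd int m - int l \<longleftrightarrow> l = m"
      by (metis lessThan_iff mod_eq_dvd_iff mod_less of_nat_eq_iff zmod_int)
    then show "(c m * cnj (c l)) * (\<Sum>t<M. root_char M ((int m - int l) * (0 + int t)))
       = (if l = m then of_nat M * (c m * cnj (c m)) else 0)"
      unfolding sum_root_char[OF assms] by simp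
  qed
  also have "\<dots> = (\<Sum>m<M. of_nat M * (c m * cnj (c m)))" by (intro sum.cong refl) simp
  also have "\<dots> = complex_of_real (M * (\<Sum>m<M. (cmod (c m))\<^sup>2))"
    by (simp only: of_real_mult of_real_sum complex_norm_square sum_distrib_left of_real_of_nat_eq)
  finally show ?thesis by (simp only: of_real_eq_iff)
qed

lemma poly_parseval:
  fixes p :: "complex poly"
  assumes "degree p < M"
  shows "(\<Sum>t<M. (cmod (poly p (root_char M (int t))))\<^sup>2) = M * (\<Sum>m<M. (cmod (coeff p m))\<^sup>2)"
proof -
  have "poly p x = (\<Sum>m<M. coeff p m * x ^ m)" for x
    unfolding poly_altdef by (rule sum.mono_neutral_left) (use assms in \<open>auto simp: coeff_eq_0\<close>)
  then show ?thesis using parseval_roots_of_unity[of M "coeff p"] assms by simp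
qed

text \<open>With D(z) the sum of a_j z^j up to \<open>n\<close> and E the exponential, D E = z E'
  has the coefficients m E_m. On the circle E is at most \<open>S\<close>, and Parseval bounds the
  mean square of D by \<open>n\<close>. As E is not a polynomial, it is cut at \<open>L\<close>, and
  the tail vanishes as \<open>L\<close> grows.\<close>

lemma exp_fps_sum_squares_le:
  fixes a :: "nat \<Rightarrow> complex"
  assumes a: "\<And>j. 1 \<le> j \<Longrightarrow> j \<le> n \<Longrightarrow> cmod (a j) \<le> 1"
    and S: "\<And>z. cmod z = 1 \<Longrightarrow> cmod (exp (\<Sum>j=1..n. a j * z ^ j / of_nat j)) \<le> S"
  shows "(\<Sum>m\<le>n. (m * cmod (fps_nth (exp_fps a) m))\<^sup>2) \<le> n * S\<^sup>2"
proof -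
  define b where "b = (\<lambda>j. if j \<le> n then a j else 0)"
  define E where "E = fps_nth (exp_fps b)"
  have Ea: "fps_nth (exp_fps a) m = E m" if "m \<le> n" for m
    unfolding E_def by (rule exp_fps_cong) (use that in \<open>auto simp: b_def\<close>)
  have sumE: "summable (\<lambda>m. cmod (E m))" unfolding E_def by (rule exp_fps_sums(2)[of n]) (simp add: b_def)
  have E_z: "(\<lambda>m. E m * z ^ m) sums exp (\<Sum>j=1..n. a j * z ^ j / of_nat j)" for z
  proof -
    have "fps_nth (exp_fps (\<lambda>j. b j * z ^ j)) sums exp (\<Sum>j=1..n. (b j * z ^ j) / of_nat j)"
      by (rule exp_fps_sums(1)) (simp add: b_def)
    moreover have "(\<Sum>j=1..n. (b j * z ^ j) / of_nat j) = (\<Sum>j=1..n. a j * z ^ j / of_nat j)"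
      by (rule sum.cong) (auto simp: b_def)
    moreover have "fps_nth (exp_fps (\<lambda>j. b j * z ^ j)) = (\<lambda>m. E m * z ^ m)"
      by (rule ext) (simp add: exp_fps_scale E_def)
    ultimately show ?thesis by simp
  qed
  define D where "D = (\<Sum>j=1..n. monom (a j) j)"
  have D: "coeff D j = (if 1 \<le> j \<and> j \<le> n then a j else 0)" for j
    by (simp add: D_def coeff_sum)
  have degD: "degree D \<le> n" by (rule degree_le) (simp add: D)
  define tail where "tail = (\<lambda>L. \<Sum>m. cmod (E (m + L)))"
  have bound: "(\<Sum>m\<le>n. (m * cmod (E m))\<^sup>2) \<le> n * (S + tail L)\<^sup>2" if L: "L > n" for L
  proof -
    define q where "q = (\<Sum>i<L. monom (E i) i)"
    have q: "coeff q i = (if i < L then E i else 0)" for i by (simp add: q_def coeff_sum)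
    have degq: "degree q \<le> L" by (rule degree_le) (simp add: q)
    \<comment> \<open>Exceeds the degree of \<open>D * q\<close>, so that Parseval is exact for both
      \<open>D * q\<close> and \<open>D\<close>, and \<open>M\<close> cancels.\<close>
    define M where "M = n + L + 1"
    have degDq: "degree (D * q) < M"
      using order_trans[OF degree_mult_le add_mono[OF degD degq]] by (simp add: M_def)
    have qz: "cmod (poly q z) \<le> S + tail L" if z: "cmod z = 1" for z
    proof -
      have pq: "poly q z = (\<Sum>i<L. E i * z ^ i)" by (simp add: q_def poly_sum poly_monom)
      have sm: "summable (\<lambda>m. norm (E (m + L) * z ^ (m + L)))"
        using summable_ignore_initial_segment[OF sumE, of L] z by (simp add: norm_mult norm_power)
      have "exp (\<Sum>j=1..n. a j * z ^ j / of_nat j) = (\<Sum>m. E (m + L) * z ^ (m + L)) + poly q z"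
        using suminf_split_initial_segment[of "\<lambda>m. E m * z ^ m" L] E_z[of z] by (simp add: pq sums_iff)
      then have "poly q z = exp (\<Sum>j=1..n. a j * z ^ j / of_nat j) - (\<Sum>m. E (m + L) * z ^ (m + L))" by simp
      also have "cmod \<dots> \<le> cmod (exp (\<Sum>j=1..n. a j * z ^ j / of_nat j)) + cmod (\<Sum>m. E (m + L) * z ^ (m + L))"
        by (rule norm_triangle_ineq4)
      also have "cmod (\<Sum>m. E (m + L) * z ^ (m + L)) \<le> tail L"
        using summable_norm[OF sm] z by (simp add: tail_def norm_mult norm_power)
      finally show ?thesis using S[OF z] by simp
    qed
    have "M * (\<Sum>m\<le>n. (m * cmod (E m))\<^sup>2) \<le> M * (\<Sum>m<M. (cmod (coeff (D * q) m))\<^sup>2)"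
    proof (rule mult_left_mono)
      have "coeff (D * q) m = of_nat m * E m" if m: "m \<le> n" for m
      proof -
        have "coeff (D * q) m = (\<Sum>i\<le>m. coeff D i * coeff q (m - i))" by (rule coeff_mult)
        also have "\<dots> = (\<Sum>j=1..m. b j * E (m - j))"
          by (rule sum.mono_neutral_cong_right) (use m L in \<open>auto simp: D q b_def\<close>)
        also have "\<dots> = of_nat m * E m" unfolding E_def by (rule exp_fps_rec[symmetric])
        finally show ?thesis .
      qed
      then have "(\<Sum>m\<le>n. (m * cmod (E m))\<^sup>2) = (\<Sum>m\<le>n. (cmod (coeff (D * q) m))\<^sup>2)"
        by (intro sum.cong) (auto simp: norm_mult)
      also have "\<dots> \<le> (\<Sum>m<M. (cmod (coeff (D * q) m))\<^sup>2)" by (rule sum_mono2) (auto simp: M_def)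
      finally show "(\<Sum>m\<le>n. (m * cmod (E m))\<^sup>2) \<le> (\<Sum>m<M. (cmod (coeff (D * q) m))\<^sup>2)" .
    qed simp
    also have "\<dots> = (\<Sum>t<M. (cmod (poly (D * q) (root_char M (int t))))\<^sup>2)"
      by (rule poly_parseval[OF degDq, symmetric])
    also have "\<dots> \<le> (\<Sum>t<M. (cmod (poly D (root_char M (int t))))\<^sup>2 * (S + tail L)\<^sup>2)"
    proof (rule sum_mono)
      fix t
      show "(cmod (poly (D * q) (root_char M (int t))))\<^sup>2 \<le> (cmod (poly D (root_char M (int t))))\<^sup>2 * (S + tail L)\<^sup>2"
        unfolding poly_mult norm_mult power_mult_distrib
        by (intro mult_left_mono power_mono qz) auto
    qed
    also have "\<dots> = M * (\<Sum>m<M. (cmod (coeff D m))\<^sup>2) * (S + tail L)\<^sup>2"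
      unfolding sum_distrib_right[symmetric]
      by (subst poly_parseval) (use degD in \<open>auto simp: M_def\<close>)
    also have "\<dots> \<le> real M * real n * (S + tail L)\<^sup>2"
    proof (intro mult_right_mono mult_left_mono)
      have "(\<Sum>m<M. (cmod (coeff D m))\<^sup>2) = (\<Sum>m=1..n. (cmod (a m))\<^sup>2)"
        by (rule sum.mono_neutral_cong_right) (auto simp: D M_def)
      also have "\<dots> \<le> (\<Sum>m=1..n. 1)" using a by (intro sum_mono power_le_one) auto
      finally show "(\<Sum>m<M. (cmod (coeff D m))\<^sup>2) \<le> real n" by simp
    qed auto
    finally have "real M * (\<Sum>m\<le>n. (m * cmod (E m))\<^sup>2) \<le> real M * (n * (S + tail L)\<^sup>2)" by (simp only: mult.assoc)
    moreover have "real M > 0" by (simp add: M_def)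
    ultimately show ?thesis by (simp only: mult_le_cancel_left_pos)
  qed
  have "tail \<longlonglongrightarrow> 0" unfolding tail_def using suminf_exist_split2[OF sumE] .
  then have "(\<lambda>L. n * (S + tail L)\<^sup>2) \<longlonglongrightarrow> n * (S + 0)\<^sup>2" by (intro tendsto_intros)
  moreover have "\<forall>L\<ge>Suc n. (\<Sum>m\<le>n. (m * cmod (E m))\<^sup>2) \<le> n * (S + tail L)\<^sup>2" using bound by simp
  ultimately have "(\<Sum>m\<le>n. (m * cmod (E m))\<^sup>2) \<le> n * (S + 0)\<^sup>2" by (rule Lim_bounded2)
  then show ?thesis using Ea by simp
qed

text \<open>The sets where the \<open>n\<close>-th partial sum exceeds \<open>B\<close> are open,
  cover the compact circle, and increase with \<open>n\<close> on it since the terms are nonnegative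
  there; finitely many of them suffice.\<close>

lemma uniform_divergence_on_circle:
  fixes f :: "nat \<Rightarrow> complex \<Rightarrow> real"
  assumes nonneg: "\<And>j z. cmod z = 1 \<Longrightarrow> f j z \<ge> 0"
    and cont: "\<And>j. continuous_on UNIV (f j)"
    and div: "\<And>z. cmod z = 1 \<Longrightarrow> \<not> summable (\<lambda>j. f j z)"
  shows "\<exists>N. \<forall>n\<ge>N. \<forall>z. cmod z = 1 \<longrightarrow> (\<Sum>j<n. f j z) \<ge> B"
proof -
  define U where "U = (\<lambda>n. {z. (\<Sum>j<n. f j z) > B})"
  have "open (U n)" for n
    unfolding U_def by (intro open_Collect_less continuous_intros cont)
  moreover have "sphere 0 1 \<subseteq> (\<Union>n\<in>UNIV. U n)"
  proof
    fix z :: complex assume "z \<in> sphere 0 1"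
    then have z: "cmod z = 1" by simp
    show "z \<in> (\<Union>n\<in>UNIV. U n)"
    proof (rule ccontr)
      assume "z \<notin> (\<Union>n\<in>UNIV. U n)"
      then have "(\<Sum>j<n. f j z) \<le> B" for n by (auto simp: U_def not_less)
      then have "summable (\<lambda>j. f j z)" using nonneg[OF z] by (intro summableI_nonneg_bounded)
      then show False using div[OF z] by blast
    qed
  qed
  ultimately obtain C where C: "finite C" "sphere 0 1 \<subseteq> (\<Union>n\<in>C. U n)"
    using compactE_image[OF compact_sphere[of "0::complex" 1], of UNIV U] by metis
  have "(\<Sum>j<n. f j z) \<ge> B" if n: "n \<ge> Max (insert 0 C)" and z: "cmod z = 1" for n z
  proof -
    obtain m where m: "m \<in> C" "z \<in> U m" using C(2) z by auto
    have "m \<le> n" using n C(1) m(1) by (meson Max_ge finite_insert insertI2 order_trans)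
    then have "(\<Sum>j<m. f j z) \<le> (\<Sum>j<n. f j z)" using nonneg[OF z] by (intro sum_mono2) auto
    then show ?thesis using m(2) by (simp add: U_def)
  qed
  then show ?thesis by blast
qed

section \<open>From the mean square to a pointwise bound\<close>

context coprime_lengths
begin

definition wexp :: "(nat \<Rightarrow> complex) \<Rightarrow> nat \<Rightarrow> complex" where
  "wexp d = fps_nth (exp_fps (\<lambda>j. of_real (chi j) * d j))"

lemma norm_wexp_le:
  assumes "\<And>j. 1 \<le> j \<Longrightarrow> cmod (d j) \<le> 1"
  shows "cmod (wexp d n) \<le> rough_coeff 1 n"
  unfolding wexp_def rough_coeff_1_eq
  by (rule norm_exp_fps_le) (use assms in \<open>auto simp: norm_mult mult_left_le\<close>)

text \<open>By the recursion, \<open>n * cmod (wexp d n)\<close> is at most the sum of all earlier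
  norms. Indices up to \<open>n / D\<close> are compared with the case \<open>d = 1\<close>, the
  others with the mean square by Cauchy-Schwarz.\<close>

lemma wexp_tendsto_0:
  assumes d: "\<And>j. 1 \<le> j \<Longrightarrow> cmod (d j) \<le> 1"
    and div: "\<And>z. cmod z = 1 \<Longrightarrow> \<not> summable (\<lambda>j. chi j * (1 - Re (d j * z ^ j)) / j)"
    and eps: "\<epsilon> > 0"
  shows "eventually (\<lambda>n. cmod (wexp d n) \<le> \<epsilon> * real n powr (theta - 1)) sequentially"
proof -
  obtain C1 where C1: "C1 > 0" "\<And>n. n \<ge> 1 \<Longrightarrow> rough_sum 1 n \<le> C1 * real n powr theta"
    using rough_bounds by (metis div_by_1 le_refl of_nat_1)
  obtain B' where B': "B' > 0" "\<And>n. n \<ge> 1 \<Longrightarrow> exp (coprime_harm n) \<le> B' * real n powr theta"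
  proof -
    obtain B where B: "B > 0" "\<And>Y n. Y \<ge> 1 \<Longrightarrow> n \<ge> Y \<Longrightarrow> exp (\<Sum>j=Y..n. chi j / j) \<le> B * (real n / real Y) powr theta"
      using exp_coprime_harm_bounds by blast
    show thesis by (rule that[OF B(1)]) (use B(2)[of 1] in \<open>simp add: coprime_harm_def\<close>)
  qed
  \<comment> \<open>\<open>D\<close> is chosen so that the indices up to \<open>n / D\<close>
    contribute at most half of the allowed total.\<close>
  have "(\<lambda>D. C1 * (2 / real D) powr theta) \<longlonglongrightarrow> 0" using theta_pos by real_asymp
  then have "eventually (\<lambda>D. C1 * (2 / real D) powr theta < \<epsilon> / 2) sequentially"
    using eps by (intro order_tendstoD(2)) auto
  then have "eventually (\<lambda>D. C1 * (2 / real D) powr theta < \<epsilon> / 2 \<and> D \<ge> 1) sequentially"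
    using eventually_ge_at_top[of 1] by eventually_elim auto
  then obtain D :: nat where D: "C1 * (2 / real D) powr theta < \<epsilon> / 2" "D \<ge> 1"
    unfolding eventually_sequentially by blast
  \<comment> \<open>The indices above \<open>n / D\<close> will contribute \<open>D * S\<close>,
    where \<open>S = B' * real n powr theta * exp (- B)\<close>; this \<open>B\<close> makes it the
    other half.\<close>
  define B where "B = ln (2 * D * B' / \<epsilon>)"
  have B: "D * B' * exp (- B) = \<epsilon> / 2"
    using D B' eps by (simp add: B_def exp_minus)
  define f where "f = (\<lambda>j z. chi j * (1 - Re (d j * z ^ j)) / j)"
  have Re_le: "Re (d j * z ^ j) \<le> 1" if "cmod z = 1" "j \<ge> 1" for j z
  proof -
    have "Re (d j * z ^ j) \<le> cmod (d j * z ^ j)" by (rule complex_Re_le_cmod)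
    also have "\<dots> \<le> 1" using d[OF that(2)] that(1) by (simp add: norm_mult norm_power)
    finally show ?thesis .
  qed
  have "\<exists>N. \<forall>n\<ge>N. \<forall>z. cmod z = 1 \<longrightarrow> (\<Sum>j<n. f j z) \<ge> B"
  proof (rule uniform_divergence_on_circle)
    show "f j z \<ge> 0" if "cmod z = 1" for j z
      using Re_le[OF that, of j] by (cases "j = 0") (auto simp: f_def)
    show "continuous_on UNIV (f j)" for j unfolding f_def by (cases "j = 0") (auto intro!: continuous_intros)
    show "\<not> summable (\<lambda>j. f j z)" if "cmod z = 1" for z using div[OF that] by (simp add: f_def)
  qed
  then obtain N where N: "\<And>n z. n \<ge> N \<Longrightarrow> cmod z = 1 \<Longrightarrow> (\<Sum>j<n. f j z) \<ge> B" by blast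
  have main: "cmod (wexp d n) \<le> \<epsilon> * real n powr (theta - 1)" if n: "n \<ge> max N D" "n \<ge> 1" for n
  proof -
    define S where "S = B' * real n powr theta * exp (- B)"
    define a where "a = (\<lambda>j. of_real (chi j) * d j)"
    have S0: "S \<ge> 0" using B' by (simp add: S_def)
    have circle: "cmod (exp (\<Sum>j=1..n. a j * z ^ j / of_nat j)) \<le> S" if z: "cmod z = 1" for z
    proof -
      have "{..<Suc n} = insert 0 {1..n}" by auto
      then have "(\<Sum>j<Suc n. f j z) = (\<Sum>j=1..n. f j z)" by (simp add: f_def)
      then have F: "(\<Sum>j=1..n. f j z) \<ge> B" using N[of "Suc n" z] n z by simp
      have "Re (\<Sum>j=1..n. a j * z ^ j / of_nat j) = (\<Sum>j=1..n. chi j / j - f j z)"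
        unfolding Re_sum
      proof (rule sum.cong[OF refl])
        fix j
        have Re_mult: "Re (of_real x * y) = x * Re y" for x and y :: complex by simp
        have split: "x * y / real j = x / real j - x * (1 - y) / real j" for x y :: real
          by (simp add: right_diff_distrib diff_divide_distrib)
        show "Re (a j * z ^ j / of_nat j) = chi j / j - f j z"
          unfolding a_def f_def mult.assoc Re_divide_of_nat Re_mult by (rule split)
      qed
      also have "\<dots> = coprime_harm n - (\<Sum>j=1..n. f j z)" by (simp add: coprime_harm_def sum_subtractf)
      finally have "cmod (exp (\<Sum>j=1..n. a j * z ^ j / of_nat j)) = exp (coprime_harm n - (\<Sum>j=1..n. f j z))" by simp
      also have "\<dots> \<le> exp (coprime_harm n - B)" using F by simp
      also have "\<dots> = exp (coprime_harm n) * exp (- B)" by (simp add: exp_diff exp_minus divide_inverse)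
      also have "\<dots> \<le> S" unfolding S_def using B'(2)[OF n(2)] by (intro mult_right_mono) auto
      finally show ?thesis .
    qed
    have sq: "(\<Sum>m\<le>n. (m * cmod (wexp d m))\<^sup>2) \<le> n * S\<^sup>2"
      unfolding wexp_def a_def[symmetric]
      by (rule exp_fps_sum_squares_le[OF _ circle]) (use d in \<open>auto simp: a_def norm_mult mult_le_one\<close>)
    define I where "I = {Suc (n div D)..<n}"
    \<comment> \<open>Cauchy-Schwarz; the weight \<open>m\<close> of the mean square is inserted
      through \<open>1 \<le> D * m / n\<close>, valid on \<open>I\<close>.\<close>
    have "(\<Sum>m\<in>I. cmod (wexp d m))\<^sup>2 \<le> (\<Sum>m\<in>I. (cmod (wexp d m))\<^sup>2) * card I"
      by (rule sum_squared_le_sum_of_squares)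
    also have "\<dots> \<le> (\<Sum>m\<in>I. (D / n)\<^sup>2 * (m * cmod (wexp d m))\<^sup>2) * n"
    proof (intro mult_mono sum_mono)
      fix m assume m: "m \<in> I"
      have "n < D * Suc (n div D)" using D(2) by (simp add: dividend_less_times_div)
      also have "\<dots> \<le> D * m" using m by (intro mult_le_mono2) (simp add: I_def)
      finally have "real n \<le> real D * real m" by (metis less_imp_le of_nat_le_iff of_nat_mult)
      then have "1 \<le> D / n * m" using n by (simp add: field_simps)
      then have "1 \<le> (D / n * m)\<^sup>2" by (rule one_le_power)
      then have "1 * (cmod (wexp d m))\<^sup>2 \<le> (D / n * m)\<^sup>2 * (cmod (wexp d m))\<^sup>2" by (rule mult_right_mono) simp
      then show "(cmod (wexp d m))\<^sup>2 \<le> (D / n)\<^sup>2 * (m * cmod (wexp d m))\<^sup>2"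
        by (simp add: power_mult_distrib power_divide mult_ac)
    qed (auto simp: I_def intro: sum_nonneg)
    also have "\<dots> = (D / n)\<^sup>2 * (\<Sum>m\<in>I. (m * cmod (wexp d m))\<^sup>2) * n" by (simp add: sum_distrib_left)
    also have "\<dots> \<le> (D / n)\<^sup>2 * (n * S\<^sup>2) * n"
    proof (intro mult_right_mono mult_left_mono)
      have "(\<Sum>m\<in>I. (m * cmod (wexp d m))\<^sup>2) \<le> (\<Sum>m\<le>n. (m * cmod (wexp d m))\<^sup>2)"
        by (rule sum_mono2) (auto simp: I_def)
      then show "(\<Sum>m\<in>I. (m * cmod (wexp d m))\<^sup>2) \<le> n * S\<^sup>2" using sq by linarith
    qed auto
    also have "\<dots> = (D * S)\<^sup>2" using n by (simp add: power2_eq_square)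
    finally have "(\<Sum>m\<in>I. cmod (wexp d m)) \<le> D * S" by (rule power2_le_imp_le) (use S0 in auto)
    also have "D * S = \<epsilon> / 2 * real n powr theta" using B by (simp add: S_def mult_ac)
    finally have upper: "(\<Sum>m\<in>I. cmod (wexp d m)) \<le> \<epsilon> / 2 * real n powr theta" .
    have "(\<Sum>m<Suc (n div D). cmod (wexp d m)) \<le> rough_sum 1 (Suc (n div D))"
      unfolding rough_sum_def by (intro sum_mono norm_wexp_le d)
    also have "\<dots> \<le> C1 * real (Suc (n div D)) powr theta" by (rule C1(2)) simp
    also have "\<dots> \<le> C1 * (2 / D * n) powr theta"
    proof (intro mult_left_mono powr_mono2)
      have "real (n div D) \<le> n / D" by (rule of_nat_div_le_of_nat)
      moreover have "1 \<le> n / D" using n D(2) by simp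
      ultimately show "real (Suc (n div D)) \<le> 2 / D * n" by simp
    qed (use C1 theta_pos in auto)
    also have "\<dots> = C1 * (2 / D) powr theta * real n powr theta" by (simp only: powr_mult mult.assoc)
    also have "\<dots> \<le> \<epsilon> / 2 * real n powr theta" using D(1) by (intro mult_right_mono) auto
    finally have lower: "(\<Sum>m<Suc (n div D). cmod (wexp d m)) \<le> \<epsilon> / 2 * real n powr theta" .
    have "n * cmod (wexp d n) = cmod (of_nat n * wexp d n)" by (simp add: norm_mult)
    also have "\<dots> \<le> (\<Sum>j=1..n. cmod (wexp d (n - j)))"
      unfolding wexp_def exp_fps_rec
      by (rule sum_norm_le) (use d in \<open>auto simp: norm_mult mult_le_one intro!: mult_left_le_one_le\<close>)
    also have "\<dots> = (\<Sum>m<n. cmod (wexp d m))"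
      by (rule sum.reindex_bij_witness[of _ "\<lambda>m. n - m" "\<lambda>j. n - j"]) auto
    also have "\<dots> \<le> (\<Sum>m\<in>{..<Suc (n div D)} \<union> I. cmod (wexp d m))"
      by (rule sum_mono2) (auto simp: I_def)
    also have "\<dots> = (\<Sum>m<Suc (n div D). cmod (wexp d m)) + (\<Sum>m\<in>I. cmod (wexp d m))"
      by (rule sum.union_disjoint) (auto simp: I_def)
    also have "\<dots> \<le> \<epsilon> * real n powr theta" using upper lower by simp
    finally show ?thesis using n by (simp add: powr_diff field_simps)
  qed
  show ?thesis
    unfolding eventually_sequentially by (rule exI[of _ "max 1 (max N D)"]) (use main in auto)
qed

end

section \<open>The convergent case\<close>

text \<open>Kronecker's lemma: beyond \<open>N\<close> one has
  \<open>f j \<le> n * (f j / j)\<close> with a small tail sum, and the first \<open>N\<close> terms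
  are bounded.\<close>

lemma kronecker_average:
  fixes f :: "nat \<Rightarrow> real" and \<epsilon> :: real
  assumes nonneg: "\<And>j. f j \<ge> 0" and bound: "\<And>j. f j \<le> B" and sum: "summable (\<lambda>j. f j / j)" and eps: "\<epsilon> > 0"
  shows "eventually (\<lambda>n. (\<Sum>j=1..n. f j) \<le> \<epsilon> * n) sequentially"
proof -
  have B: "B \<ge> 0" using nonneg[of 0] bound[of 0] by simp
  have "(\<lambda>N. \<Sum>j. f (j + N) / (j + N)) \<longlonglongrightarrow> 0" using suminf_exist_split2[OF sum] by simp
  then have "eventually (\<lambda>N. (\<Sum>j. f (j + N) / real (j + N)) < \<epsilon> / 2) sequentially"
    using eps by (intro order_tendstoD(2)) auto
  then obtain N where N: "(\<Sum>j. f (j + N) / real (j + N)) < \<epsilon> / 2"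
    unfolding eventually_sequentially by blast
  have "(\<Sum>j=1..n. f j) \<le> \<epsilon> * n" if n: "n \<ge> nat \<lceil>2 * (N * B + B) / \<epsilon>\<rceil>" for n
  proof -
    have "(\<Sum>j=1..n. f j) \<le> (\<Sum>j\<in>{..<N} \<union> {N..n}. f j)"
      by (rule sum_mono2) (use nonneg in auto)
    also have "\<dots> = (\<Sum>j<N. f j) + (\<Sum>j\<in>{N..n}. f j)" by (rule sum.union_disjoint) auto
    also have "(\<Sum>j<N. f j) \<le> (\<Sum>j<N. B)" by (intro sum_mono bound)
    \<comment> \<open>If \<open>N = 0\<close> the range contains \<open>j = 0\<close>, where
      \<open>f j / j\<close> is 0 by convention and does not control \<open>f j\<close>.\<close>
    also have "(\<Sum>j\<in>{N..n}. f j) \<le> f 0 + (\<Sum>j\<in>{N..n}. n * (f j / j))"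
    proof -
      have "(\<Sum>j\<in>{N..n}. f j) \<le> (\<Sum>j\<in>{N..n}. (if j = 0 then f 0 else 0) + n * (f j / j))"
      proof (rule sum_mono)
        fix j assume j: "j \<in> {N..n}"
        have "f j \<le> n * (f j / j)" if "j \<noteq> 0"
          using j that mult_right_mono[of "real j" "real n" "f j"] nonneg[of j] by (simp add: field_simps)
        then show "f j \<le> (if j = 0 then f 0 else 0) + n * (f j / j)" by auto
      qed
      also have "\<dots> \<le> f 0 + (\<Sum>j\<in>{N..n}. n * (f j / j))"
        using nonneg[of 0] by (simp add: sum.distrib sum.delta)
      finally show ?thesis .
    qed
    also have "(\<Sum>j\<in>{N..n}. n * (f j / j)) = n * (\<Sum>j\<in>{N..n}. f j / j)" by (simp add: sum_distrib_left)
    also have "(\<Sum>j\<in>{N..n}. f j / j) = (\<Sum>i\<in>{..<Suc n - N}. f (i + N) / real (i + N))"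
      by (rule sum.reindex_bij_witness[of _ "\<lambda>i. i + N" "\<lambda>j. j - N"]) auto
    also have "n * \<dots> \<le> n * (\<epsilon> / 2)"
    proof (rule mult_left_mono)
      have "(\<Sum>i\<in>{..<Suc n - N}. f (i + N) / real (i + N)) \<le> (\<Sum>j. f (j + N) / real (j + N))"
        by (rule sum_le_suminf) (use nonneg summable_ignore_initial_segment[OF sum, of N] in auto)
      then show "(\<Sum>i\<in>{..<Suc n - N}. f (i + N) / real (i + N)) \<le> \<epsilon> / 2" using N by simp
    qed simp
    finally have "(\<Sum>j=1..n. f j) \<le> N * B + f 0 + n * (\<epsilon> / 2)" by simp
    moreover have "2 * (N * B + B) / \<epsilon> \<le> n" using n by linarith
    then have "N * B + B \<le> n * (\<epsilon> / 2)" using eps by (simp add: field_simps)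
    ultimately show ?thesis using bound[of 0] by (simp add: algebra_simps)
  qed
  then show ?thesis unfolding eventually_sequentially by blast
qed

text \<open>The left half-plane is convex, and the derivative of the exponential has norm at most 1
  there.\<close>

lemma norm_exp_diff_le:
  assumes "Re u \<le> 0" "Re v \<le> 0"
  shows "cmod (exp u - exp v) \<le> cmod (u - v)"
proof -
  have "norm (exp u - exp v) \<le> 1 * norm (u - v)"
  proof (rule field_differentiable_bound[where S = "{z. Re z \<le> 0}" and f' = exp])
    show "convex {z. Re z \<le> 0}" by (rule convex_halfspace_Re_le)
    show "(exp has_field_derivative exp z) (at z within {z. Re z \<le> 0})" for z :: complex
      by (rule DERIV_subset[OF DERIV_exp]) simp
  qed (use assms in auto)
  then show ?thesis by simp
qed

section \<open>The deviation of \<open>d\<close> from 1, and the mean factor\<close>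

context coprime_lengths
begin

text \<open>The value at 0 is fixed because nothing is assumed about \<open>d 0\<close>; the uniform
  bound 2 then holds for all \<open>j\<close>.\<close>

definition dev :: "(nat \<Rightarrow> complex) \<Rightarrow> nat \<Rightarrow> real" where
  "dev d j = (if j = 0 then 0 else chi j * cmod (d j - 1))"

definition mean_factor :: "(nat \<Rightarrow> complex) \<Rightarrow> nat \<Rightarrow> complex" where
  "mean_factor d n = exp (\<Sum>j=1..n. of_real (chi j) * (d j - 1) / of_nat j)"

context
  fixes d :: "nat \<Rightarrow> complex"
  assumes d: "\<And>j. 1 \<le> j \<Longrightarrow> cmod (d j) \<le> 1"
    and conv: "summable (\<lambda>j. chi j * (1 - Re (d j)) / j)"
begin

lemma dev_nonneg: "0 \<le> dev d j"
  by (simp add: dev_def)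

lemma dev_le_2: "dev d j \<le> 2"
proof (cases "j = 0")
  case False
  then have "cmod (d j - 1) \<le> 2" using norm_triangle_ineq4[of "d j" 1] d[of j] by simp
  then show ?thesis using False by (simp add: dev_def chi_def)
qed (simp add: dev_def)

text \<open>Within the unit disc, \<open>(cmod (w - 1))\<^sup>2\<close> is at most
  \<open>2 * (1 - Re w)\<close>. So the convergence hypothesis controls deviations in mean
  square.\<close>

lemma dev_sq_le: "(dev d j)\<^sup>2 \<le> 2 * (chi j * (1 - Re (d j)))" if "j \<ge> 1"
proof -
  have "(cmod (d j - 1))\<^sup>2 = (cmod (d j))\<^sup>2 - 2 * Re (d j) + 1"
    unfolding cmod_power2 by (simp add: power2_eq_square algebra_simps)
  also have "(cmod (d j))\<^sup>2 \<le> 1" using d[OF that] by (simp add: power_le_one)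
  finally have "(cmod (d j - 1))\<^sup>2 \<le> 2 * (1 - Re (d j))" by simp
  then show ?thesis using that by (simp add: dev_def chi_def)
qed

text \<open>Kronecker's lemma for the squares, then Cauchy-Schwarz.\<close>

lemma sum_dev_small:
  fixes \<eta> :: real
  assumes "\<eta> > 0"
  shows "eventually (\<lambda>n. (\<Sum>j=1..n. dev d j) \<le> \<eta> * n) sequentially"
proof -
  have "eventually (\<lambda>n. (\<Sum>j=1..n. (dev d j)\<^sup>2) \<le> \<eta>\<^sup>2 * n) sequentially"
  proof (rule kronecker_average)
    show "(dev d j)\<^sup>2 \<le> 2\<^sup>2" for j using dev_le_2 dev_nonneg by (rule power_mono)
    have "summable (\<lambda>j. 2 * (chi j * (1 - Re (d j)) / j))" using conv by (rule summable_mult)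
    then show "summable (\<lambda>j. (dev d j)\<^sup>2 / j)"
    proof (rule summable_comparison_test'[of _ 1])
      fix j :: nat assume "j \<ge> 1"
      then show "norm ((dev d j)\<^sup>2 / j) \<le> 2 * (chi j * (1 - Re (d j)) / j)"
        using divide_right_mono[OF dev_sq_le, of j "real j"] by simp
    qed
  qed (use assms in auto)
  then show ?thesis
  proof eventually_elim
    case (elim n)
    have "(\<Sum>j=1..n. dev d j)\<^sup>2 \<le> (\<Sum>j=1..n. (dev d j)\<^sup>2) * card {1..n}" by (rule sum_squared_le_sum_of_squares)
    also have "\<dots> \<le> \<eta>\<^sup>2 * real n * real n" using elim by (intro mult_mono) auto
    also have "\<dots> = (\<eta> * n)\<^sup>2" by (simp add: power2_eq_square)
    finally show ?case by (rule power2_le_imp_le) (use assms in auto)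
  qed
qed

text \<open>Where \<open>n - j < n / D\<close>, the coefficients have a small sum and deviations are
  at most 2. Elsewhere every coefficient has the order n^(theta - 1), up to a factor depending on
  \<open>D\<close>, and the deviations have sum o(n).\<close>

lemma sum_dev_rough_small:
  assumes eps: "\<epsilon> > 0"
  shows "eventually (\<lambda>n. (\<Sum>j=1..n. dev d j * rough_coeff 1 (n - j)) \<le> \<epsilon> * real n powr theta) sequentially"
proof -
  obtain C1 where C1: "C1 > 0" "\<And>n. n \<ge> 1 \<Longrightarrow> rough_sum 1 n \<le> C1 * real n powr theta"
    using rough_bounds by (metis div_by_1 le_refl of_nat_1)
  obtain C where C: "C > 0" "\<And>n. n \<ge> 1 \<Longrightarrow> rough_coeff 1 n \<le> C * real n powr (theta - 1)"
    using rough_coeff_regularity by metis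
  have "(\<lambda>D. 2 * C1 * (1 / real D) powr theta) \<longlonglongrightarrow> 0" using theta_pos by real_asymp
  then have "eventually (\<lambda>D. 2 * C1 * (1 / real D) powr theta < \<epsilon> / 2 \<and> D \<ge> 1) sequentially"
    using eps by (intro eventually_conj order_tendstoD(2) eventually_ge_at_top) auto
  then obtain D :: nat where D: "2 * C1 * (1 / real D) powr theta < \<epsilon> / 2" "D \<ge> 1"
    unfolding eventually_sequentially by blast
  \<comment> \<open>Cancels the factor \<open>C * (2 * D)\<close> that bounds the coefficients with
    \<open>n - j \<ge> M\<close>.\<close>
  define \<eta> where "\<eta> = \<epsilon> / (2 * (C * (2 * D)))"
  have eta: "\<eta> > 0" using eps C D by (simp add: \<eta>_def)
  show ?thesis
    using sum_dev_small[OF eta] eventually_ge_at_top[of "2 * D"]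
  proof eventually_elim
    case (elim n)
    define M where "M = n div D"
    have n: "n \<ge> 1" "real n \<ge> 1" using elim D by auto
    have "M * D + n mod D = n" by (simp add: M_def)
    moreover have "n mod D < D" using D by simp
    ultimately have "n < M * D + D" by linarith
    then have "real n < real M * real D + real D" by (metis of_nat_add of_nat_less_iff of_nat_mult)
    then have Mn: "real M \<ge> n / (2 * D)" using elim D by (simp add: field_simps)
    have Mle: "real M \<le> n / D" unfolding M_def by (rule of_nat_div_le_of_nat)
    have M1: "M \<ge> 1" using elim D by (simp add: M_def Suc_le_eq div_greater_zero_iff)
    have small: "(\<Sum>j\<in>{j\<in>{1..n}. n - j < M}. dev d j * rough_coeff 1 (n - j)) \<le> \<epsilon> / 2 * real n powr theta"
    proof -
      have "(\<Sum>j\<in>{j\<in>{1..n}. n - j < M}. dev d j * rough_coeff 1 (n - j)) \<le> (\<Sum>j\<in>{j\<in>{1..n}. n - j < M}. 2 * rough_coeff 1 (n - j))"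
        by (intro sum_mono mult_right_mono dev_le_2 rough_coeff_nonneg)
      also have "\<dots> = (\<Sum>i\<in>(\<lambda>j. n - j) ` {j\<in>{1..n}. n - j < M}. 2 * rough_coeff 1 i)"
        by (subst sum.reindex) (auto simp: inj_on_def)
      also have "\<dots> \<le> (\<Sum>i<M. 2 * rough_coeff 1 i)" by (rule sum_mono2) (auto simp: rough_coeff_nonneg)
      also have "\<dots> = 2 * rough_sum 1 M" by (simp add: rough_sum_def sum_distrib_left)
      also have "\<dots> \<le> 2 * (C1 * (n / D) powr theta)"
        using C1(2)[OF M1] powr_mono2[OF _ _ Mle, of theta] theta_pos C1(1)
        by (intro mult_left_mono) (auto intro: order_trans mult_left_mono)
      also have "\<dots> = 2 * C1 * (1 / real D) powr theta * real n powr theta"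
        by (simp add: powr_divide)
      also have "\<dots> \<le> \<epsilon> / 2 * real n powr theta" using D(1) by (intro mult_right_mono) auto
      finally show ?thesis .
    qed
    have large: "(\<Sum>j\<in>{j\<in>{1..n}. \<not> n - j < M}. dev d j * rough_coeff 1 (n - j)) \<le> \<epsilon> / 2 * real n powr theta"
    proof -
      have gb: "rough_coeff 1 i \<le> C * (2 * D) * real n powr (theta - 1)" if i: "i \<ge> M" for i
      proof -
        have "real i powr (theta - 1) \<le> (n / (2 * D)) powr (theta - 1)"
          by (rule powr_mono2') (use theta_le_1 n D Mn i in auto)
        also have "(n / (2 * D)) powr (theta - 1) = (2 * D) powr (1 - theta) * real n powr (theta - 1)"
          by (simp add: powr_divide powr_minus_divide[symmetric] powr_diff field_simps)
        also have "\<dots> \<le> (2 * D) powr 1 * real n powr (theta - 1)"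
          using D theta_pos by (intro mult_right_mono powr_mono) auto
        finally have "C * real i powr (theta - 1) \<le> C * (2 * D * real n powr (theta - 1))"
          using C(1) by simp
        moreover have "rough_coeff 1 i \<le> C * real i powr (theta - 1)" by (rule C(2)) (use M1 i in simp)
        ultimately show ?thesis by simp
      qed
      have "(\<Sum>j\<in>{j\<in>{1..n}. \<not> n - j < M}. dev d j * rough_coeff 1 (n - j)) \<le>
          (\<Sum>j\<in>{j\<in>{1..n}. \<not> n - j < M}. dev d j * (C * (2 * D) * real n powr (theta - 1)))"
        by (intro sum_mono mult_left_mono gb dev_nonneg) auto
      also have "\<dots> \<le> (\<Sum>j=1..n. dev d j * (C * (2 * D) * real n powr (theta - 1)))"
        by (rule sum_mono2) (use C dev_nonneg in auto)
      also have "\<dots> = (\<Sum>j=1..n. dev d j) * (C * (2 * D) * real n powr (theta - 1))"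
        by (simp add: sum_distrib_right)
      also have "\<dots> \<le> (\<eta> * n) * (C * (2 * D) * real n powr (theta - 1))"
        using elim C by (intro mult_right_mono) auto
      also have "\<dots> = \<epsilon> / 2 * real n powr theta"
        using C D n by (simp add: \<eta>_def powr_diff)
      finally show ?thesis .
    qed
    have "(\<Sum>j=1..n. dev d j * rough_coeff 1 (n - j)) = (\<Sum>j\<in>{j\<in>{1..n}. n - j < M}. dev d j * rough_coeff 1 (n - j))
       + (\<Sum>j\<in>{j\<in>{1..n}. \<not> n - j < M}. dev d j * rough_coeff 1 (n - j))"
      by (subst sum.union_disjoint[symmetric]) (auto intro!: sum.cong)
    then show ?case using small large by simp
  qed
qed

lemma Re_mean_exponent_le: "Re (\<Sum>j=1..n. of_real (chi j) * (d j - 1) / of_nat j) \<le> 0"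
proof -
  have "Re (of_real (chi j) * (d j - 1) / of_nat j) \<le> 0" if j: "j \<in> {1..n}" for j
  proof -
    have "Re (d j) \<le> 1" using complex_Re_le_cmod[of "d j"] d[of j] j by auto
    then have "chi j * (Re (d j) - 1) \<le> 0" by (simp add: mult_nonneg_nonpos)
    then show ?thesis by (simp add: Re_divide_of_nat divide_nonpos_nonneg)
  qed
  then show ?thesis unfolding Re_sum by (intro sum_nonpos) auto
qed

lemma norm_mean_factor_le: "cmod (mean_factor d n) \<le> 1"
  unfolding mean_factor_def using Re_mean_exponent_le by simp

lemma mean_factor_diff:
  assumes "Y \<ge> 1" "Y - 1 \<le> n"
  shows "cmod (mean_factor d (Y - 1) - mean_factor d n) \<le> (\<Sum>j=Y..n. dev d j) / Y"
proof -
  let ?t = "\<lambda>j. of_real (chi j) * (d j - 1) / of_nat j"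
  have "{1..n} = {1..Y - 1} \<union> {Y..n}" using assms by auto
  then have split: "(\<Sum>j=1..n. ?t j) = (\<Sum>j=1..Y - 1. ?t j) + (\<Sum>j=Y..n. ?t j)"
    using assms by (simp add: sum.union_disjoint)
  have "cmod (mean_factor d (Y - 1) - mean_factor d n) \<le> cmod ((\<Sum>j=1..Y - 1. ?t j) - (\<Sum>j=1..n. ?t j))"
    unfolding mean_factor_def by (intro norm_exp_diff_le Re_mean_exponent_le)
  also have "\<dots> = cmod (\<Sum>j=Y..n. ?t j)" unfolding split by (simp add: norm_minus_commute)
  also have "\<dots> \<le> (\<Sum>j=Y..n. dev d j / Y)"
  proof (rule sum_norm_le)
    fix j assume j: "j \<in> {Y..n}"
    have "cmod (?t j) = dev d j / j" using j assms by (simp add: dev_def norm_mult norm_divide)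
    also have "\<dots> \<le> dev d j / Y" using j assms dev_nonneg by (intro divide_left_mono) auto
    finally show "cmod (?t j) \<le> dev d j / Y" .
  qed
  also have "\<dots> = (\<Sum>j=Y..n. dev d j) / Y" by (simp add: sum_divide_distrib)
  finally show ?thesis .
qed

text \<open>Slow variation of the mean factor; in the final convolution it allows the replacement of
  \<open>n - m\<close> by \<open>n\<close>.\<close>

lemma mean_factor_shift: "cmod (mean_factor d n - mean_factor d (n + m)) \<le> 2 * real m / (real n + 1)"
proof -
  have "cmod (mean_factor d (Suc n - 1) - mean_factor d (n + m)) \<le> (\<Sum>j=Suc n..n + m. dev d j) / Suc n"
    by (rule mean_factor_diff) auto
  also have "\<dots> \<le> (\<Sum>j=Suc n..n + m. 2) / Suc n" by (intro divide_right_mono sum_mono dev_le_2) auto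
  finally show ?thesis by (simp add: mult.commute add.commute)
qed


text \<open>The coefficient is a convolution of \<open>b\<close> (lengths below \<open>Y\<close>,
  dominated by \<open>smooth_coeff\<close>) with rough coefficients. If the latter were constantly
  \<open>exp (- h) * p\<close>, the result would be exactly
  \<open>p * mean_factor d (Y - 1)\<close>. The deviations \<open>x\<close> satisfy a balance: their
  sum weighted by \<open>smooth_coeff\<close> is 0. Hence only their negative parts matter, and
  \<open>low\<close> is one-sided. For \<open>m < t\<close> it bounds them; for
  \<open>m \<ge> t\<close> they are at most \<open>exp (- h) * p\<close>, and Markov's inequality
  makes the mass small.\<close>

lemma truncated_mean:
  assumes Y: "Y \<ge> 1" and t: "t \<ge> 1" and n: "n \<ge> 1"
    and low: "\<And>m. m < t \<Longrightarrow> m \<le> n \<and> rough_coeff 1 n - exp (coprime_harm (Y - 1)) * rough_coeff Y (n - m) \<le> \<beta>"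
    and beta: "\<beta> \<ge> 0"
  shows "cmod (fps_nth (exp_fps (\<lambda>j. if j < Y then of_real (chi j) * d j else of_real (chi j))) n
            - of_real (rough_coeff 1 n) * mean_factor d (Y - 1)) \<le> 2 * (\<beta> + rough_coeff 1 n * (Y - 1) / t)"
proof -
  define h where "h = coprime_harm (Y - 1)"
  define p where "p = rough_coeff 1 n"
  define b where "b = fps_nth (exp_fps (\<lambda>j. if j < Y then of_real (chi j) * d j else 0))"
  define \<gamma> where "\<gamma> = (\<lambda>m. if m \<le> n then rough_coeff Y (n - m) else 0)"
  define x where "x = (\<lambda>m. \<gamma> m - exp (- h) * p)"
  have p0: "p \<ge> 0" by (simp add: p_def rough_coeff_nonneg)
  have bw: "cmod (b m) \<le> smooth_coeff Y m" for m
    unfolding b_def smooth_coeff_def by (rule norm_exp_fps_le) (use d in \<open>auto simp: norm_mult mult_left_le\<close>)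
  have b_sums: "b sums exp (\<Sum>j=1..Y - 1. (if j < Y then of_real (chi j) * d j else 0) / of_nat j)"
    unfolding b_def by (rule exp_fps_sums) (use Y in auto)
  have Hsum: "complex_of_real h = (\<Sum>j=1..Y - 1. of_real (chi j) / of_nat j)" by (simp add: h_def coprime_harm_def)
  have "exp (\<Sum>j=1..Y - 1. (if j < Y then of_real (chi j) * d j else 0) / of_nat j) = exp (of_real h) * mean_factor d (Y - 1)"
  proof -
    have "(\<Sum>j=1..Y - 1. (if j < Y then of_real (chi j) * d j else 0) / of_nat j)
       = of_real h + (\<Sum>j=1..Y - 1. of_real (chi j) * (d j - 1) / of_nat j)"
      unfolding Hsum sum.distrib[symmetric]
      by (rule sum.cong) (use Y in \<open>auto simp: right_diff_distrib diff_divide_distrib\<close>)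
    then show ?thesis by (simp add: exp_add mean_factor_def)
  qed
  then have b_sums': "b sums (exp (of_real h) * mean_factor d (Y - 1))" using b_sums by simp
  have T: "fps_nth (exp_fps (\<lambda>j. if j < Y then of_real (chi j) * d j else of_real (chi j))) n
     = (\<Sum>m\<le>n. b m * of_real (\<gamma> m))"
  proof -
    have "(\<lambda>j. if j < Y then of_real (chi j) * d j else of_real (chi j)) =
       (\<lambda>j. (if j < Y then of_real (chi j) * d j else 0) + of_real (if Y \<le> j then chi j else 0))" by auto
    then show ?thesis
      by (simp add: exp_fps_add fps_mult_nth exp_fps_of_real b_def \<gamma>_def rough_coeff_def atLeast0AtMost)
  qed
  have T_sums: "(\<lambda>m. b m * of_real (\<gamma> m)) sums (\<Sum>m\<le>n. b m * of_real (\<gamma> m))"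
    by (rule sums_finite) (auto simp: \<gamma>_def)
  have "(\<lambda>m. b m * of_real (exp (- h) * p)) sums (exp (of_real h) * mean_factor d (Y - 1) * of_real (exp (- h) * p))"
    by (rule sums_mult2[OF b_sums'])
  moreover have "exp (of_real h) * mean_factor d (Y - 1) * of_real (exp (- h) * p) = of_real p * mean_factor d (Y - 1)"
    by (simp add: exp_minus exp_of_real field_simps)
  ultimately have S2: "(\<lambda>m. b m * of_real (exp (- h) * p)) sums (of_real p * mean_factor d (Y - 1))"
    by (simp only:)
  have bx: "(\<lambda>m. b m * of_real (x m)) sums ((\<Sum>m\<le>n. b m * of_real (\<gamma> m)) - of_real p * mean_factor d (Y - 1))"
    using sums_diff[OF T_sums S2] by (simp only: x_def of_real_diff right_diff_distrib)
  have "(\<lambda>m. smooth_coeff Y m * \<gamma> m) sums (\<Sum>m\<le>n. smooth_coeff Y m * \<gamma> m)" by (rule sums_finite) (auto simp: \<gamma>_def)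
  moreover have "(\<Sum>m\<le>n. smooth_coeff Y m * \<gamma> m) = p" unfolding p_def rough_coeff_1_convolution[of n Y] by (simp add: \<gamma>_def)
  ultimately have "(\<lambda>m. smooth_coeff Y m * \<gamma> m) sums p" by simp
  moreover have "(\<lambda>m. smooth_coeff Y m * (exp (- h) * p)) sums p"
  proof -
    have "exp h * (exp (- h) * p) = p" by (simp add: mult.assoc[symmetric] exp_minus)
    then show ?thesis
      using sums_mult2[OF smooth_coeff_sums[OF Y], of "exp (- h) * p"] unfolding h_def[symmetric] by (simp only:)
  qed
  \<comment> \<open>Both series sum to \<open>p\<close>: one by the splitting of all lengths at
    \<open>Y\<close>, the other because the total mass \<open>exp h\<close> cancels
    \<open>exp (- h)\<close>.\<close>
  ultimately have wx: "(\<lambda>m. smooth_coeff Y m * x m) sums 0" using sums_diff by (fastforce simp: x_def right_diff_distrib)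
  define r where "r = (\<lambda>m. smooth_coeff Y m - (if m < t then smooth_coeff Y m else 0))"
  have r_sums: "r sums (exp h - (\<Sum>m<t. smooth_coeff Y m))"
    unfolding r_def h_def
    by (intro sums_diff smooth_coeff_sums[OF Y]) (use sums_If_finite_set[of "{..<t}" "smooth_coeff Y"] in simp)
  have markov: "exp h - (\<Sum>m<t. smooth_coeff Y m) \<le> (Y - 1) / t * exp h"
  proof -
    have "(\<Sum>j=1..Y-1. (if j < Y then chi j else 0) / j) = h"
      unfolding h_def coprime_harm_def by (rule sum.cong) (use Y in auto)
    then have "(1 - real (Y - 1) / real t) * exp h \<le> (\<Sum>m<t. smooth_coeff Y m)"
      using exp_fps_markov[of "\<lambda>j. if j < Y then chi j else 0" "Y - 1" t] Y t by (simp add: smooth_coeff_def)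
    then show ?thesis by (simp add: algebra_simps)
  qed
  define bound where "bound = (\<lambda>m. smooth_coeff Y m * x m + 2 * (exp (- h) * (\<beta> * smooth_coeff Y m + p * r m)))"
  have bound_sums: "bound sums (0 + 2 * (exp (- h) * (\<beta> * exp h + p * (exp h - (\<Sum>m<t. smooth_coeff Y m)))))"
    unfolding bound_def h_def
    by (intro sums_add wx[unfolded h_def] sums_mult smooth_coeff_sums[OF Y] r_sums[unfolded h_def])
  have le: "cmod (b m * of_real (x m)) \<le> bound m" for m
  proof -
    have "cmod (b m * of_real (x m)) = cmod (b m) * \<bar>x m\<bar>" by (simp add: norm_mult)
    also have "\<dots> \<le> smooth_coeff Y m * \<bar>x m\<bar>" by (intro mult_right_mono bw) auto
    \<comment> \<open>An absolute value is the number itself plus twice its negative part.\<close>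
    also have "\<bar>x m\<bar> \<le> x m + 2 * (exp (- h) * (\<beta> + (if m < t then 0 else p)))"
    proof -
      have "- x m \<le> exp (- h) * (\<beta> + (if m < t then 0 else p))"
      proof (cases "m < t")
        case True
        have "rough_coeff 1 n - exp h * rough_coeff Y (n - m) \<le> \<beta>" "m \<le> n" using low[OF True] by (auto simp: h_def)
        then have "exp (- h) * (p - exp h * \<gamma> m) \<le> exp (- h) * \<beta>"
          by (intro mult_left_mono) (auto simp: p_def \<gamma>_def)
        moreover have "exp (- h) * (exp h * \<gamma> m) = \<gamma> m" by (simp add: mult.assoc[symmetric] exp_minus)
        ultimately show ?thesis using True by (simp add: x_def right_diff_distrib)
      next
        case False
        have "\<gamma> m \<ge> 0" "exp (- h) * \<beta> \<ge> 0" using beta by (simp_all add: \<gamma>_def rough_coeff_nonneg)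
        then show ?thesis using False by (simp add: x_def distrib_left)
      qed
      moreover have "0 \<le> exp (- h) * (\<beta> + (if m < t then 0 else p))" using beta p0 by simp
      ultimately show ?thesis by linarith
    qed
    also have "smooth_coeff Y m * (x m + 2 * (exp (- h) * (\<beta> + (if m < t then 0 else p)))) = bound m"
      by (simp add: bound_def r_def algebra_simps)
    finally show ?thesis using smooth_coeff_nonneg by (simp add: mult_left_mono)
  qed
  have "cmod ((\<Sum>m\<le>n. b m * of_real (\<gamma> m)) - of_real p * mean_factor d (Y - 1)) = cmod (\<Sum>m. b m * of_real (x m))"
    using bx by (simp add: sums_iff)
  also have "\<dots> \<le> (\<Sum>m. bound m)"
    by (rule norm_suminf_le) (use le bound_sums in \<open>auto simp: sums_iff\<close>)
  also have "\<dots> = 2 * (exp (- h) * (\<beta> * exp h + p * (exp h - (\<Sum>m<t. smooth_coeff Y m))))"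
    using bound_sums by (simp add: sums_iff)
  also have "\<dots> \<le> 2 * (exp (- h) * (\<beta> * exp h + p * ((Y - 1) / t * exp h)))"
    using markov p0 by (intro mult_left_mono add_left_mono) auto
  also have "\<dots> = 2 * (\<beta> + p * (Y - 1) / t)" by (simp add: exp_minus field_simps)
  finally show ?thesis unfolding T p_def .
qed

text \<open>Three errors of size \<epsilon> / 3: putting \<open>d = 1\<close> at lengths from
  \<open>Y\<close> on (\<open>norm_exp_fps_diff_le\<close>, with
  \<open>1 / j \<le> 1 / Y \<le> D / n\<close>), applying \<open>truncated_mean\<close>, and
  extending the mean factor from \<open>Y - 1\<close> to \<open>n\<close>.\<close>

lemma wexp_near_mean:
  assumes eps: "\<epsilon> > 0"
  shows "eventually (\<lambda>n. cmod (wexp d n - of_real (rough_coeff 1 n) * mean_factor d n) \<le> \<epsilon> * real n powr (theta - 1)) sequentially"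
proof -
  obtain \<kappa> c C where k: "\<kappa> > 0" "c > 0" "C > 0"
    and gC: "\<And>n. n \<ge> 1 \<Longrightarrow> rough_coeff 1 n \<le> C * real n powr (theta - 1)"
    and gk: "\<And>Y n. Y \<ge> 1 \<Longrightarrow> n \<ge> 2 * Y \<Longrightarrow> \<bar>exp (coprime_harm (Y - 1)) * rough_coeff Y n - \<kappa> * real n powr (theta - 1)\<bar>
         \<le> C * real n powr (theta - 1) * (real Y / real n) powr c"
    using rough_coeff_regularity by metis
  have "(\<lambda>D. (4 / real D) powr c) \<longlonglongrightarrow> 0" "(\<lambda>D. 1 / real D) \<longlonglongrightarrow> 0" using k by real_asymp+
  then have "(\<lambda>D. 2 * (3 * C * (4 / real D) powr c + 3 * C * (1 / real D))) \<longlonglongrightarrow> 2 * (3 * C * 0 + 3 * C * 0)"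
    by (intro tendsto_intros)
  then have "(\<lambda>D. 2 * (3 * C * (4 / real D) powr c + 3 * C / real D)) \<longlonglongrightarrow> 0" by simp
  \<comment> \<open>The two summands are the errors of \<open>truncated_mean\<close> in units of
    \<open>n powr (theta - 1)\<close>: the bound \<open>\<beta>\<close>, and the Markov term with
    \<open>Y - 1 \<le> n / D\<close> and \<open>t \<ge> n / 3\<close>. The condition
    \<open>D \<ge> 8\<close> gives \<open>N \<ge> 2 * Y\<close> below.\<close>
  then have "eventually (\<lambda>D. 2 * (3 * C * (4 / real D) powr c + 3 * C / real D) < \<epsilon> / 3 \<and> D \<ge> 8) sequentially"
    using eps by (intro eventually_conj order_tendstoD(2) eventually_ge_at_top) auto
  then obtain D :: nat where D: "2 * (3 * C * (4 / real D) powr c + 3 * C / real D) < \<epsilon> / 3" "D \<ge> 8"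
    unfolding eventually_sequentially by blast
  have e1: "\<epsilon> / (3 * D) > 0" "\<epsilon> / (3 * C * D) > 0" using eps D k by auto
  show ?thesis
    using sum_dev_rough_small[OF e1(1)] sum_dev_small[OF e1(2)] eventually_ge_at_top[of D]
  proof eventually_elim
    case (elim n)
    define Y where "Y = Suc (n div D)"
    define p where "p = real n powr (theta - 1)"
    define v where "v = (\<lambda>j. if j < Y then of_real (chi j) * d j else of_real (chi j))"
    define T where "T = fps_nth (exp_fps v) n"
    \<comment> \<open>Keeps \<open>n - m \<ge> n / 2\<close> for \<open>m < t\<close>, where the
      asymptotics of \<open>rough_coeff Y\<close> are uniform.\<close>
    define t where "t = n div 2"
    have n: "n \<ge> 8" "real n \<ge> 8" using elim D by auto
    have p0: "p > 0" using n by (simp add: p_def)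
    have pn: "real n powr theta = n * p" using n by (simp add: p_def powr_diff)
    have Y1: "Y \<ge> 1" by (simp add: Y_def)
    have Yn: "Y - 1 \<le> n" by (simp add: Y_def)
    have "n < D * Y" using D(2) by (simp add: Y_def dividend_less_times_div)
    then have "real n < real D * real Y" by (metis of_nat_less_iff of_nat_mult)
    have Yinv: "1 / real Y \<le> D / n"
      using \<open>real n < real D * real Y\<close> n Y1 by (simp add: field_simps)
    have divle: "real (n div D) \<le> n / D" by (rule of_nat_div_le_of_nat)
    have "1 \<le> n / D" using elim D by simp
    then have Yup: "real Y \<le> 2 * n / D" using divle by (simp add: Y_def)
    have i: "cmod (wexp d n - T) \<le> \<epsilon> / 3 * p"
    proof -
      have "cmod (wexp d n - T) \<le> (\<Sum>j=1..n. norm (of_real (chi j) * d j - v j) / j * fps_nth (exp_fps chi) (n - j))"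
        unfolding wexp_def T_def
        by (rule norm_exp_fps_diff_le) (use d in \<open>auto simp: v_def norm_mult mult_left_le\<close>)
      also have "\<dots> \<le> (\<Sum>j=1..n. 1 / Y * (dev d j * rough_coeff 1 (n - j)))"
      proof (rule sum_mono)
        fix j assume j: "j \<in> {1..n}"
        have "norm (of_real (chi j) * d j - v j) / j \<le> 1 / Y * dev d j"
        proof (cases "j < Y")
          case True
          then show ?thesis using dev_nonneg by (simp add: v_def)
        next
          case False
          have "of_real (chi j) * d j - v j = of_real (chi j) * (d j - 1)"
            using False by (simp add: v_def right_diff_distrib)
          then have "norm (of_real (chi j) * d j - v j) = dev d j" using j by (simp add: dev_def norm_mult)
          moreover have "dev d j / j \<le> dev d j / Y" using False Y1 dev_nonneg by (intro divide_left_mono) auto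
          ultimately show ?thesis by simp
        qed
        then have "norm (of_real (chi j) * d j - v j) / j * rough_coeff 1 (n - j) \<le> (1 / Y * dev d j) * rough_coeff 1 (n - j)"
          by (rule mult_right_mono) (rule rough_coeff_nonneg)
        then show "norm (of_real (chi j) * d j - v j) / j * fps_nth (exp_fps chi) (n - j) \<le> 1 / Y * (dev d j * rough_coeff 1 (n - j))"
          unfolding rough_coeff_1_eq[symmetric] by simp
      qed
      also have "\<dots> = 1 / Y * (\<Sum>j=1..n. dev d j * rough_coeff 1 (n - j))" by (simp only: sum_distrib_left)
      also have "\<dots> \<le> D / n * (\<epsilon> / (3 * D) * real n powr theta)"
        using Yinv elim dev_nonneg rough_coeff_nonneg by (intro mult_mono sum_nonneg) auto
      also have "\<dots> = \<epsilon> / 3 * p" unfolding pn using D n by simp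
      finally show ?thesis .
    qed
    have low: "m \<le> n \<and> rough_coeff 1 n - exp (coprime_harm (Y - 1)) * rough_coeff Y (n - m) \<le> 3 * C * p * (4 / D) powr c" if m: "m < t" for m
    proof -
      define N where "N = n - m"
      have mn: "2 * m \<le> n" using m by (simp add: t_def)
      then have Nn: "N \<le> n" "n \<le> 2 * N" "N \<ge> 1" using n by (auto simp: N_def)
      have NR: "real N \<ge> n / 2" using Nn by linarith
      have "8 * real n \<le> real D * real n" using D(2) by (intro mult_right_mono) auto
      then have "4 * n / D \<le> n / 2" using D(2) by (simp add: field_simps)
      then have "real (2 * Y) \<le> real N" using NR Yup by simp
      then have NY: "N \<ge> 2 * Y" by (simp only: of_nat_le_iff)
      have NP: "real n powr (theta - 1) \<le> real N powr (theta - 1)"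
        using theta_le_1 Nn by (intro powr_mono2') auto
      have NP2: "real N powr (theta - 1) \<le> 2 * p"
      proof -
        have "real N powr (theta - 1) \<le> (n / 2) powr (theta - 1)"
          using theta_le_1 NR n by (intro powr_mono2') auto
        also have "\<dots> = 2 powr (1 - theta) * p"
          by (simp add: p_def powr_divide powr_minus_divide[symmetric] powr_diff field_simps)
        also have "\<dots> \<le> 2 powr 1 * p" using theta_pos p0 by (intro mult_right_mono powr_mono) auto
        finally show ?thesis by simp
      qed
      have "real Y / real N \<le> (2 * n / D) / (n / 2)" using Yup NR n by (intro frac_le) auto
      then have YN: "real Y / real N \<le> 4 / D" using n by simp
      have r1: "(real Y / real N) powr c \<le> (4 / D) powr c" using YN k by (intro powr_mono2) auto
      have "1 / real n \<le> 4 / D" using elim D n by (simp add: field_simps)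
      then have r2: "(1 / real n) powr c \<le> (4 / D) powr c" using k by (intro powr_mono2) auto
      have "\<bar>exp (coprime_harm (Y - 1)) * rough_coeff Y N - \<kappa> * real N powr (theta - 1)\<bar> \<le> C * real N powr (theta - 1) * (real Y / real N) powr c"
        by (rule gk[OF Y1 NY])
      also have "\<dots> \<le> C * (2 * p) * (4 / D) powr c" using NP2 r1 k p0 by (intro mult_mono) auto
      finally have 1: "\<bar>exp (coprime_harm (Y - 1)) * rough_coeff Y N - \<kappa> * real N powr (theta - 1)\<bar> \<le> 2 * (C * p * (4 / D) powr c)" by simp
      have "\<bar>exp (coprime_harm (1 - 1)) * rough_coeff 1 n - \<kappa> * real n powr (theta - 1)\<bar> \<le> C * real n powr (theta - 1) * (real 1 / real n) powr c"
        by (rule gk) (use n in auto)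
      also have "\<dots> \<le> C * p * (4 / D) powr c" unfolding p_def using r2 k by (intro mult_left_mono) auto
      finally have 2: "\<bar>rough_coeff 1 n - \<kappa> * real n powr (theta - 1)\<bar> \<le> C * p * (4 / D) powr c" by (simp add: coprime_harm_def)
      \<comment> \<open>As \<open>theta \<le> 1\<close>, the main term at \<open>N = n - m\<close>
        is at least the one at \<open>n\<close>, which is the direction required;
        \<open>3 = 2 + 1\<close> adds up the two errors.\<close>
      have "\<kappa> * real n powr (theta - 1) \<le> \<kappa> * real N powr (theta - 1)" using NP k by simp
      then have "rough_coeff 1 n - exp (coprime_harm (Y - 1)) * rough_coeff Y N \<le> 3 * (C * p * (4 / D) powr c)" using 1 2 by linarith
      then show ?thesis using mn by (simp add: N_def)
    qed
    have ii: "cmod (T - of_real (rough_coeff 1 n) * mean_factor d (Y - 1)) \<le> \<epsilon> / 3 * p"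
    proof -
      have t1: "t \<ge> 1" "real t \<ge> n / 3" using n by (auto simp: t_def)
      have "cmod (T - of_real (rough_coeff 1 n) * mean_factor d (Y - 1)) \<le> 2 * (3 * C * p * (4 / D) powr c + rough_coeff 1 n * real (Y - 1) / t)"
        unfolding T_def v_def by (rule truncated_mean[OF Y1 t1(1) _ low]) (use n p0 k in auto)
      also have "rough_coeff 1 n * real (Y - 1) / t \<le> (C * p) * (n / D) / (n / 3)"
        using gC[of n] n t1 divle k p0 D(2) rough_coeff_nonneg
        by (intro frac_le mult_mono) (auto simp: p_def Y_def)
      also have "(C * p) * (n / D) / (n / 3) = 3 * C * p / D" using n by simp
      also have "2 * (3 * C * p * (4 / D) powr c + 3 * C * p / D) = 2 * (3 * C * (4 / D) powr c + 3 * C / D) * p"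
        by (simp add: algebra_simps)
      also have "\<dots> \<le> \<epsilon> / 3 * p" using D(1) p0 by (intro mult_right_mono) auto
      finally show ?thesis by simp
    qed
    have mf: "cmod (mean_factor d (Y - 1) - mean_factor d n) \<le> 1 / Y * (\<Sum>j=1..n. dev d j)"
    proof -
      have "(\<Sum>j=Y..n. dev d j) / Y \<le> (\<Sum>j=1..n. dev d j) / Y"
        by (intro divide_right_mono sum_mono2) (use Y1 dev_nonneg in auto)
      then show ?thesis using mean_factor_diff[OF Y1 Yn] by simp
    qed
    have iii: "cmod (of_real (rough_coeff 1 n) * mean_factor d (Y - 1) - of_real (rough_coeff 1 n) * mean_factor d n) \<le> \<epsilon> / 3 * p"
    proof -
      have "cmod (of_real (rough_coeff 1 n) * mean_factor d (Y - 1) - of_real (rough_coeff 1 n) * mean_factor d n)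
         = rough_coeff 1 n * cmod (mean_factor d (Y - 1) - mean_factor d n)"
        by (simp add: right_diff_distrib[symmetric] norm_mult rough_coeff_nonneg)
      also have "\<dots> \<le> (C * p) * (1 / Y * (\<Sum>j=1..n. dev d j))"
        using gC[of n] n mf k p0 by (intro mult_mono) (auto simp: p_def)
      also have "\<dots> \<le> (C * p) * (D / n * (\<epsilon> / (3 * C * D) * n))"
        using Yinv elim k p0 dev_nonneg by (intro mult_left_mono mult_mono sum_nonneg) auto
      also have "\<dots> = \<epsilon> / 3 * p" using D n k by simp
      finally show ?thesis .
    qed
    have "wexp d n - of_real (rough_coeff 1 n) * mean_factor d n = (wexp d n - T) + (T - of_real (rough_coeff 1 n) * mean_factor d (Y - 1))
        + (of_real (rough_coeff 1 n) * mean_factor d (Y - 1) - of_real (rough_coeff 1 n) * mean_factor d n)" by simp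
    also have "cmod \<dots> \<le> \<epsilon> / 3 * p + \<epsilon> / 3 * p + \<epsilon> / 3 * p"
      by (intro norm_triangle_mono i ii iii)
    also have "\<dots> = \<epsilon> * real n powr (theta - 1)" by (simp add: p_def)
    finally show ?case .
  qed
qed

end

end

section \<open>Lengths not coprime to k\<close>

definition root_weight :: "nat \<Rightarrow> (nat \<Rightarrow> 'a::field_char_0) \<Rightarrow> nat \<Rightarrow> nat \<Rightarrow> 'a" where
  "root_weight k d j s = (if q_part k j dvd s then d j ^ s else 0)"

text \<open>Lengths beyond \<open>J\<close> do not occur, and 0 is divisible by everything; so the
  finite product tests the condition for all \<open>j\<close>.\<close>

lemma prod_root_weight:
  assumes "finite X" "\<sigma> permutes X" "card X \<le> J"
  shows "(\<Prod>j=1..J. root_weight k d j (cycle_count X \<sigma> j)) =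
     (if \<forall>j. q_part k j dvd cycle_count X \<sigma> j then \<Prod>C\<in>orbit \<sigma> ` X. d (card C) else 0)"
proof (cases "\<forall>j. q_part k j dvd cycle_count X \<sigma> j")
  case True
  then show ?thesis by (simp add: root_weight_def prod_over_cycles[OF assms])
next
  case False
  then obtain j where j: "\<not> q_part k j dvd cycle_count X \<sigma> j" by blast
  then have "cycle_count X \<sigma> j \<noteq> 0" by (metis dvd_0_right)
  then have "j \<in> {1..J}" using cycle_count_eq_0[OF assms(1,2), of j] assms(3) by force
  moreover have "root_weight k d j (cycle_count X \<sigma> j) = 0" using j by (simp add: root_weight_def)
  ultimately have "(\<Prod>j=1..J. root_weight k d j (cycle_count X \<sigma> j)) = 0"
    by (intro prod_zero) auto
  then show ?thesis by (simp only: if_not_P[OF False])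
qed

definition cycle_index_coeff :: "nat \<Rightarrow> (nat \<Rightarrow> 'a::field_char_0) \<Rightarrow> nat \<Rightarrow> 'a" where
  "cycle_index_coeff k d n = fps_nth (\<Prod>j=1..n. cycle_fps j (root_weight k d j)) n"

lemma sum_power_perms:
  assumes "k > 0"
  shows "(\<Sum>\<sigma>\<in>power_perms k n. mult_fun d n \<sigma>) = fact n * cycle_index_coeff k d n"
proof -
  have fin: "finite {\<sigma>. \<sigma> permutes {1..n}}" by (rule finite_permutations) simp
  have "(\<Sum>\<sigma>\<in>power_perms k n. mult_fun d n \<sigma>) =
      (\<Sum>\<sigma> | \<sigma> permutes {1..n}. if \<forall>j. q_part k j dvd cycle_count {1..n} \<sigma> j then mult_fun d n \<sigma> else 0)"
    unfolding power_perms_iff[OF assms] by (rule sum.mono_neutral_cong_left) (use fin in auto)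
  also have "\<dots> = (\<Sum>\<sigma> | \<sigma> permutes {1..n}. \<Prod>j=1..n. root_weight k d j (cycle_count {1..n} \<sigma> j))"
  proof (rule sum.cong[OF refl])
    fix \<sigma> assume "\<sigma> \<in> {\<sigma>. \<sigma> permutes {1..n}}"
    then show "(if \<forall>j. q_part k j dvd cycle_count {1..n} \<sigma> j then mult_fun d n \<sigma> else 0)
      = (\<Prod>j=1..n. root_weight k d j (cycle_count {1..n} \<sigma> j))"
      unfolding mult_fun_def perm_cycles_def by (intro prod_root_weight[symmetric]) auto
  qed
  also have "\<dots> = fact n * cycle_index_coeff k d n"
    using sum_permutations_cycle_counts[of "{1..n}" n "root_weight k d"] by (simp add: cycle_index_coeff_def)
  finally show ?thesis .
qed

lemma mean_power_perms_eq:
  assumes "k > 0"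
  shows "mean_power_perms k n (mult_fun d n) = cycle_index_coeff k d n / cycle_index_coeff k (\<lambda>_. 1) n"
proof -
  have "of_nat (card (power_perms k n)) = (\<Sum>\<sigma>\<in>power_perms k n. mult_fun (\<lambda>_. 1) n \<sigma>)"
    by (simp add: mult_fun_def)
  then show ?thesis unfolding mean_power_perms_def by (simp add: sum_power_perms[OF assms])
qed

text \<open>The cycle lengths add up to \<open>n\<close>. This is how a general \<open>x0\<close> is
  reduced to 0.\<close>

lemma mult_fun_twist:
  assumes "\<sigma> permutes {1..n}"
  shows "mult_fun (\<lambda>j. d j * z ^ j) n \<sigma> = z ^ n * mult_fun d n \<sigma>"
proof -
  have "(\<Prod>C\<in>orbit \<sigma> ` {1..n}. z ^ card C) = (\<Prod>j=1..n. (z ^ j) ^ cycle_count {1..n} \<sigma> j)"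
    using prod_over_cycles[of "{1..n}" \<sigma> n "\<lambda>j. z ^ j"] assms by simp
  also have "\<dots> = z ^ (\<Sum>j=1..n. j * cycle_count {1..n} \<sigma> j)"
    by (simp add: power_sum power_mult)
  also have "\<dots> = z ^ n" using sum_cycle_count[of "{1..n}" \<sigma> n] assms by simp
  finally show ?thesis by (simp add: mult_fun_def perm_cycles_def prod.distrib mult.commute)
qed

lemma mean_power_perms_twist:
  "mean_power_perms k n (mult_fun (\<lambda>j. d j * z ^ j) n) = z ^ n * mean_power_perms k n (mult_fun d n)"
proof -
  have "\<sigma> permutes {1..n}" if "\<sigma> \<in> power_perms k n" for \<sigma>
    using that permutes_funpow by (auto simp: power_perms_def)
  then have "(\<Sum>\<sigma>\<in>power_perms k n. mult_fun (\<lambda>j. d j * z ^ j) n \<sigma>) = (\<Sum>\<sigma>\<in>power_perms k n. z ^ n * mult_fun d n \<sigma>)"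
    by (intro sum.cong refl mult_fun_twist)
  then show ?thesis by (simp add: mean_power_perms_def sum_distrib_left)
qed

section \<open>Products of power series and their majorants\<close>

lemma fps_prod_sums:
  fixes F :: "'i \<Rightarrow> 'a::{real_normed_field,banach,field_char_0} fps"
  assumes "finite A" "\<And>i. i \<in> A \<Longrightarrow> fps_nth (F i) sums S i" "\<And>i. i \<in> A \<Longrightarrow> summable (\<lambda>n. norm (fps_nth (F i) n))"
  shows "fps_nth (\<Prod>i\<in>A. F i) sums (\<Prod>i\<in>A. S i) \<and> summable (\<lambda>n. norm (fps_nth (\<Prod>i\<in>A. F i) n))"
  using assms
proof (induction A)
  case empty
  have "fps_nth (1 :: 'a fps) = (\<lambda>n. if n = 0 then 1 else 0)" by auto
  moreover have "(\<lambda>n. if n = 0 then 1 else (0::'a)) sums 1" using sums_single[of 0 "\<lambda>_. 1::'a"] by simp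
  moreover have "summable (\<lambda>n. norm (if n = 0 then 1 else (0::'a)))"
    by (rule summable_finite[of "{0}"]) auto
  ultimately show ?case by simp
next
  case (insert a A)
  define P where "P = (\<Prod>i\<in>A. F i)"
  have P: "fps_nth P sums (\<Prod>i\<in>A. S i)" "summable (\<lambda>n. norm (fps_nth P n))"
    using insert by (auto simp: P_def)
  have a: "fps_nth (F a) sums S a" "summable (\<lambda>n. norm (fps_nth (F a) n))" using insert.prems by auto
  have prod: "fps_nth (\<Prod>i\<in>insert a A. F i) n = (\<Sum>i\<le>n. fps_nth (F a) i * fps_nth P (n - i))" for n
    using insert.hyps by (simp add: P_def fps_mult_nth atLeast0AtMost)
  have "fps_nth (\<Prod>i\<in>insert a A. F i) sums (S a * (\<Prod>i\<in>A. S i))"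
    using Cauchy_product_sums[OF a(2) P(2)] a(1) P(1) unfolding prod by (simp add: sums_unique[symmetric])
  moreover have "summable (\<lambda>n. norm (fps_nth (\<Prod>i\<in>insert a A. F i) n))"
  proof (rule summable_comparison_test'[of _ 0])
    show "summable (\<lambda>n. \<Sum>i\<le>n. norm (fps_nth (F a) i) * norm (fps_nth P (n - i)))"
      by (rule summable_Cauchy_product) (use a P in auto)
    show "norm (norm (fps_nth (\<Prod>i\<in>insert a A. F i) n)) \<le> (\<Sum>i\<le>n. norm (fps_nth (F a) i) * norm (fps_nth P (n - i)))" for n
      unfolding prod by (simp add: norm_mult[symmetric] norm_sum)
  qed
  ultimately show ?case using insert.hyps by simp
qed

lemma norm_fps_prod_le:
  fixes F :: "'i \<Rightarrow> 'a::{real_normed_field,field_char_0} fps"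
  assumes "finite A" "\<And>i n. i \<in> A \<Longrightarrow> norm (fps_nth (F i) n) \<le> fps_nth (E i) n"
  shows "norm (fps_nth (\<Prod>i\<in>A. F i) n) \<le> fps_nth (\<Prod>i\<in>A. E i) n"
  using assms
proof (induction A arbitrary: n)
  case (insert a A)
  have IH: "norm (fps_nth (prod F A) n) \<le> fps_nth (prod E A) n" for n using insert by auto
  have "norm (fps_nth (F a * prod F A) n) \<le> (\<Sum>i=0..n. norm (fps_nth (F a) i * fps_nth (prod F A) (n - i)))"
    unfolding fps_mult_nth by (rule norm_sum)
  also have "\<dots> \<le> (\<Sum>i=0..n. fps_nth (E a) i * fps_nth (prod E A) (n - i))"
  proof (rule sum_mono)
    fix i
    have "norm (fps_nth (F a) i) \<le> fps_nth (E a) i" using insert.prems by simp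
    then show "norm (fps_nth (F a) i * fps_nth (prod F A) (n - i)) \<le> fps_nth (E a) i * fps_nth (prod E A) (n - i)"
      unfolding norm_mult using IH by (intro mult_mono) (auto intro: order_trans[OF norm_ge_zero])
  qed
  finally show ?case using insert.hyps by (simp add: fps_mult_nth)
qed (simp add: fps_one_nth)

lemma exp_fps_prod:
  assumes "finite A"
  shows "(\<Prod>i\<in>A. exp_fps (r i)) = exp_fps (\<lambda>m. \<Sum>i\<in>A. r i m)"
  using assms
proof (induction A)
  case empty
  show ?case by (rule exp_fps_unique) (auto simp: fps_eq_iff fps_mult_nth)
qed (simp add: exp_fps_add)

text \<open>The term \<open>j = m\<close> of the recursion alone gives the linear part of the
  exponential.\<close>

lemma exp_fps_nth_ge:
  fixes r :: "nat \<Rightarrow> real"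
  assumes "\<And>j. 0 \<le> r j" "m \<ge> 1"
  shows "r m / m \<le> fps_nth (exp_fps r) m"
proof -
  have "r m * fps_nth (exp_fps r) (m - m) \<le> (\<Sum>j=1..m. r j * fps_nth (exp_fps r) (m - j))"
    by (rule member_le_sum) (use assms exp_fps_nonneg[of r] in auto)
  then have "r m \<le> m * fps_nth (exp_fps r) m" using exp_fps_rec[of m r] by simp
  then show ?thesis using assms(2) by (simp add: field_simps)
qed

lemma convolution_tendsto_0:
  fixes a b :: "nat \<Rightarrow> real"
  assumes a: "a \<longlonglongrightarrow> 0" and b: "summable b" "\<And>n. b n \<ge> 0"
  shows "(\<lambda>n. \<Sum>i\<le>n. b i * a (n - i)) \<longlonglongrightarrow> 0"
proof -
  obtain A where A: "\<And>n. \<bar>a n\<bar> \<le> A"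
    using convergent_imp_Bseq[OF convergentI[OF a]] by (auto simp: Bseq_def)
  define x where "x = (\<lambda>i n. if i \<le> n then b i * a (n - i) else 0)"
  have "(\<lambda>n. \<Sum>i. x i n) \<longlonglongrightarrow> (\<Sum>i. 0)"
  proof (rule tannerys_theorem[THEN conjunct2, THEN conjunct2])
    fix i
    have "(\<lambda>n. b i * a n) \<longlonglongrightarrow> b i * 0" by (intro tendsto_intros a)
    then have "(\<lambda>n. x i (n + i)) \<longlonglongrightarrow> 0" by (simp add: x_def)
    then show "(\<lambda>n. x i n) \<longlonglongrightarrow> 0" by (rule LIMSEQ_offset)
  next
    have "norm (x i n) \<le> b i * A" for i n
      using A[of "n - i"] A[of 0] b(2)[of i] by (auto simp: x_def abs_mult intro: mult_left_mono)
    then show "eventually (\<lambda>(i, n). norm (x i n) \<le> b i * A) (at_top \<times>\<^sub>F sequentially)"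
      by (intro always_eventually) auto
    show "summable (\<lambda>i. b i * A)" by (rule summable_mult2[OF b(1)])
  qed simp
  moreover have "(\<Sum>i. x i n) = (\<Sum>i\<le>n. b i * a (n - i))" for n
    by (subst suminf_finite[of "{..n}"]) (auto simp: x_def)
  ultimately show ?thesis by simp
qed

text \<open>A factor for a length \<open>j\<close> that is not coprime to \<open>k\<close> has no linear term in \<open>z\<^sup>j / j\<close>, and the
  exponentials of the higher terms dominate it. Over all \<open>j\<close> these exponents add up to at most
  \<open>exp 2 / m\<^sup>2\<close> at \<open>z\<^sup>m\<close>.\<close>

definition majorant :: "nat \<Rightarrow> real" where
  "majorant = fps_nth (exp_fps (\<lambda>m. exp 2 / m))"

lemma majorant_nonneg: "0 \<le> majorant n"
  unfolding majorant_def by (rule exp_fps_nonneg) simp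

lemma summable_majorant: "summable majorant"
proof (rule summableI_nonneg_bounded)
  fix n
  have sq: "summable (\<lambda>j. exp 2 * (1 / real j ^ 2))"
    using inverse_power_summable[of 2] by (intro summable_mult) (simp add: inverse_eq_divide)
  have "(\<Sum>i<n. majorant i) \<le> (\<Sum>i\<le>n. majorant i)" by (rule sum_mono2) (auto simp: majorant_nonneg)
  also have "\<dots> \<le> exp (\<Sum>j=1..n. exp 2 / real j / real j)"
    unfolding majorant_def by (rule sum_exp_fps_le) simp
  also have "(\<Sum>j=1..n. exp 2 / real j / real j) = (\<Sum>j=1..n. exp 2 * (1 / real j ^ 2))"
    by (simp add: power2_eq_square)
  also have "\<dots> \<le> (\<Sum>j. exp 2 * (1 / real j ^ 2))" by (rule sum_le_suminf[OF sq]) auto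
  finally show "(\<Sum>i<n. majorant i) \<le> exp (\<Sum>j. exp 2 * (1 / real j ^ 2))" by simp
qed (rule majorant_nonneg)

text \<open>By the recursion, \<open>n * majorant n\<close> is the convolution of the summable
  \<open>majorant\<close> with the null sequence \<open>exp 2 / j\<close>; at \<open>j = 0\<close>
  the quotient is 0 by convention.\<close>

lemma majorant_null: "(\<lambda>n. n * majorant n) \<longlonglongrightarrow> 0"
proof -
  have "(\<lambda>n. exp 2 / real n) \<longlonglongrightarrow> 0" by real_asymp
  then have "(\<lambda>n. \<Sum>i\<le>n. majorant i * (exp 2 / real (n - i))) \<longlonglongrightarrow> 0"
    by (rule convolution_tendsto_0) (use summable_majorant majorant_nonneg in auto)
  moreover have "(\<Sum>i\<le>n. majorant i * (exp 2 / real (n - i))) = n * majorant n" for n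
  proof -
    have "(\<Sum>i\<le>n. majorant i * (exp 2 / real (n - i))) = (\<Sum>j\<le>n. majorant (n - j) * (exp 2 / real j))"
      by (rule sum.reindex_bij_witness[of _ "\<lambda>j. n - j" "\<lambda>i. n - i"]) auto
    also have "\<dots> = (\<Sum>j=1..n. majorant (n - j) * (exp 2 / real j))"
      by (rule sum.mono_neutral_right) (auto simp: Suc_le_eq)
    also have "\<dots> = n * majorant n" unfolding majorant_def exp_fps_rec by (simp add: mult.commute)
    finally show ?thesis .
  qed
  ultimately show ?thesis by simp
qed

text \<open>In the normalization of \<open>exp_fps\<close>, \<open>m\<close> times the coefficient
  of z^m in the exponential of z^j / j without its constant and linear terms.\<close>

definition log_majorant :: "nat \<Rightarrow> nat \<Rightarrow> real" where
  "log_majorant j m = (if j dvd m \<and> m div j \<ge> 2 then m / (real j ^ (m div j) * fact (m div j)) else 0)"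

text \<open>With m = j s and s at least 2, \<open>m\<close> times the \<open>j\<close>-th term is
  (s^2 / s!) j^(2 - s), at most s / (s - 1)! and hence at most 2^(s - 1) / (s - 1)!. Different
  \<open>j\<close> give different \<open>s\<close>, so these sum to at most
  \<open>exp 2\<close>.\<close>

lemma sum_log_majorant_le:
  assumes "m \<ge> 1"
  shows "(\<Sum>j=1..J. log_majorant j m) \<le> exp 2 / m"
proof -
  define A where "A = {j \<in> {1..J}. j dvd m \<and> m div j \<ge> 2}"
  have each: "log_majorant j m \<le> (2 ^ (m div j - 1) / fact (m div j - 1)) / m" if "j \<in> A" for j
  proof -
    define s where "s = m div j"
    have s: "s \<ge> 2" "m = j * s" "j \<ge> 1" using that by (auto simp: s_def A_def)
    obtain i where i: "s = Suc (Suc i)" using s(1) by (metis Suc_le_D numeral_2_eq_2 Suc_le_mono le_Suc_ex plus_nat.simps(2) add_2_eq_Suc)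
    have "real m * log_majorant j m = real m * (real m / (real j ^ s * fact s))"
      using that by (simp add: log_majorant_def A_def s_def)
    also have "\<dots> = (real s ^ 2 / fact s) * (real j ^ 2 / real j ^ s)" using s by (simp add: power2_eq_square mult_ac)
    also have "\<dots> \<le> (real s ^ 2 / fact s) * 1"
    proof (rule mult_left_mono)
      have "real j ^ 2 \<le> real j ^ s" using s by (intro power_increasing) auto
      then show "real j ^ 2 / real j ^ s \<le> 1" using s by (simp add: divide_le_eq_1)
    qed simp
    also have "real s ^ 2 / fact s = real s / fact (s - 1)" using s by (simp add: fact_reduce power2_eq_square)
    also have "\<dots> \<le> 2 ^ (s - 1) / fact (s - 1)"
    proof (rule divide_right_mono)
      have "s \<le> 2 ^ (s - 1)" using s(1) by (metis One_nat_def Suc_le_eq Suc_pred less_exp less_le_trans pos2)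
      then show "real s \<le> 2 ^ (s - 1)" by (metis of_nat_le_iff of_nat_numeral of_nat_power)
    qed simp
    finally show ?thesis using assms by (simp add: s_def field_simps)
  qed
  have "(\<Sum>j=1..J. log_majorant j m) = (\<Sum>j\<in>A. log_majorant j m)"
    by (rule sum.mono_neutral_right) (auto simp: A_def log_majorant_def)
  also have "\<dots> \<le> (\<Sum>j\<in>A. (2 ^ (m div j - 1) / fact (m div j - 1)) / m)" by (rule sum_mono) (rule each)
  also have "\<dots> = (\<Sum>j\<in>A. 2 ^ (m div j - 1) / fact (m div j - 1)) / m" by (simp add: sum_divide_distrib)
  also have "(\<Sum>j\<in>A. 2 ^ (m div j - 1) / fact (m div j - 1)) = (\<Sum>i\<in>(\<lambda>j. m div j - 1) ` A. (2::real) ^ i / fact i)"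
  proof (subst sum.reindex)
    show "inj_on (\<lambda>j. m div j - 1) A"
    proof (rule inj_onI)
      fix x y assume x: "x \<in> A" and y: "y \<in> A" and e: "m div x - 1 = m div y - 1"
      then have "m div x = m div y" by (auto simp: A_def)
      then have "x * (m div x) = y * (m div x)" using x y by (auto simp: A_def)
      then show "x = y" using x by (auto simp: A_def)
    qed
  qed simp
  also have "\<dots> \<le> (\<Sum>i. (2::real) ^ i / fact i)"
  proof (rule sum_le_suminf)
    show "summable (\<lambda>i. 2 ^ i / fact i :: real)" using summable_exp[of "2::real"] by (simp add: divide_inverse mult.commute)
  qed (auto simp: A_def)
  also have "\<dots> = (exp 2 :: real)" by (simp add: exp_def divide_inverse mult.commute)
  finally show ?thesis by (simp add: divide_right_mono)
qed

section \<open>The product over the lengths not coprime to \<open>k\<close>\<close>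

definition noncoprime_prod :: "nat \<Rightarrow> (nat \<Rightarrow> 'a::field_char_0) \<Rightarrow> nat \<Rightarrow> 'a fps" where
  "noncoprime_prod k d J = (\<Prod>j\<in>{j. 1 \<le> j \<and> j \<le> J \<and> gcd j k > 1}. cycle_fps j (root_weight k d j))"

definition noncoprime_coeff :: "nat \<Rightarrow> (nat \<Rightarrow> 'a::field_char_0) \<Rightarrow> nat \<Rightarrow> 'a" where
  "noncoprime_coeff k d n = fps_nth (noncoprime_prod k d n) n"

lemma fps_nth_mult_cutoff:
  fixes F :: "'a::comm_ring_1 fps"
  assumes "fps_nth F 0 = 1" "\<And>i. 1 \<le> i \<Longrightarrow> i \<le> n \<Longrightarrow> fps_nth F i = 0"
  shows "fps_nth (F * P) n = fps_nth P n"
proof -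
  have "fps_nth (F * P) n = (\<Sum>i=0..n. (if i = 0 then fps_nth P n else 0))"
    unfolding fps_mult_nth by (rule sum.cong) (use assms in auto)
  then show ?thesis by simp
qed

lemma cycle_fps_root_weight_low:
  "fps_nth (cycle_fps j (root_weight k d j)) 0 = 1"
  "1 \<le> i \<Longrightarrow> i < j \<Longrightarrow> fps_nth (cycle_fps j (root_weight k d j)) i = 0"
  by (auto simp: cycle_fps_nth root_weight_def dest: dvd_imp_le)

text \<open>A factor of length \<open>j > n\<close> is 1 up to terms of degree \<open>j\<close> and
  more, so the \<open>n\<close>-th coefficient is final once \<open>J \<ge> n\<close>.\<close>

lemma noncoprime_prod_nth:
  assumes "n \<le> J"
  shows "fps_nth (noncoprime_prod k d J) n = noncoprime_coeff k d n"
  using assms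
proof (induction J rule: dec_induct)
  case base show ?case by (simp add: noncoprime_coeff_def)
next
  case (step J)
  show ?case
  proof (cases "gcd (Suc J) k > 1")
    case True
    then have "{j. 1 \<le> j \<and> j \<le> Suc J \<and> gcd j k > 1} = insert (Suc J) {j. 1 \<le> j \<and> j \<le> J \<and> gcd j k > 1}"
      by (auto simp: le_Suc_eq)
    then have "noncoprime_prod k d (Suc J) = cycle_fps (Suc J) (root_weight k d (Suc J)) * noncoprime_prod k d J"
      unfolding noncoprime_prod_def by (simp only:) (subst prod.insert; auto)
    then show ?thesis using step by (simp add: fps_nth_mult_cutoff cycle_fps_root_weight_low)
  next
    case False
    then have "{j. 1 \<le> j \<and> j \<le> Suc J \<and> gcd j k > 1} = {j. 1 \<le> j \<and> j \<le> J \<and> gcd j k > 1}"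
      by (auto simp: le_Suc_eq)
    then show ?thesis using step.IH unfolding noncoprime_prod_def by simp
  qed
qed

text \<open>A nonconstant term of a factor has \<open>s \<ge> q_part k j \<ge> 2\<close>, so it is
  bounded by \<open>log_majorant j m / m\<close>, the linear part of the exponential. The bound is
  independent of \<open>J\<close>.\<close>

lemma norm_noncoprime_prod_le:
  fixes d :: "nat \<Rightarrow> 'a::{real_normed_field,field_char_0}"
  assumes k: "k > 0" and d: "\<And>j. 1 \<le> j \<Longrightarrow> norm (d j) \<le> 1"
  shows "norm (fps_nth (noncoprime_prod k d J) n) \<le> majorant n"
proof -
  let ?A = "{j. 1 \<le> j \<and> j \<le> J \<and> gcd j k > 1}"
  have fin: "finite ?A" by (rule finite_subset[of _ "{..J}"]) auto
  have nonneg: "0 \<le> log_majorant j m" for j m by (simp add: log_majorant_def)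
  have "norm (fps_nth (noncoprime_prod k d J) n) \<le> fps_nth (\<Prod>j\<in>?A. exp_fps (log_majorant j)) n"
    unfolding noncoprime_prod_def
  proof (rule norm_fps_prod_le[OF fin])
    fix j m assume j: "j \<in> ?A"
    show "norm (fps_nth (cycle_fps j (root_weight k d j)) m) \<le> fps_nth (exp_fps (log_majorant j)) m"
    proof (cases "m = 0")
      case True
      then show ?thesis by (simp add: cycle_fps_root_weight_low(1))
    next
      case m: False
      show ?thesis
      proof (cases "j dvd m \<and> q_part k j dvd m div j")
        case False
        then show ?thesis using exp_fps_nonneg[of "log_majorant j" m] nonneg by (auto simp: cycle_fps_nth root_weight_def)
      next
        case True
        then have s0: "m div j > 0" using m j by (auto elim: dvdE)
        have "q_part k j \<ge> 2" using q_part_ge_2[OF k] j by auto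
        moreover have "q_part k j \<le> m div j" using True s0 by (intro dvd_imp_le) auto
        ultimately have s: "m div j \<ge> 2" by simp
        have "norm (fps_nth (cycle_fps j (root_weight k d j)) m) = norm (d j) ^ (m div j) / (real j ^ (m div j) * fact (m div j))"
          using True by (simp add: cycle_fps_nth root_weight_def norm_divide norm_mult norm_power)
        also have "\<dots> \<le> 1 / (real j ^ (m div j) * fact (m div j))"
          using d[of j] j by (intro divide_right_mono power_le_one) auto
        also have "\<dots> = log_majorant j m / m" using True s m by (simp add: log_majorant_def)
        also have "\<dots> \<le> fps_nth (exp_fps (log_majorant j)) m"
          by (rule exp_fps_nth_ge) (use nonneg m in auto)
        finally show ?thesis .
      qed
    qed
  qed
  also have "\<dots> = fps_nth (exp_fps (\<lambda>m. \<Sum>j\<in>?A. log_majorant j m)) n" by (simp only: exp_fps_prod[OF fin])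
  also have "\<dots> \<le> majorant n" unfolding majorant_def
  proof (rule exp_fps_mono)
    fix m :: nat assume m: "1 \<le> m"
    have "(\<Sum>j\<in>?A. log_majorant j m) \<le> (\<Sum>j=1..J. log_majorant j m)" by (rule sum_mono2) (auto simp: nonneg)
    then show "(\<Sum>j\<in>?A. log_majorant j m) \<le> exp 2 / m" using sum_log_majorant_le[OF m, of J] by linarith
  qed (simp add: sum_nonneg nonneg)
  finally show ?thesis .
qed

lemma norm_noncoprime_coeff_le:
  fixes d :: "nat \<Rightarrow> 'a::{real_normed_field,field_char_0}"
  assumes "k > 0" "\<And>j. 1 \<le> j \<Longrightarrow> norm (d j) \<le> 1"
  shows "norm (noncoprime_coeff k d n) \<le> majorant n"
  unfolding noncoprime_coeff_def by (rule norm_noncoprime_prod_le[OF assms])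

text \<open>The value at 1 of the factor of length \<open>j\<close>, written as in the
  theorem.\<close>

definition local_factor :: "nat \<Rightarrow> nat \<Rightarrow> complex \<Rightarrow> complex" where
  "local_factor k j c = 1 + (\<Sum>\<^sub>\<infinity>s\<in>{s. 1 \<le> s \<and> q_part k j dvd s}. c ^ s / (of_nat j ^ s * fact s))"

lemma cycle_fps_root_weight_sums:
  assumes j: "j \<ge> 1"
  shows "fps_nth (cycle_fps j (root_weight k d j)) sums local_factor k j (d j)"
    and "summable (\<lambda>n. norm (fps_nth (cycle_fps j (root_weight k d j)) n))"
proof -
  let ?F = "fps_nth (cycle_fps j (root_weight k d j))"
  define u where "u = (\<lambda>s. d j ^ s / (of_nat j ^ s * fact s) :: complex)"
  have u_abs: "summable (\<lambda>s. norm (u s))"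
  proof -
    have "norm (u s) = (norm (d j) / j) ^ s /\<^sub>R fact s" for s
      using j by (simp add: u_def norm_divide norm_mult norm_power power_divide field_simps)
    then show ?thesis using summable_exp_generic[of "norm (d j) / j"] by simp
  qed
  define v where "v = (\<lambda>s. if q_part k j dvd s then u s else 0)"
  have v_abs: "summable (\<lambda>s. norm (v s))"
    by (rule summable_comparison_test'[OF u_abs, of 0]) (simp add: v_def)
  have Fv: "?F (j * s) = v s" for s using j by (simp add: cycle_fps_nth root_weight_def v_def u_def)
  have F0: "?F n = 0" if "n \<notin> range (\<lambda>s. j * s)" for n
    using that by (auto simp: cycle_fps_nth elim!: dvdE)
  have mono: "strict_mono (\<lambda>s. j * s)" using j by (simp add: strict_mono_def)
  have v_split: "v = (\<lambda>s. (if s = 0 then 1 else 0) + (if s \<in> {s. 1 \<le> s \<and> q_part k j dvd s} then u s else 0))"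
    by (auto simp: v_def u_def fun_eq_iff)
  have "(u has_sum infsum u {s. 1 \<le> s \<and> q_part k j dvd s}) {s. 1 \<le> s \<and> q_part k j dvd s}"
  proof (rule has_sum_infsum)
    have "u summable_on UNIV" by (rule norm_summable_imp_summable_on[OF u_abs])
    then show "u summable_on {s. 1 \<le> s \<and> q_part k j dvd s}" by (rule summable_on_subset_banach) simp
  qed
  then have "((\<lambda>s. if s \<in> {s. 1 \<le> s \<and> q_part k j dvd s} then u s else 0) has_sum
      infsum u {s. 1 \<le> s \<and> q_part k j dvd s}) UNIV"
    by (rule has_sum_cong_neutral[THEN iffD1, rotated -1]) auto
  then have "(\<lambda>s. if s \<in> {s. 1 \<le> s \<and> q_part k j dvd s} then u s else 0) sums infsum u {s. 1 \<le> s \<and> q_part k j dvd s}"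
    by (rule has_sum_imp_sums)
  then have "v sums (1 + infsum u {s. 1 \<le> s \<and> q_part k j dvd s})"
    unfolding v_split by (intro sums_add) (use sums_single[of 0 "\<lambda>_. 1::complex"] in auto)
  then have "(\<lambda>s. ?F (j * s)) sums local_factor k j (d j)" by (simp add: Fv local_factor_def u_def)
  then show "?F sums local_factor k j (d j)" using sums_mono_reindex[OF mono, of ?F] F0 by simp
  have "summable (\<lambda>s. norm (?F (j * s)))" using v_abs by (simp add: Fv)
  then show "summable (\<lambda>n. norm (?F n))"
    using summable_mono_reindex[OF mono, of "\<lambda>n. norm (?F n)"] F0 by simp
qed

text \<open>Coefficients stabilize and have a summable majorant, so Tannery's theorem exchanges the
  infinite product with the evaluation at 1.\<close>

lemma prod_local_factor_tendsto:
  assumes k: "k > 0" and d: "\<And>j. 1 \<le> j \<Longrightarrow> norm (d j) \<le> 1"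
  shows "(\<lambda>J. \<Prod>j\<in>{j. 1 \<le> j \<and> j \<le> J \<and> gcd j k > 1}. local_factor k j (d j)) \<longlonglongrightarrow> (\<Sum>n. noncoprime_coeff k d n)"
proof -
  have "(\<lambda>J. \<Sum>n. fps_nth (noncoprime_prod k d J) n) \<longlonglongrightarrow> (\<Sum>n. noncoprime_coeff k d n)"
  proof (rule tannerys_theorem[THEN conjunct2, THEN conjunct2])
    fix n
    have "eventually (\<lambda>J. noncoprime_coeff k d n = fps_nth (noncoprime_prod k d J) n) sequentially"
      using eventually_ge_at_top[of n] by eventually_elim (simp add: noncoprime_prod_nth)
    then show "(\<lambda>J. fps_nth (noncoprime_prod k d J) n) \<longlonglongrightarrow> noncoprime_coeff k d n"
      by (rule Lim_transform_eventually[OF tendsto_const])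
  next
    show "eventually (\<lambda>(n, J). norm (fps_nth (noncoprime_prod k d J) n) \<le> majorant n) (at_top \<times>\<^sub>F sequentially)"
      using norm_noncoprime_prod_le[OF assms] by (intro always_eventually) auto
  qed (rule summable_majorant, simp)
  moreover have "(\<Sum>n. fps_nth (noncoprime_prod k d J) n) = (\<Prod>j\<in>{j. 1 \<le> j \<and> j \<le> J \<and> gcd j k > 1}. local_factor k j (d j))" for J
  proof -
    have "finite {j. 1 \<le> j \<and> j \<le> J \<and> gcd j k > 1}" by (rule finite_subset[of _ "{..J}"]) auto
    then have "fps_nth (noncoprime_prod k d J) sums (\<Prod>j\<in>{j. 1 \<le> j \<and> j \<le> J \<and> gcd j k > 1}. local_factor k j (d j))"
      unfolding noncoprime_prod_def
      by (intro fps_prod_sums[THEN conjunct1]) (auto intro: cycle_fps_root_weight_sums)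
    then show ?thesis by (simp add: sums_iff)
  qed
  ultimately show ?thesis by simp
qed

section \<open>Asymptotics of the mean value\<close>

context coprime_lengths
begin

text \<open>The uniform asymptotics at \<open>Y = 1\<close>, where
  \<open>coprime_harm 0 = 0\<close>.\<close>

lemma rough_coeff_1_tendsto: "\<exists>\<kappa>>0. (\<lambda>n. rough_coeff 1 n / real n powr (theta - 1)) \<longlonglongrightarrow> \<kappa>"
proof -
  obtain \<kappa> c C where k: "\<kappa> > 0" "c > 0"
    and gk: "\<And>Y n. Y \<ge> 1 \<Longrightarrow> n \<ge> 2 * Y \<Longrightarrow> \<bar>exp (coprime_harm (Y - 1)) * rough_coeff Y n - \<kappa> * real n powr (theta - 1)\<bar>
         \<le> C * real n powr (theta - 1) * (real Y / real n) powr c"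
    using rough_coeff_regularity by metis
  have "(\<lambda>n. C * (1 / real n) powr c) \<longlonglongrightarrow> 0"
  proof -
    have "(\<lambda>n. (1 / real n) powr c) \<longlonglongrightarrow> 0" using k by real_asymp
    then show ?thesis by (rule tendsto_mult_right_zero)
  qed
  moreover have "eventually (\<lambda>n. norm (rough_coeff 1 n / real n powr (theta - 1) - \<kappa>) \<le> C * (1 / real n) powr c) sequentially"
    using eventually_ge_at_top[of 2]
  proof eventually_elim
    case (elim n)
    define P where "P = real n powr (theta - 1)"
    have P: "P > 0" using elim by (simp add: P_def)
    have "\<bar>exp (coprime_harm (1 - 1)) * rough_coeff 1 n - \<kappa> * P\<bar> \<le> C * P * (real 1 / real n) powr c"
      unfolding P_def by (rule gk) (use elim in auto)
    then have "\<bar>rough_coeff 1 n - \<kappa> * P\<bar> / P \<le> C * (1 / real n) powr c"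
      using P by (simp add: coprime_harm_def pos_divide_le_eq mult_ac)
    moreover have "rough_coeff 1 n / P - \<kappa> = (rough_coeff 1 n - \<kappa> * P) / P" using P by (simp add: diff_divide_distrib)
    ultimately show ?case using P unfolding P_def[symmetric] by simp
  qed
  ultimately have "(\<lambda>n. rough_coeff 1 n / real n powr (theta - 1) - \<kappa>) \<longlonglongrightarrow> 0" by (rule Lim_null_comparison[rotated])
  then show ?thesis using k(1) LIM_zero_iff by blast
qed

text \<open>\<open>A\<close> may oscillate, so differences instead of limits are estimated.
  Tannery's theorem handles \<open>m \<le> n / 2\<close> (\<open>a\<close>); for larger
  \<open>m\<close> the majorant is o(1 / n) while the \<open>x\<close> have total O(n^theta)
  (\<open>b\<close>); finally the truncated sum of \<open>h\<close> is completed
  (\<open>c\<close>).\<close>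

lemma convolution_asymp:
  fixes h x :: "nat \<Rightarrow> complex" and A :: "nat \<Rightarrow> complex"
  assumes h: "\<And>m. cmod (h m) \<le> majorant m"
    and x: "\<And>n. cmod (x n) \<le> rough_coeff 1 n"
    and A: "\<And>n. cmod (A n) \<le> 1" "\<And>m. (\<lambda>n. A (n + m) - A n) \<longlonglongrightarrow> 0"
    and lim: "(\<lambda>n. x n / of_real (real n powr (theta - 1)) - of_real \<kappa> * A n) \<longlonglongrightarrow> 0"
  shows "(\<lambda>n. (\<Sum>m\<le>n. h m * x (n - m)) / of_real (real n powr (theta - 1)) - of_real \<kappa> * A n * (\<Sum>m. h m)) \<longlonglongrightarrow> 0"
proof -
  define P where "P = (\<lambda>n. real n powr (theta - 1))"
  obtain C1 where C1: "C1 > 0" "\<And>n. n \<ge> 1 \<Longrightarrow> rough_sum 1 n \<le> C1 * real n powr theta"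
    using rough_bounds by (metis div_by_1 le_refl of_nat_1)
  obtain C where C: "C > 0" "\<And>n. n \<ge> 1 \<Longrightarrow> rough_coeff 1 n \<le> C * real n powr (theta - 1)"
    using rough_coeff_regularity by metis
  have sum_h: "summable (\<lambda>m. cmod (h m))"
    by (rule summable_comparison_test'[OF summable_majorant, of 0]) (use h in auto)
  have P_ratio: "P (n - m) \<le> 2 * P n" if "2 * m \<le> n" "n \<ge> 1" for n m
  proof -
    have "P (n - m) \<le> (n / 2) powr (theta - 1)" unfolding P_def
      by (rule powr_mono2') (use theta_le_1 that in auto)
    also have "\<dots> = 2 powr (1 - theta) * P n"
      by (simp add: P_def powr_divide powr_minus_divide[symmetric] powr_diff field_simps)
    also have "\<dots> \<le> 2 powr 1 * P n" using theta_pos by (intro mult_right_mono powr_mono) (auto simp: P_def)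
    finally show ?thesis by simp
  qed
  \<comment> \<open>The restriction gives \<open>P (n - m) \<le> 2 * P n\<close> and with it a
    dominating sequence; without it \<open>x (n - m) / P n\<close> has no such uniform
    bound.\<close>
  define a where "a = (\<lambda>m n. if 2 * m \<le> n \<and> n \<ge> 1 then h m * (x (n - m) / of_real (P n) - of_real \<kappa> * A n) else 0)"
  have "(\<lambda>n. \<Sum>m. a m n) \<longlonglongrightarrow> (\<Sum>m. 0)"
  proof (rule tannerys_theorem[THEN conjunct2, THEN conjunct2])
    fix m
    have ratio: "(\<lambda>n. P n / P (n + m)) \<longlonglongrightarrow> 1"
    proof -
      have "(\<lambda>n. real n powr (theta - 1) / (real n + real m) powr (theta - 1)) \<longlonglongrightarrow> 1" by real_asymp
      then show ?thesis by (simp add: P_def)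
    qed
    have "(\<lambda>n. complex_of_real (P n / P (n + m))) \<longlonglongrightarrow> of_real 1" by (intro tendsto_of_real ratio)
    then have r: "(\<lambda>n. complex_of_real (P n / P (n + m))) \<longlonglongrightarrow> 1" by simp
    have "(\<lambda>n. complex_of_real (P n / P (n + m)) - 1) \<longlonglongrightarrow> 0" using r by (rule LIM_zero)
    then have z: "(\<lambda>n. \<bar>\<kappa>\<bar> * norm (complex_of_real (P n / P (n + m)) - 1)) \<longlonglongrightarrow> 0"
      by (intro tendsto_mult_right_zero tendsto_norm_zero)
    have Az: "(\<lambda>n. of_real \<kappa> * A n * (of_real (P n / P (n + m)) - 1)) \<longlonglongrightarrow> 0"
    proof (rule Lim_null_comparison[OF always_eventually z], rule allI)
      fix n
      have "norm (of_real \<kappa> * A n) \<le> \<bar>\<kappa>\<bar> * 1" unfolding norm_mult by (intro mult_mono A) auto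
      then show "norm (of_real \<kappa> * A n * (of_real (P n / P (n + m)) - 1)) \<le> \<bar>\<kappa>\<bar> * norm (complex_of_real (P n / P (n + m)) - 1)"
        unfolding norm_mult[of "of_real \<kappa> * A n"] by (intro mult_right_mono) auto
    qed
    have limP: "(\<lambda>n. x n / of_real (P n) - of_real \<kappa> * A n) \<longlonglongrightarrow> 0" using lim by (simp add: P_def)
    have "(\<lambda>n. h m * ((x n / of_real (P n) - of_real \<kappa> * A n) * of_real (P n / P (n + m))
         + of_real \<kappa> * A n * (of_real (P n / P (n + m)) - 1) - of_real \<kappa> * (A (n + m) - A n))) \<longlonglongrightarrow>
         h m * (0 * 1 + 0 - of_real \<kappa> * 0)"
      by (rule tendsto_mult[OF tendsto_const tendsto_diff[OF tendsto_add[OF tendsto_mult[OF limP r] Az]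
            tendsto_mult[OF tendsto_const A(2)]]])
    moreover have "eventually (\<lambda>n. h m * ((x n / of_real (P n) - of_real \<kappa> * A n) * of_real (P n / P (n + m))
         + of_real \<kappa> * A n * (of_real (P n / P (n + m)) - 1) - of_real \<kappa> * (A (n + m) - A n)) = a m (n + m)) sequentially"
      using eventually_ge_at_top[of "Suc m"]
    proof eventually_elim
      case (elim n)
      then have "P n > 0" "P (n + m) > 0" by (auto simp: P_def)
      then show ?case using elim by (simp add: a_def field_simps)
    qed
    ultimately have "(\<lambda>n. a m (n + m)) \<longlonglongrightarrow> h m * (0 * 1 + 0 - of_real \<kappa> * 0)"
      by (rule Lim_transform_eventually)
    then show "(\<lambda>n. a m n) \<longlonglongrightarrow> 0" using LIMSEQ_offset by simp
  next
    have "norm (a m n) \<le> majorant m * (2 * C + \<bar>\<kappa>\<bar>)" for m n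
    proof (cases "2 * m \<le> n \<and> n \<ge> 1")
      case True
      then have P: "P n > 0" by (simp add: P_def)
      have nm: "n - m \<ge> 1" using True by linarith
      have "cmod (x (n - m)) \<le> C * P (n - m)" unfolding P_def by (rule order_trans[OF x C(2)[OF nm]])
      also have "\<dots> \<le> C * (2 * P n)" using P_ratio[of m n] True C(1) by (intro mult_left_mono) auto
      finally have 1: "cmod (x (n - m)) / P n \<le> 2 * C" using P by (simp add: pos_divide_le_eq)
      have 2: "cmod (of_real \<kappa> * A n) \<le> \<bar>\<kappa>\<bar> * 1" unfolding norm_mult by (intro mult_mono A) auto
      have "cmod (x (n - m) / of_real (P n) - of_real \<kappa> * A n) \<le> cmod (x (n - m) / of_real (P n)) + cmod (of_real \<kappa> * A n)"
        by (rule norm_triangle_ineq4)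
      also have "\<dots> \<le> 2 * C + \<bar>\<kappa>\<bar>" using 1 2 P by (simp add: norm_divide)
      finally have "cmod (x (n - m) / of_real (P n) - of_real \<kappa> * A n) \<le> 2 * C + \<bar>\<kappa>\<bar>" .
      then show ?thesis using True h unfolding a_def
        by (simp only: if_True simp_thms norm_mult) (intro mult_mono majorant_nonneg norm_ge_zero, auto)
    next
      case False
      then show ?thesis unfolding a_def using majorant_nonneg[of m] C(1) by auto
    qed
    then show "eventually (\<lambda>(m, n). norm (a m n) \<le> majorant m * (2 * C + \<bar>\<kappa>\<bar>)) (at_top \<times>\<^sub>F sequentially)"
      by (intro always_eventually) auto
    show "summable (\<lambda>m. majorant m * (2 * C + \<bar>\<kappa>\<bar>))" by (rule summable_mult2[OF summable_majorant])
  qed simp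
  then have lim1: "(\<lambda>n. \<Sum>m. a m n) \<longlonglongrightarrow> 0" by simp
  define b where "b = (\<lambda>n. (\<Sum>m\<in>{Suc (n div 2)..n}. h m * x (n - m)) / of_real (P n))"
  have lim2: "b \<longlonglongrightarrow> 0"
  proof (rule LIMSEQ_I)
    fix e :: real assume e: "e > 0"
    define e' where "e' = e / (8 * C1)"
    have e': "e' > 0" using e C1 by (simp add: e'_def)
    have "eventually (\<lambda>n. n * majorant n < e') sequentially" using majorant_null e' by (rule order_tendstoD)
    then obtain N where N: "\<And>n. n \<ge> N \<Longrightarrow> n * majorant n < e'" unfolding eventually_sequentially by blast
    have "norm (b n - 0) < e" if n: "n \<ge> 2 * N + 1" for n
    proof -
      have P: "P n > 0" using n by (simp add: P_def)
      have np: "real n > 0" using n by simp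
      have mj: "majorant m \<le> 2 * e' / n" if m: "m \<in> {Suc (n div 2)..n}" for m
      proof -
        have "m \<ge> N" "n \<le> 2 * m" using m n by auto
        then have "majorant m * n \<le> majorant m * (2 * m)"
          using majorant_nonneg by (intro mult_left_mono) auto
        also have "\<dots> \<le> 2 * e'" using N[OF \<open>m \<ge> N\<close>] by (simp add: mult_ac)
        finally show ?thesis using np by (simp add: pos_le_divide_eq)
      qed
      have "cmod (\<Sum>m\<in>{Suc (n div 2)..n}. h m * x (n - m)) \<le> (\<Sum>m\<in>{Suc (n div 2)..n}. 2 * e' / n * rough_coeff 1 (n - m))"
      proof (rule sum_norm_le)
        fix m assume m: "m \<in> {Suc (n div 2)..n}"
        show "norm (h m * x (n - m)) \<le> 2 * e' / n * rough_coeff 1 (n - m)"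
          unfolding norm_mult by (intro mult_mono order_trans[OF h mj[OF m]] x) (use e' in auto)
      qed
      also have "\<dots> = 2 * e' / n * (\<Sum>m\<in>{Suc (n div 2)..n}. rough_coeff 1 (n - m))" by (simp only: sum_distrib_left)
      also have "\<dots> \<le> 2 * e' / n * (C1 * (n * P n))"
      proof (rule mult_left_mono)
        have "(\<Sum>m\<in>{Suc (n div 2)..n}. rough_coeff 1 (n - m)) = (\<Sum>i\<in>(\<lambda>m. n - m) ` {Suc (n div 2)..n}. rough_coeff 1 i)"
          by (subst sum.reindex) (auto simp: inj_on_def)
        also have "\<dots> \<le> rough_sum 1 n" unfolding rough_sum_def
          by (rule sum_mono2) (use n in \<open>auto simp: rough_coeff_nonneg\<close>)
        also have "rough_sum 1 n \<le> C1 * real n powr theta" by (rule C1(2)) (use n in simp)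
        also have "real n powr theta = n * P n" using np by (simp add: P_def powr_diff)
        finally show "(\<Sum>m\<in>{Suc (n div 2)..n}. rough_coeff 1 (n - m)) \<le> C1 * (n * P n)" .
      qed (use e' np in auto)
      also have "\<dots> = e / 4 * P n" using C1(1) np by (simp add: e'_def)
      also have "\<dots> < e * P n" using e P by simp
      finally show ?thesis using P by (simp add: b_def norm_divide pos_divide_less_eq)
    qed
    then show "\<exists>no. \<forall>n\<ge>no. norm (b n - 0) < e" by blast
  qed
  define c where "c = (\<lambda>n. of_real \<kappa> * A n * ((\<Sum>m<Suc (n div 2). h m) - (\<Sum>m. h m)))"
  have lim3: "c \<longlonglongrightarrow> 0"
  proof -
    have "(\<lambda>n. \<Sum>m<n. h m) \<longlonglongrightarrow> (\<Sum>m. h m)"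
      using summable_LIMSEQ[OF summable_norm_cancel[OF sum_h]] .
    moreover have "filterlim (\<lambda>n::nat. Suc (n div 2)) at_top sequentially"
      unfolding filterlim_at_top eventually_sequentially
    proof
      fix Z :: nat
      show "\<exists>N. \<forall>n\<ge>N. Z \<le> Suc (n div 2)" by (rule exI[of _ "2 * Z"]) auto
    qed
    ultimately have "(\<lambda>n. \<Sum>m<Suc (n div 2). h m) \<longlonglongrightarrow> (\<Sum>m. h m)" by (rule filterlim_compose)
    then have "(\<lambda>n. (\<Sum>m<Suc (n div 2). h m) - (\<Sum>m. h m)) \<longlonglongrightarrow> 0" by (rule LIM_zero)
    then have z: "(\<lambda>n. \<bar>\<kappa>\<bar> * norm ((\<Sum>m<Suc (n div 2). h m) - (\<Sum>m. h m))) \<longlonglongrightarrow> 0"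
      by (intro tendsto_mult_right_zero tendsto_norm_zero)
    show ?thesis
    proof (rule Lim_null_comparison[OF always_eventually z], rule allI)
      fix n
      have "norm (of_real \<kappa> * A n) \<le> \<bar>\<kappa>\<bar> * 1" unfolding norm_mult by (intro mult_mono A) auto
      then show "norm (c n) \<le> \<bar>\<kappa>\<bar> * norm ((\<Sum>m<Suc (n div 2). h m) - (\<Sum>m. h m))"
        unfolding c_def norm_mult[of "of_real \<kappa> * A n"] by (intro mult_right_mono) auto
    qed
  qed
  have "(\<lambda>n. (\<Sum>m. a m n) + b n + c n) \<longlonglongrightarrow> 0 + 0 + 0" by (intro tendsto_add lim1 lim2 lim3)
  moreover have "eventually (\<lambda>n. (\<Sum>m. a m n) + b n + c n =
      (\<Sum>m\<le>n. h m * x (n - m)) / of_real (P n) - of_real \<kappa> * A n * (\<Sum>m. h m)) sequentially"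
    using eventually_ge_at_top[of 1]
  proof eventually_elim
    case (elim n)
    have "(\<Sum>m. a m n) = (\<Sum>m<Suc (n div 2). a m n)"
      by (rule suminf_finite) (auto simp: a_def)
    also have "\<dots> = (\<Sum>m<Suc (n div 2). h m * x (n - m) / of_real (P n) - of_real \<kappa> * A n * h m)"
      by (rule sum.cong) (use elim in \<open>auto simp: a_def algebra_simps\<close>)
    also have "\<dots> = (\<Sum>m<Suc (n div 2). h m * x (n - m)) / of_real (P n) - of_real \<kappa> * A n * (\<Sum>m<Suc (n div 2). h m)"
      by (simp only: sum_subtractf sum_divide_distrib sum_distrib_left)
    finally have 1: "(\<Sum>m. a m n) = (\<Sum>m<Suc (n div 2). h m * x (n - m)) / of_real (P n) - of_real \<kappa> * A n * (\<Sum>m<Suc (n div 2). h m)" .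
    have "{..n} = {..<Suc (n div 2)} \<union> {Suc (n div 2)..n}" by auto
    then have 2: "(\<Sum>m\<le>n. h m * x (n - m)) = (\<Sum>m<Suc (n div 2). h m * x (n - m)) + (\<Sum>m\<in>{Suc (n div 2)..n}. h m * x (n - m))"
      by (simp only:) (rule sum.union_disjoint; auto)
    show ?case unfolding 1 2 b_def c_def by (simp add: add_divide_distrib right_diff_distrib)
  qed
  ultimately have "(\<lambda>n. (\<Sum>m\<le>n. h m * x (n - m)) / of_real (P n) - of_real \<kappa> * A n * (\<Sum>m. h m)) \<longlonglongrightarrow> 0 + 0 + 0"
    by (rule Lim_transform_eventually)
  then show ?thesis by (simp add: P_def)
qed

text \<open>For coprime lengths \<open>q_part\<close> is 1, so their factors are full exponentials
  and combine to \<open>exp_fps\<close>.\<close>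

lemma cycle_index_coeff_eq:
  fixes d :: "nat \<Rightarrow> complex"
  shows "cycle_index_coeff k d n = (\<Sum>m\<le>n. noncoprime_coeff k d m * wexp d (n - m))"
proof -
  let ?A = "{j \<in> {1..n}. coprime j k}" and ?B = "{j. 1 \<le> j \<and> j \<le> n \<and> gcd j k > 1}"
  have gcd_pos: "gcd j k > 1 \<longleftrightarrow> \<not> coprime j k" for j
  proof -
    have "gcd j k > 0" using k_pos by simp
    then show ?thesis unfolding coprime_iff_gcd_eq_1 by linarith
  qed
  have split: "{1..n} = ?A \<union> ?B" "?A \<inter> ?B = {}" unfolding gcd_pos by auto
  have finB: "finite ?B" by (rule finite_subset[of _ "{..n}"]) auto
  have "(\<Prod>j=1..n. cycle_fps j (root_weight k d j)) = (\<Prod>j\<in>?A. cycle_fps j (root_weight k d j)) * noncoprime_prod k d n"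
    unfolding noncoprime_prod_def
    by (rule trans[OF prod.cong[OF split(1) refl] prod.union_disjoint[OF _ finB split(2)]]) simp
  also have "(\<Prod>j\<in>?A. cycle_fps j (root_weight k d j)) = (\<Prod>j\<in>?A. cycle_fps j (\<lambda>s. d j ^ s))"
    by (rule prod.cong) (auto simp: root_weight_def[abs_def] q_part_eq_1)
  also have "\<dots> = exp_fps (\<lambda>i. if i \<in> ?A then d i else 0)" by (rule prod_cycle_fps_power) auto
  finally have "cycle_index_coeff k d n = fps_nth (noncoprime_prod k d n * exp_fps (\<lambda>i. if i \<in> ?A then d i else 0)) n"
    by (simp add: cycle_index_coeff_def mult.commute)
  also have "\<dots> = (\<Sum>m\<le>n. fps_nth (noncoprime_prod k d n) m * fps_nth (exp_fps (\<lambda>i. if i \<in> ?A then d i else 0)) (n - m))"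
    by (simp add: fps_mult_nth atLeast0AtMost)
  also have "\<dots> = (\<Sum>m\<le>n. noncoprime_coeff k d m * wexp d (n - m))"
  proof (rule sum.cong[OF refl])
    fix m assume m: "m \<in> {..n}"
    have "fps_nth (exp_fps (\<lambda>i. if i \<in> ?A then d i else 0)) (n - m) = wexp d (n - m)"
      unfolding wexp_def by (rule exp_fps_cong) (use m in \<open>auto simp: chi_def\<close>)
    then show "fps_nth (noncoprime_prod k d n) m * fps_nth (exp_fps (\<lambda>i. if i \<in> ?A then d i else 0)) (n - m)
       = noncoprime_coeff k d m * wexp d (n - m)"
      using m by (simp add: noncoprime_prod_nth)
  qed
  finally show ?thesis .
qed

lemma wexp_1: "wexp (\<lambda>_. 1) n = of_real (rough_coeff 1 n)"
  unfolding wexp_def rough_coeff_1_eq by (simp add: exp_fps_of_real)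

text \<open>For weights 1 the coefficients are nonnegative reals with first coefficient 1.\<close>

lemma noncoprime_sum_nonzero: "(\<Sum>m. noncoprime_coeff k (\<lambda>_. 1 :: complex) m) \<noteq> 0"
proof -
  have nn: "noncoprime_coeff k (\<lambda>_. 1 :: complex) m = of_real (noncoprime_coeff k (\<lambda>_. 1 :: real) m)
     \<and> noncoprime_coeff k (\<lambda>_. 1 :: real) m \<ge> 0" for m
  proof -
    have fin: "finite {j. 1 \<le> j \<and> j \<le> m \<and> gcd j k > 1}" by (rule finite_subset[of _ "{..m}"]) auto
    have rw: "fps_nth (cycle_fps j (root_weight k (\<lambda>_. 1 :: complex) j)) i = of_real (fps_nth (cycle_fps j (root_weight k (\<lambda>_. 1 :: real) j)) i)"
      "fps_nth (cycle_fps j (root_weight k (\<lambda>_. 1 :: real) j)) i \<ge> 0" for i j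
      by (simp_all add: cycle_fps_nth root_weight_def)
    have "fps_nth (\<Prod>j\<in>B. cycle_fps j (root_weight k (\<lambda>_. 1 :: complex) j)) i =
        of_real (fps_nth (\<Prod>j\<in>B. cycle_fps j (root_weight k (\<lambda>_. 1 :: real) j)) i) \<and>
        fps_nth (\<Prod>j\<in>B. cycle_fps j (root_weight k (\<lambda>_. 1 :: real) j)) i \<ge> 0" if "finite B" for B i
      using that
    proof (induction B arbitrary: i)
      case (insert j B)
      then show ?case by (simp add: fps_mult_nth rw sum_nonneg)
    qed simp
    then show ?thesis unfolding noncoprime_coeff_def noncoprime_prod_def using fin by blast
  qed
  define u where "u = noncoprime_coeff k (\<lambda>_. 1 :: real)"
  have "summable u"
    by (rule summable_comparison_test'[OF summable_majorant, of 0])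
       (use norm_noncoprime_coeff_le[OF k_pos, of "\<lambda>_. 1 :: real"] in \<open>auto simp: u_def\<close>)
  moreover have "u 0 = 1"
  proof -
    have empty: "{j::nat. 1 \<le> j \<and> j \<le> 0 \<and> gcd j k > 1} = {}" by auto
    show ?thesis unfolding u_def noncoprime_coeff_def noncoprime_prod_def empty by simp
  qed
  ultimately have "(\<Sum>m. u m) > 0" using nn by (intro suminf_pos2[of _ 0]) (auto simp: u_def)
  moreover have "(\<Sum>m. noncoprime_coeff k (\<lambda>_. 1 :: complex) m) = of_real (\<Sum>m. u m)" unfolding u_def
    using nn \<open>summable u\<close> by (simp add: suminf_of_real u_def)
  ultimately show ?thesis by simp
qed

text \<open>Common frame for both cases: \<open>A\<close> is 0 if the series diverges and
  \<open>mean_factor d\<close> if it converges. The constant \<open>\<kappa>\<close> cancels in the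
  quotient.\<close>

lemma mean_asymp:
  fixes d :: "nat \<Rightarrow> complex"
  assumes d: "\<And>j. 1 \<le> j \<Longrightarrow> cmod (d j) \<le> 1"
    and A: "\<And>n. cmod (A n) \<le> 1" "\<And>m. (\<lambda>n. A (n + m) - A n) \<longlonglongrightarrow> 0"
    and near: "\<And>\<epsilon>. \<epsilon> > 0 \<Longrightarrow>
      eventually (\<lambda>n. cmod (wexp d n - of_real (rough_coeff 1 n) * A n) \<le> \<epsilon> * real n powr (theta - 1)) sequentially"
  shows "(\<lambda>n. mean_power_perms k n (mult_fun d n)
     - A n * ((\<Sum>m. noncoprime_coeff k d m) / (\<Sum>m. noncoprime_coeff k (\<lambda>_. 1) m))) \<longlonglongrightarrow> 0"
proof -
  define P where "P = (\<lambda>n. real n powr (theta - 1))"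
  define Sd where "Sd = (\<Sum>m. noncoprime_coeff k d m)"
  define S1 where "S1 = (\<Sum>m. noncoprime_coeff k (\<lambda>_. 1 :: complex) m)"
  obtain \<kappa> where kappa: "\<kappa> > 0" "(\<lambda>n. rough_coeff 1 n / P n) \<longlonglongrightarrow> \<kappa>" using rough_coeff_1_tendsto unfolding P_def by blast
  have lim: "(\<lambda>n. wexp d n / of_real (P n) - of_real \<kappa> * A n) \<longlonglongrightarrow> 0"
  proof -
    have "(\<lambda>n. (wexp d n - of_real (rough_coeff 1 n) * A n) / of_real (P n)) \<longlonglongrightarrow> 0"
    proof (rule tendstoI)
      fix e :: real assume e: "e > 0"
      show "eventually (\<lambda>n. dist ((wexp d n - of_real (rough_coeff 1 n) * A n) / of_real (P n)) 0 < e) sequentially"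
        using near[OF half_gt_zero[OF e]] eventually_ge_at_top[of 1]
      proof eventually_elim
        case (elim n)
        have P: "P n > 0" using elim by (simp add: P_def)
        have "cmod (wexp d n - of_real (rough_coeff 1 n) * A n) \<le> e / 2 * P n" using elim by (simp add: P_def)
        also have "\<dots> < e * P n" using e P by simp
        finally show ?case using P by (simp add: norm_divide pos_divide_less_eq)
      qed
    qed
    moreover have "(\<lambda>n. of_real (rough_coeff 1 n / P n - \<kappa>) * A n) \<longlonglongrightarrow> 0"
    proof (rule Lim_null_comparison[OF always_eventually], rule allI)
      show "(\<lambda>n. \<bar>rough_coeff 1 n / P n - \<kappa>\<bar>) \<longlonglongrightarrow> 0" using kappa(2) LIM_zero tendsto_rabs_zero by blast
      show "norm (of_real (rough_coeff 1 n / P n - \<kappa>) * A n) \<le> \<bar>rough_coeff 1 n / P n - \<kappa>\<bar>" for n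
        using A(1)[of n] unfolding norm_mult norm_of_real by (simp add: mult_left_le)
    qed
    ultimately have "(\<lambda>n. (wexp d n - of_real (rough_coeff 1 n) * A n) / of_real (P n) + of_real (rough_coeff 1 n / P n - \<kappa>) * A n) \<longlonglongrightarrow> 0 + 0"
      by (rule tendsto_add)
    then show ?thesis by (simp add: diff_divide_distrib left_diff_distrib)
  qed
  have lim1: "(\<lambda>n. wexp (\<lambda>_. 1) n / of_real (P n) - of_real \<kappa> * 1) \<longlonglongrightarrow> 0"
  proof -
    have "(\<lambda>n. complex_of_real (rough_coeff 1 n / P n)) \<longlonglongrightarrow> of_real \<kappa>" by (intro tendsto_of_real kappa(2))
    then have "(\<lambda>n. complex_of_real (rough_coeff 1 n / P n) - of_real \<kappa>) \<longlonglongrightarrow> 0" by (rule LIM_zero)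
    then show ?thesis unfolding wexp_1 by simp
  qed
  have num: "(\<lambda>n. cycle_index_coeff k d n / of_real (P n) - of_real \<kappa> * A n * Sd) \<longlonglongrightarrow> 0"
    unfolding cycle_index_coeff_eq Sd_def P_def
    by (rule convolution_asymp[OF _ _ A lim[unfolded P_def]])
       (use norm_noncoprime_coeff_le[OF k_pos d] norm_wexp_le[OF d] in auto)
  have den0: "(\<lambda>n. cycle_index_coeff k (\<lambda>_. 1) n / of_real (P n) - of_real \<kappa> * 1 * S1) \<longlonglongrightarrow> 0"
    unfolding cycle_index_coeff_eq S1_def P_def
    by (rule convolution_asymp[OF _ _ _ _ lim1[unfolded P_def]])
       (use norm_noncoprime_coeff_le[OF k_pos, of "\<lambda>_. 1 :: complex"] norm_wexp_le[of "\<lambda>_. 1"] in auto)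
  then have den: "(\<lambda>n. cycle_index_coeff k (\<lambda>_. 1) n / of_real (P n)) \<longlonglongrightarrow> of_real \<kappa> * S1"
    using LIM_zero_cancel by fastforce
  have S1: "S1 \<noteq> 0" unfolding S1_def by (rule noncoprime_sum_nonzero)
  have kS: "of_real \<kappa> * S1 \<noteq> 0" using S1 kappa(1) by simp
  have q: "(\<lambda>n. (cycle_index_coeff k d n / of_real (P n) - of_real \<kappa> * A n * Sd) / (cycle_index_coeff k (\<lambda>_. 1) n / of_real (P n))) \<longlonglongrightarrow> 0 / (of_real \<kappa> * S1)"
    by (rule tendsto_divide[OF num den kS])
  have r: "(\<lambda>n. of_real \<kappa> * Sd / (cycle_index_coeff k (\<lambda>_. 1) n / of_real (P n)) - of_real \<kappa> * Sd / (of_real \<kappa> * S1)) \<longlonglongrightarrow> 0"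
    by (rule LIM_zero, rule tendsto_divide[OF tendsto_const den kS])
  have r': "(\<lambda>n. A n * (of_real \<kappa> * Sd / (cycle_index_coeff k (\<lambda>_. 1) n / of_real (P n)) - of_real \<kappa> * Sd / (of_real \<kappa> * S1))) \<longlonglongrightarrow> 0"
  proof (rule Lim_null_comparison[OF always_eventually tendsto_norm_zero[OF r]], rule allI)
    fix n
    show "norm (A n * (of_real \<kappa> * Sd / (cycle_index_coeff k (\<lambda>_. 1) n / of_real (P n)) - of_real \<kappa> * Sd / (of_real \<kappa> * S1)))
      \<le> norm (of_real \<kappa> * Sd / (cycle_index_coeff k (\<lambda>_. 1) n / of_real (P n)) - of_real \<kappa> * Sd / (of_real \<kappa> * S1))"
      by (subst norm_mult) (rule mult_left_le_one_le, use A(1) in auto)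
  qed
  have "(\<lambda>n. (cycle_index_coeff k d n / of_real (P n) - of_real \<kappa> * A n * Sd) / (cycle_index_coeff k (\<lambda>_. 1) n / of_real (P n))
      + A n * (of_real \<kappa> * Sd / (cycle_index_coeff k (\<lambda>_. 1) n / of_real (P n)) - of_real \<kappa> * Sd / (of_real \<kappa> * S1))) \<longlonglongrightarrow> 0 / (of_real \<kappa> * S1) + 0"
    by (rule tendsto_add[OF q r'])
  moreover have "eventually (\<lambda>n. (cycle_index_coeff k d n / of_real (P n) - of_real \<kappa> * A n * Sd) / (cycle_index_coeff k (\<lambda>_. 1) n / of_real (P n))
      + A n * (of_real \<kappa> * Sd / (cycle_index_coeff k (\<lambda>_. 1) n / of_real (P n)) - of_real \<kappa> * Sd / (of_real \<kappa> * S1))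
      = mean_power_perms k n (mult_fun d n) - A n * (Sd / S1)) sequentially"
    using eventually_ge_at_top[of 1]
  proof eventually_elim
    case (elim n)
    define p where "p = complex_of_real (P n)"
    define N where "N = cycle_index_coeff k d n"
    define D where "D = cycle_index_coeff k (\<lambda>_. 1 :: complex) n"
    have p: "p \<noteq> 0" using elim by (simp add: p_def P_def)
    have c: "of_real \<kappa> * Sd / (of_real \<kappa> * S1) = Sd / S1" using kappa(1) by simp
    have m: "mean_power_perms k n (mult_fun d n) = N / D" by (simp add: mean_power_perms_eq[OF k_pos] N_def D_def)
    \<comment> \<open>At \<open>D = 0\<close> division by zero gives 0, and both sides equal
      \<open>- A n * (Sd / S1)\<close>.\<close>
    have "(N / p - of_real \<kappa> * A n * Sd) / (D / p) + A n * (of_real \<kappa> * Sd / (D / p) - Sd / S1) = N / D - A n * (Sd / S1)"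
      using p by (cases "D = 0") (simp_all add: field_simps)
    then show ?case unfolding c m p_def N_def D_def .
  qed
  ultimately have "(\<lambda>n. mean_power_perms k n (mult_fun d n) - A n * (Sd / S1)) \<longlonglongrightarrow> 0 / (of_real \<kappa> * S1) + 0"
    by (rule Lim_transform_eventually)
  then show ?thesis by (simp add: Sd_def S1_def)
qed

text \<open>The terms are nonnegative, so unordered summability over the coprime \<open>j\<close> is
  ordinary convergence of the series weighted by \<open>chi\<close>; at \<open>j = 0\<close> the
  quotient is 0.\<close>

lemma summable_on_coprime_iff:
  fixes d :: "nat \<Rightarrow> complex"
  assumes d: "\<And>j. 1 \<le> j \<Longrightarrow> cmod (d j) \<le> 1"
  shows "(\<lambda>j. (1 - Re (d j)) / real j) summable_on {j. j \<ge> 1 \<and> coprime j k} \<longleftrightarrow>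
     summable (\<lambda>j. chi j * (1 - Re (d j)) / j)"
proof -
  have "(\<lambda>j. (1 - Re (d j)) / real j) summable_on {j. j \<ge> 1 \<and> coprime j k} \<longleftrightarrow>
      (\<lambda>j. chi j * (1 - Re (d j)) / j) summable_on UNIV"
    by (rule summable_on_cong_neutral) (auto simp: chi_def not_le)
  also have "\<dots> \<longleftrightarrow> summable (\<lambda>j. chi j * (1 - Re (d j)) / j)"
  proof (rule summable_on_UNIV_nonneg_real_iff)
    fix j
    show "0 \<le> chi j * (1 - Re (d j)) / real j"
    proof (cases "j = 0")
      case False
      then have "Re (d j) \<le> 1" using order_trans[OF complex_Re_le_cmod d] by simp
      then show ?thesis by simp
    qed simp
  qed
  finally show ?thesis .
qed

section \<open>The two cases of the theorem\<close>

lemma mean_power_perms_tendsto_0: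
  assumes d: "\<And>j. 1 \<le> j \<Longrightarrow> cmod (d j) \<le> 1"
    and div: "\<And>z. cmod z = 1 \<Longrightarrow> \<not> summable (\<lambda>j. chi j * (1 - Re (d j * z ^ j)) / j)"
  shows "(\<lambda>n. mean_power_perms k n (mult_fun d n)) \<longlonglongrightarrow> 0"
  using mean_asymp[of d "\<lambda>_. 0"] d wexp_tendsto_0[OF d div] by simp

lemma mean_power_perms_asymp:
  assumes d: "\<And>j. 1 \<le> j \<Longrightarrow> cmod (d j) \<le> 1"
    and conv: "summable (\<lambda>j. chi j * (1 - Re (d j)) / j)"
  shows "(\<lambda>n. mean_power_perms k n (mult_fun d n) - mean_factor d n *
    (\<Prod>j\<in>{j. 1 \<le> j \<and> j \<le> n \<and> gcd j k > 1}. local_factor k j (d j) / local_factor k j 1)) \<longlonglongrightarrow> 0"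
proof -
  note nf = norm_mean_factor_le[OF d conv]
  have shift: "(\<lambda>n. mean_factor d (n + m) - mean_factor d n) \<longlonglongrightarrow> 0" for m
  proof (rule tendstoI)
    fix e :: real assume e: "e > 0"
    show "eventually (\<lambda>n. dist (mean_factor d (n + m) - mean_factor d n) 0 < e) sequentially"
    proof -
      have "eventually (\<lambda>n. 2 * real m / (real n + 1) < e) sequentially"
        using e by real_asymp
      then show ?thesis
      proof eventually_elim
        case (elim n)
        have "cmod (mean_factor d n - mean_factor d (n + m)) \<le> 2 * real m / (real n + 1)"
          by (rule mean_factor_shift[OF d conv])
        then show ?case using elim by (simp add: norm_minus_commute)
      qed
    qed
  qed
  define Sd where "Sd = (\<Sum>m. noncoprime_coeff k d m)"
  define S1 where "S1 = (\<Sum>m. noncoprime_coeff k (\<lambda>_. 1 :: complex) m)"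
  have near: "(\<lambda>n. mean_power_perms k n (mult_fun d n) - mean_factor d n * (Sd / S1)) \<longlonglongrightarrow> 0"
    unfolding Sd_def S1_def
    by (rule mean_asymp[OF d nf shift wexp_near_mean[OF d conv]])
  define R where "R = (\<lambda>n. \<Prod>j\<in>{j. 1 \<le> j \<and> j \<le> n \<and> gcd j k > 1}. local_factor k j (d j) / local_factor k j 1)"
  have "S1 \<noteq> 0" unfolding S1_def by (rule noncoprime_sum_nonzero)
  then have "R \<longlonglongrightarrow> Sd / S1" unfolding R_def prod_dividef Sd_def S1_def
    using prod_local_factor_tendsto[OF k_pos, of "\<lambda>_. 1"]
    by (intro tendsto_divide prod_local_factor_tendsto[OF k_pos d]) auto
  then have "(\<lambda>n. Sd / S1 - R n) \<longlonglongrightarrow> Sd / S1 - Sd / S1" by (intro tendsto_intros)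
  then have z: "(\<lambda>n. norm (Sd / S1 - R n)) \<longlonglongrightarrow> 0" by (intro tendsto_norm_zero) simp
  have "(\<lambda>n. mean_factor d n * (Sd / S1 - R n)) \<longlonglongrightarrow> 0"
  proof (rule Lim_null_comparison[OF always_eventually z], rule allI)
    fix n
    show "norm (mean_factor d n * (Sd / S1 - R n)) \<le> norm (Sd / S1 - R n)"
      by (subst norm_mult) (rule mult_left_le_one_le, use nf in auto)
  qed
  then have "(\<lambda>n. (mean_power_perms k n (mult_fun d n) - mean_factor d n * (Sd / S1)) + mean_factor d n * (Sd / S1 - R n)) \<longlonglongrightarrow> 0 + 0"
    by (intro tendsto_add near)
  then show ?thesis by (simp add: R_def right_diff_distrib)
qed

end

theorem theorem18:
  fixes k :: nat and fhat :: "nat \<Rightarrow> complex"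
  assumes "k \<ge> 1"
    and "\<And>j. j \<ge> 1 \<Longrightarrow> norm (fhat j) \<le> 1"
  shows
    "((\<forall>x\<in>{-pi..pi}.
        \<not> (\<lambda>j. (1 - Re (fhat j * exp (- \<i> * of_real x * of_nat j))) / real j)
            summable_on {j. j \<ge> 1 \<and> coprime j k})
      \<longrightarrow> (\<lambda>n. mean_power_perms k n (mult_fun fhat n)) \<longlonglongrightarrow> 0)
    \<and>
     (\<forall>x0\<in>{-pi..pi}.
        (\<lambda>j. (1 - Re (fhat j * exp (- \<i> * of_real x0 * of_nat j))) / real j)
            summable_on {j. j \<ge> 1 \<and> coprime j k}
      \<longrightarrow> (\<lambda>n. mean_power_perms k n (mult_fun fhat n)
            - exp (\<i> * of_real x0 * of_nat n)
              * exp (\<Sum>j\<in>{j. 1 \<le> j \<and> j \<le> n \<and> coprime j k}.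
                       (fhat j * exp (- \<i> * of_real x0 * of_nat j) - 1) / of_nat j)
              * (\<Prod>j\<in>{j. 1 \<le> j \<and> j \<le> n \<and> gcd j k > 1}.
                   (1 + (\<Sum>\<^sub>\<infinity>s\<in>{s. 1 \<le> s \<and> q_part k j dvd s}.
                           (fhat j * exp (- \<i> * of_real x0 * of_nat j)) ^ s / (of_nat j ^ s * fact s)))
                 / (1 + (\<Sum>\<^sub>\<infinity>s\<in>{s. 1 \<le> s \<and> q_part k j dvd s}.
                           1 / (of_nat j ^ s * fact s)))))
          \<longlonglongrightarrow> 0)"
proof -
  interpret coprime_lengths k by standard (use assms(1) in simp)
  have exp_pow: "exp (- \<i> * of_real x * of_nat j) = exp (- \<i> * of_real x) ^ j" for x j
    by (rule exp_of_nat2_mult)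
  have bound: "cmod (fhat j * z ^ j) \<le> 1" if "1 \<le> j" "cmod z = 1" for j z
    using assms(2)[OF that(1)] that(2) by (simp add: norm_mult norm_power)
  show ?thesis
  proof (intro conjI impI ballI, goal_cases)
    case 1
    show ?case
    proof (rule mean_power_perms_tendsto_0[OF assms(2)])
      fix z :: complex assume z: "cmod z = 1"
      \<comment> \<open>The exponentials in the statement are taken at \<open>- x\<close>, so the
        point \<open>z\<close> of the circle belongs to \<open>x = - Arg z\<close>.\<close>
      have "- Arg z \<in> {-pi..pi}" using mpi_less_Arg[of z] Arg_le_pi[of z] by simp
      then have "\<not> (\<lambda>j. (1 - Re (fhat j * exp (- \<i> * of_real (- Arg z) * of_nat j))) / real j)
            summable_on {j. j \<ge> 1 \<and> coprime j k}" using 1 by blast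
      moreover have "exp (- \<i> * of_real (- Arg z)) = z"
      proof -
        have "z \<noteq> 0" using z by auto
        then have "of_real (cmod z) * exp (\<i> * of_real (Arg z)) = z" by (rule Arg_eq[symmetric])
        then show ?thesis by (simp add: z)
      qed
      ultimately have "\<not> (\<lambda>j. (1 - Re (fhat j * z ^ j)) / real j) summable_on {j. j \<ge> 1 \<and> coprime j k}"
        unfolding exp_pow by simp
      then show "\<not> summable (\<lambda>j. chi j * (1 - Re (fhat j * z ^ j)) / j)"
        using summable_on_coprime_iff[of "\<lambda>j. fhat j * z ^ j"] bound z by blast
    qed
  next
    case (2 x0)
    \<comment> \<open>The twist moves \<open>x0\<close> to 0; the mean for \<open>fhat\<close> is
      \<open>z ^ n\<close> times the mean for \<open>d\<close>, which explains the factor in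
      front.\<close>
    define d where "d = (\<lambda>j. fhat j * exp (- \<i> * of_real x0 * of_nat j))"
    define z where "z = exp (\<i> * of_real x0)"
    have d1: "cmod (d j) \<le> 1" if "1 \<le> j" for j
      unfolding d_def exp_pow by (rule bound[OF that]) simp
    have zn: "exp (\<i> * of_real x0 * of_nat n) = z ^ n" for n
      unfolding z_def by (rule exp_of_nat2_mult)
    have "exp (- \<i> * of_real x0 * of_nat j) * exp (\<i> * of_real x0 * of_nat j) = 1" for j
      by (simp add: exp_add[symmetric])
    then have dz: "(\<lambda>j. d j * z ^ j) = fhat" by (simp add: fun_eq_iff d_def mult.assoc flip: zn)
    have twist: "z ^ n * mean_power_perms k n (mult_fun d n) = mean_power_perms k n (mult_fun fhat n)" for n
      using mean_power_perms_twist[of k n d z] unfolding dz by (rule sym)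
    have "(\<Sum>j=1..n. of_real (chi j) * (d j - 1) / of_nat j)
          = (\<Sum>j\<in>{j. 1 \<le> j \<and> j \<le> n \<and> coprime j k}. (d j - 1) / of_nat j)" for n
      by (rule sum.mono_neutral_cong_right) (auto simp: chi_def)
    then have mf: "mean_factor d n = exp (\<Sum>j\<in>{j. 1 \<le> j \<and> j \<le> n \<and> coprime j k}. (d j - 1) / of_nat j)" for n
      by (simp add: mean_factor_def)
    have "summable (\<lambda>j. chi j * (1 - Re (d j)) / j)"
      using 2(2) summable_on_coprime_iff[of d] d1 by (simp add: d_def)
    note lim = tendsto_norm_zero[OF mean_power_perms_asymp[OF d1 this]]
    have "(\<lambda>n. z ^ n * (mean_power_perms k n (mult_fun d n) - mean_factor d n *
      (\<Prod>j\<in>{j. 1 \<le> j \<and> j \<le> n \<and> gcd j k > 1}. local_factor k j (d j) / local_factor k j 1))) \<longlonglongrightarrow> 0"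
      by (rule Lim_null_comparison[OF always_eventually lim]) (simp add: norm_mult norm_power z_def)
    then show ?case
      unfolding right_diff_distrib twist mf local_factor_def power_one zn
      unfolding d_def mult.assoc .
  qed
qed

end
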